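(* Let $M\ge0$ and let $(A_N)$, $(B_N)$ be $(M,0)$-regular sequences of normal matrices with limit moments $\Phi$, $\Psi$. Assume the HCIZ non-vanishing hypothesis \[ 0\notin\overline{\bigcup_{N\ge1}\{z\in\mathbb{C}:\mathbf{I}_N(z;A_N,B_N)=0\}}. \] Then there exists a domain $D\subseteq\{z:|z|<z_cM^{-2}\}$, $z_c=\frac{2}{27}$, containing $0$, on which every $\mathbf{F}_N(z;A_N,B_N)$ is defined and holomorphic, such that $\mathbf{F}_N(z;A_N,B_N)\to\mathbf{C}_0(z;\Phi,\Psi)$ uniformly on compact subsets of $D$ as $N\to\infty$.
   Context: A sequence $(A_N)$ of $N\times N$ normal matrices is $(M,0)$-regular with limit moments $\Phi=(\phi_k)_{k\ge1}$ if $\|A_N\|\le M$ for all $N$ and $N^{-1}\operatorname{Tr}(A_N^k)\to\phi_k$ for each $k\ge1$. $\mathbf{I}_N(z;A,B)=\int_{\mathrm{U}(N)}e^{-zN\operatorname{Tr}(AUBU^{-1})}\kappa_N(\mathrm{d}U)$ (normalized Haar measure $\kappa_N$) is entire with $\mathbf{I}_N(0)=1$; on any simply connected domain containing $0$ where $\mathbf{I}_N$ does not vanish, $\mathbf{F}_N(z;A,B)$ denotes the holomorphic function with $\mathbf{F}_N(0)=0$ and $\mathbf{I}_N=e^{N^2\mathbf{F}_N}$. $\mathbf{C}_0(z;\Phi,\Psi)=\sum_{d\ge1}C_{0,d}(\Phi,\Psi)z^d/d!$ with $C_{0,d}(\Phi,\Psi)=\sum_{\alpha,\beta\vdash d}(-1)^{d+\ell(\alpha)+\ell(\beta)}\vec{H}_0(\alpha,\beta)\phi_\alpha\psi_\beta$,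 where $\phi_\alpha=\prod_i\phi_{\alpha_i}$, $\psi_\beta=\prod_j\psi_{\beta_j}$, and $\vec{H}_0(\alpha,\beta)$ is the number of tuples $(\rho,\sigma,\tau_1,\dots,\tau_r)$ in $S(d)$ with $r=\ell(\alpha)+\ell(\beta)-2$, $\rho$ of cycle type $\alpha$, $\sigma$ of cycle type $\beta$, $\tau_i$ transpositions, $\rho\sigma\tau_1\cdots\tau_r=\mathrm{id}$, the generated group transitive on $\{1,\dots,d\}$, and $t_1\le\dots\le t_r$ where $\tau_i=(s_i\ t_i)$, $s_i<t_i$. *)

theory Defs
  imports
    "HOL-Probability.Probability"
    "HOL-Combinatorics.Orbits"
    "HOL-Algebra.Sym_Groups"
    "Jordan_Normal_Form.Schur_Decomposition"
begin

section \<open>Matrices\<close>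

definition mat_trace :: "complex mat \<Rightarrow> complex" where
  "mat_trace A = (\<Sum>i<dim_row A. A $$ (i, i))"

definition vec_l2_norm :: "complex vec \<Rightarrow> real" where
  "vec_l2_norm v = sqrt (\<Sum>i<dim_vec v. (cmod (vec_index v i))\<^sup>2)"

definition mat_op_norm :: "complex mat \<Rightarrow> real" where
  "mat_op_norm A =
     (SUP v\<in>{v \<in> carrier_vec (dim_col A). vec_l2_norm v \<le> 1}. vec_l2_norm (A *\<^sub>v v))"

definition normal_mat :: "complex mat \<Rightarrow> bool" where
  "normal_mat A \<longleftrightarrow> A * mat_adjoint A = mat_adjoint A * A"

text \<open>Sequences are indexed by \<open>N \<ge> 1\<close>; the value at \<open>0\<close> is irrelevant. Likewise
  \<open>\<phi>\<close> is only used at indices \<open>k \<ge> 1\<close>.\<close>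

definition regular_sequence ::
    "real \<Rightarrow> (nat \<Rightarrow> complex) \<Rightarrow> (nat \<Rightarrow> complex mat) \<Rightarrow> bool" where
  "regular_sequence M \<phi> A \<longleftrightarrow>
     (\<forall>N\<ge>1. A N \<in> carrier_mat N N \<and> normal_mat (A N) \<and> mat_op_norm (A N) \<le> M) \<and>
     (\<forall>k\<ge>1. (\<lambda>N. mat_trace (A N ^\<^sub>m k) / of_nat N) \<longlonglongrightarrow> \<phi> k)"

section \<open>Haar measure on the unitary group and the HCIZ integral\<close>

definition unitary_group :: "nat \<Rightarrow> complex mat set" where
  "unitary_group N =
     {U \<in> carrier_mat N N. U * mat_adjoint U = 1\<^sub>m N \<and> mat_adjoint U * U = 1\<^sub>m N}"

text \<open>The Borel \<open>\<sigma>\<close>-algebra of \<open>U(N)\<close>, inherited from \<open>\<complex>\<^bsup>N\<times>N\<^esup>\<close> through the matrix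
  entries (a finite product of the Borel \<open>\<sigma>\<close>-algebras of \<open>\<complex>\<close>).\<close>

definition unitary_borel :: "nat \<Rightarrow> complex mat measure" where
  "unitary_borel N =
     vimage_algebra (unitary_group N)
       (\<lambda>U. \<lambda>ij \<in> {..<N} \<times> {..<N}. U $$ ij)
       (Pi\<^sub>M ({..<N} \<times> {..<N}) (\<lambda>_. borel))"

text \<open>The normalized Haar measure: the unique left-invariant Borel probability measure.\<close>

definition is_unitary_haar :: "nat \<Rightarrow> complex mat measure \<Rightarrow> bool" where
  "is_unitary_haar N \<kappa> \<longleftrightarrow>
     prob_space \<kappa> \<and> space \<kappa> = unitary_group N \<and> sets \<kappa> = sets (unitary_borel N) \<and>
     (\<forall>V\<in>unitary_group N. distr \<kappa> \<kappa> (\<lambda>U. V * U) = \<kappa>)"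

text \<open>The parameter \<open>\<kappa>\<close> is the Haar measure of \<open>U(N)\<close>. On \<open>U(N)\<close> the inverse is the adjoint.\<close>

definition hciz ::
    "complex mat measure \<Rightarrow> nat \<Rightarrow> complex mat \<Rightarrow> complex mat \<Rightarrow> complex \<Rightarrow> complex" where
  "hciz \<kappa> N A B z =
     (LINT U|\<kappa>. exp (- z * of_nat N * mat_trace (A * U * B * mat_adjoint U)))"

text \<open>\<open>F\<close> is the free energy on the domain \<open>D\<close>. On a connected \<open>D\<close> containing \<open>0\<close> this
  determines \<open>F\<close> uniquely, and it forces the integral to be nonzero on \<open>D\<close>.\<close>

definition is_hciz_free_energy ::
    "complex mat measure \<Rightarrow> nat \<Rightarrow> complex mat \<Rightarrow> complex mat \<Rightarrow> complex set \<Rightarrow>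
     (complex \<Rightarrow> complex) \<Rightarrow> bool" where
  "is_hciz_free_energy \<kappa> N A B D F \<longleftrightarrow>
     F holomorphic_on D \<and> F 0 = 0 \<and>
     (\<forall>z\<in>D. hciz \<kappa> N A B z = exp ((of_nat N)\<^sup>2 * F z))"

section \<open>Genus zero monotone double Hurwitz numbers\<close>

text \<open>Integer partitions are multisets of positive parts, so the length of \<open>\<alpha>\<close> is \<open>size \<alpha>\<close>.\<close>

definition int_partitions :: "nat \<Rightarrow> nat multiset set" where
  "int_partitions d = {\<alpha>. 0 \<notin># \<alpha> \<and> sum_mset \<alpha> = d}"

definition perm_cycle_type :: "nat \<Rightarrow> (nat \<Rightarrow> nat) \<Rightarrow> nat multiset" where
  "perm_cycle_type d p = image_mset card (mset_set (orbit p ` {1..d}))"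

text \<open>A tuple of transpositions \<open>\<tau>\<^sub>i = (s\<^sub>i t\<^sub>i)\<close>, \<open>s\<^sub>i < t\<^sub>i\<close>, is encoded by the list of the
  pairs \<open>(s\<^sub>i, t\<^sub>i)\<close>, which the transpositions determine.\<close>

definition transps :: "(nat \<times> nat) list \<Rightarrow> (nat \<Rightarrow> nat) list" where
  "transps ts = map (\<lambda>(s, t). Transposition.transpose s t) ts"

definition monotone_hurwitz_0 :: "nat \<Rightarrow> nat multiset \<Rightarrow> nat multiset \<Rightarrow> nat" where
  "monotone_hurwitz_0 d \<alpha> \<beta> = card {(\<rho>, \<sigma>, ts).
     \<rho> permutes {1..d} \<and> perm_cycle_type d \<rho> = \<alpha> \<and>
     \<sigma> permutes {1..d} \<and> perm_cycle_type d \<sigma> = \<beta> \<and>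
     length ts = size \<alpha> + size \<beta> - 2 \<and>
     (\<forall>(s, t)\<in>set ts. 1 \<le> s \<and> s < t \<and> t \<le> d) \<and>
     \<rho> \<circ> \<sigma> \<circ> foldr (\<circ>) (transps ts) id = id \<and>
     (\<forall>x\<in>{1..d}. \<forall>y\<in>{1..d}.
        \<exists>g\<in>generate (sym_group d) ({\<rho>, \<sigma>} \<union> set (transps ts)). g x = y) \<and>
     sorted (map snd ts)}"

definition moment_prod :: "(nat \<Rightarrow> complex) \<Rightarrow> nat multiset \<Rightarrow> complex" where
  "moment_prod \<phi> \<alpha> = (\<Prod>i\<in>#\<alpha>. \<phi> i)"

definition hciz_coeff_0 :: "nat \<Rightarrow> (nat \<Rightarrow> complex) \<Rightarrow> (nat \<Rightarrow> complex) \<Rightarrow> complex" where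
  "hciz_coeff_0 d \<phi> \<psi> =
     (\<Sum>\<alpha>\<in>int_partitions d. \<Sum>\<beta>\<in>int_partitions d.
        (-1) ^ (d + size \<alpha> + size \<beta>) * of_nat (monotone_hurwitz_0 d \<alpha> \<beta>)
          * moment_prod \<phi> \<alpha> * moment_prod \<psi> \<beta>)"

text \<open>The series starts in degree \<open>1\<close>; its \<open>n\<close>-th term has degree \<open>Suc n\<close>.\<close>

definition hciz_limit_term ::
    "(nat \<Rightarrow> complex) \<Rightarrow> (nat \<Rightarrow> complex) \<Rightarrow> complex \<Rightarrow> nat \<Rightarrow> complex" where
  "hciz_limit_term \<phi> \<psi> z n = hciz_coeff_0 (Suc n) \<phi> \<psi> * z ^ Suc n / fact (Suc n)"

definition hciz_limit :: "(nat \<Rightarrow> complex) \<Rightarrow> (nat \<Rightarrow> complex) \<Rightarrow> complex \<Rightarrow> complex" where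
  "hciz_limit \<phi> \<psi> z = (\<Sum>n. hciz_limit_term \<phi> \<psi> z n)"

text \<open>The disc \<open>|z| < z\<^sub>c M\<^bsup>-2\<^esup>\<close> with \<open>z\<^sub>c = 2/27\<close>, which is the whole plane for \<open>M = 0\<close>. The
  product form avoids HOL's convention \<open>x / 0 = 0\<close>.\<close>

definition hciz_disc :: "real \<Rightarrow> complex set" where
  "hciz_disc M = {z. cmod z * M\<^sup>2 < 2 / 27}"

end

theory Submission
  imports Defs "HOL-Complex_Analysis.Complex_Analysis"
begin

text \<open>
  The domain is a small disc. Where \<open>I\<^sub>N\<close> has no zero, \<open>I\<^sub>N = exp (N\<^sup>2 F\<^sub>N)\<close> and
  \<open>|I\<^sub>N(z)| \<le> exp (|z| N\<^sup>2 M\<^sup>2)\<close> give \<open>Re F\<^sub>N(z) \<le> |z| M\<^sup>2\<close>, hence by Borel-Caratheodory a bound on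
  \<open>|F\<^sub>N|\<close> uniform in \<open>N\<close>. It then suffices that every Taylor coefficient of \<open>F\<^sub>N\<close> converges.

  Put \<open>X = U B U\<^sup>*\<close>. Invariance of Haar measure under conjugation gives loop equations for the
  entries of \<open>E[X\<^bsup>a\<^sub>1\<^esup> \<otimes> \<dots> \<otimes> X\<^bsup>a\<^sub>d\<^esup>]\<close>, whose left-hand side is the operator \<open>N + J\<^sub>m\<close> with
  \<open>J\<^sub>m = \<Sum>\<^bsub>k<m\<^esub> (k m)\<close> a Jucys-Murphy element. Inverting these operators one slot at a time
  produces geometric series in \<open>-1/N\<close> over monotone sequences of transpositions, so for \<open>N > d\<^sup>2\<close>
  the moment \<open>E[Tr(AX)\<^sup>d]\<close> is \<open>N\<^bsup>-d\<^esup>\<close> times a sum over tuples \<open>(\<rho>, \<sigma>, \<tau>\<^sub>1, \<dots>, \<tau>\<^sub>r)\<close>, each weighted by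
  \<open>(-1/N)\<^sup>r p\<^sub>\<rho>(A) p\<^sub>\<sigma>(B)\<close>. Taking the logarithm restricts the sum to transitive tuples. For these
  the Riemann-Hurwitz inequality \<open>\<ell>(\<alpha>) + \<ell>(\<beta>) \<le> r + 2\<close> holds, and after division by \<open>N\<^sup>2\<close> only the
  tuples with equality survive as \<open>N \<rightarrow> \<infinity>\<close>.
\<close>

text \<open>Inverting \<open>N + J_m\<close> by a geometric series needs \<open>N\<close> large
  compared with the degree \<open>d\<close>, with no uniformity in \<open>d\<close>, so the
  expansion alone never controls \<open>F_N\<close> at a fixed nonzero point. The non-vanishing
  hypothesis closes this gap: it gives one disc, independent of \<open>N\<close>, on which all
  logarithms exist, and the real-part bound there turns convergence of each coefficient into locally
  uniform convergence. The positive radius of convergence of the limit series comes out of the same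
  bound through Cauchy estimates, without asymptotics of Hurwitz numbers. Powers \<open>X^a\<close>
  are carried along because a loop equation merges two slots into one with the sum of their
  exponents; exponent 0 marks a slot already eliminated. As for signs, each transposition brings
  -1/N and the integrand contributes (-1)^d; in genus zero r + 2 is the total number of cycles of
  rho and sigma, which yields the sign in \<open>C_{0,d}\<close>.\<close>

section \<open>Orbit products of permutations\<close>

text \<open>For \<open>w k = Tr(A\<^sup>k)\<close> and \<open>a = 1\<close> this is the power sum \<open>p\<^sub>\<sigma>(A)\<close>. The exponents \<open>a\<close> record
  how many tensor slots have been merged into a point.\<close>

definition orbit_prod :: "(nat \<Rightarrow> 'b::comm_monoid_mult) \<Rightarrow> nat set \<Rightarrow> (nat \<Rightarrow> nat) \<Rightarrow> (nat \<Rightarrow> nat) \<Rightarrow> 'b" where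
  "orbit_prod w S \<sigma> a = (\<Prod>C\<in>orbit \<sigma> ` S. w (\<Sum>l\<in>C. a l))"

definition tprod :: "(nat \<times> nat) list \<Rightarrow> nat \<Rightarrow> nat" where
  "tprod ts = foldr (\<circ>) (transps ts) id"

lemma permutes_self_in_orbit:
  assumes "finite S" "p permutes S" shows "x \<in> orbit p x"
  by (rule permutation_self_in_orbit) (use assms permutation_permutes in metis)

lemma permutes_orbit_eq:
  assumes "finite S" "p permutes S" "y \<in> orbit p x" shows "orbit p y = orbit p x"
proof
  show "orbit p y \<subseteq> orbit p x" by (intro subsetI orbit_trans[OF _ assms(3)])
  have x: "x \<in> orbit p y" by (rule orbit_swap[OF permutes_self_in_orbit[OF assms(1,2)] assms(3)])
  show "orbit p x \<subseteq> orbit p y" by (intro subsetI orbit_trans[OF _ x])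
qed

lemma orbit_subset_closed:
  assumes "x \<in> X" "\<And>y. y \<in> X \<Longrightarrow> f y \<in> X" shows "orbit f x \<subseteq> X"
proof
  fix y assume "y \<in> orbit f x" then show "y \<in> X" by induction (auto intro: assms)
qed

lemma orbit_invariant:
  assumes "\<And>x. L (f x) = L x" "y \<in> orbit f s" shows "L y = L s"
  using assms(2) by induction (simp_all only: assms(1))

lemma orbit_prod_insert_fixed:
  assumes "finite S" "p permutes S" "m \<notin> S"
  shows "orbit_prod w (insert m S) p a = w (a m) * orbit_prod w S p a"
proof -
  have 1: "orbit p m = {m}" using assms by (simp add: orbit_eq_singleton_iff permutes_def)
  have "{m} \<notin> orbit p ` S"
  proof
    assume "{m} \<in> orbit p ` S"
    then obtain x where "x \<in> S" "orbit p x = {m}" by auto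
    then show False using permutes_self_in_orbit[OF assms(1,2), of x] assms(3) by auto
  qed
  then show ?thesis using assms(1) by (simp add: orbit_prod_def 1)
qed

text \<open>Since \<open>p\<close> fixes \<open>m\<close>, the predecessor of \<open>k\<close> is
  now sent to \<open>m\<close> and \<open>m\<close> to \<open>k\<close>: the point \<open>m\<close>
  is spliced into the cycle of \<open>k\<close> just before \<open>k\<close>, and the other cycles
  stay.\<close>

lemma orbit_transpose_insert:
  assumes "finite S" "p permutes S" "m \<notin> S" "k \<in> S" "x \<in> S"
  shows "orbit (Transposition.transpose k m \<circ> p) x = (if k \<in> orbit p x then insert m (orbit p x) else orbit p x)"
proof -
  let ?q = "Transposition.transpose k m \<circ> p"
  have sub: "orbit p x \<subseteq> S" using permutes_orbit_subset[OF assms(2,5)] .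
  have pm: "p m = m" using assms(2,3) by (simp add: permutes_def)
  have self: "y \<in> orbit p y" for y using permutes_self_in_orbit[OF assms(1,2)] .
  have qp: "?q permutes insert m S"
    by (intro permutes_compose permutes_subset[OF assms(2)] permutes_swap_id) (use assms in auto)
  have selfq: "y \<in> orbit ?q y" for y by (rule permutes_self_in_orbit[OF _ qp]) (use assms in auto)
  \<comment> \<open>One step of \<open>p\<close> is one step of \<open>?q\<close>, two when it
    passes through \<open>m\<close>, and none at \<open>m\<close> itself.\<close>
  have a: "orbit p x \<subseteq> orbit ?q x"
  proof (rule orbit_subset_closed)
    show "x \<in> orbit ?q x" by (rule selfq)
    fix y assume y: "y \<in> orbit ?q x"
    have q1: "?q y \<in> orbit ?q x" using y by (rule orbit.step)
    have q2: "?q (?q y) \<in> orbit ?q x" using q1 by (rule orbit.step)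
    show "p y \<in> orbit ?q x"
    proof (cases "p y = k")
      case True
      then have "?q (?q y) = k" using pm by simp
      then show ?thesis using q2 True by simp
    next
      case False
      show ?thesis
      proof (cases "p y = m")
        case True
        then have "y = m" using pm assms(2) by (metis permutes_inverses(2))
        then show ?thesis using y pm by simp
      next
        case F: False
        then have "?q y = p y" using False by simp
        then show ?thesis using q1 by simp
      qed
    qed
  qed
  have km: "m \<in> orbit ?q x" if "k \<in> orbit p x"
  proof -
    have "k \<in> orbit ?q x" using a that by auto
    define y where "y = inv_into UNIV p k"
    have y: "p y = k" unfolding y_def by (rule permutes_inverses(1)[OF assms(2)])
    have "y \<in> orbit p k"
      using orbit_swap[OF self, of k y] orbit.base[of p y] y by simp
    then have "y \<in> orbit p x" by (rule orbit_trans) (rule that)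
    then have "y \<in> orbit ?q x" using a by auto
    then have "?q y \<in> orbit ?q x" by (rule orbit.step)
    then show ?thesis using y by simp
  qed
  let ?X = "if k \<in> orbit p x then insert m (orbit p x) else orbit p x"
  have "orbit ?q x \<subseteq> ?X"
  proof (rule orbit_subset_closed)
    show "x \<in> ?X" using self by auto
    fix y assume y: "y \<in> ?X"
    show "?q y \<in> ?X"
    proof (cases "y = m")
      case True
      then show ?thesis using y pm sub assms(3) by (auto split: if_splits)
    next
      case False
      then have yo: "y \<in> orbit p x" using y by (auto split: if_splits)
      then have py: "p y \<in> orbit p x" by (rule orbit.step)
      then have "p y \<noteq> m" using sub assms(3) by auto
      then show ?thesis using py by (cases "p y = k") auto
    qed
  qed
  then show ?thesis using a km by (auto split: if_splits)
qed

text \<open>Adding \<open>m\<close> to the cycle through \<open>k\<close> matches the cycles of the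
  two permutations one to one, and giving the exponent of \<open>m\<close> to \<open>k\<close> keeps
  every cycle sum. This is the combinatorial twin of merging two slots in the loop equation.\<close>

lemma orbit_prod_insert_transpose:
  assumes "finite S" "p permutes S" "m \<notin> S" "k \<in> S"
  shows "orbit_prod w (insert m S) (Transposition.transpose k m \<circ> p) a = orbit_prod w S p (a(k := a k + a m))"
proof -
  let ?q = "Transposition.transpose k m \<circ> p"
  let ?h = "\<lambda>X. if k \<in> X then insert m X else X"
  have pm: "p m = m" using assms(2,3) by (simp add: permutes_def)
  have qp: "?q permutes insert m S"
    by (intro permutes_compose permutes_subset[OF assms(2)] permutes_swap_id) (use assms in auto)
  have ob: "orbit ?q x = ?h (orbit p x)" if "x \<in> S" for x
    using orbit_transpose_insert[OF assms that] .
  have "m \<in> orbit ?q k" using ob[OF assms(4)] permutes_self_in_orbit[OF assms(1,2), of k] by simp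
  then have m: "orbit ?q m = orbit ?q k"
    using permutes_orbit_eq[OF _ qp, of m k] assms(1) by auto
  have eq: "orbit ?q ` insert m S = ?h ` (orbit p ` S)"
  proof -
    have "orbit ?q ` insert m S = orbit ?q ` S" using m assms(4) by auto
    also have "\<dots> = (\<lambda>x. ?h (orbit p x)) ` S" using ob by (intro image_cong) auto
    finally show ?thesis by (simp only: image_image)
  qed
  have sub: "X \<subseteq> S" if "X \<in> orbit p ` S" for X
    using that permutes_orbit_subset[OF assms(2)] by auto
  have inj: "inj_on ?h (orbit p ` S)"
    using sub assms(3) by (intro inj_onI) (metis insert_ident insertI1 in_mono)
  have "orbit_prod w (insert m S) ?q a = (\<Prod>X\<in>orbit p ` S. w (\<Sum>l\<in>?h X. a l))"
    unfolding orbit_prod_def eq by (subst prod.reindex[OF inj]) simp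
  also have "\<dots> = (\<Prod>X\<in>orbit p ` S. w (\<Sum>l\<in>X. (a(k := a k + a m)) l))"
  proof (intro prod.cong refl arg_cong[of _ _ w])
    fix X assume X: "X \<in> orbit p ` S"
    have fX: "finite X" using sub[OF X] assms(1) finite_subset by blast
    have mX: "m \<notin> X" using sub[OF X] assms(3) by auto
    show "(\<Sum>l\<in>?h X. a l) = (\<Sum>l\<in>X. (a(k := a k + a m)) l)"
    proof (cases "k \<in> X")
      case True
      then have "(\<Sum>l\<in>X. (a(k := a k + a m)) l) = (a k + a m) + (\<Sum>l\<in>X - {k}. a l)"
        using fX by (simp add: sum.remove)
      moreover have "(\<Sum>l\<in>X. a l) = a k + (\<Sum>l\<in>X - {k}. a l)"
        using fX True by (simp add: sum.remove)
      ultimately show ?thesis using True fX mX by simp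
    next
      case False
      then show ?thesis by (auto intro!: sum.cong)
    qed
  qed
  finally show ?thesis by (simp add: orbit_prod_def)
qed

lemma orbit_comp_disjoint:
  assumes "p permutes T" "q permutes U" "T \<inter> U = {}" "x \<in> T" "finite T"
  shows "orbit (p \<circ> q) x = orbit p x"
proof -
  have sub: "orbit p x \<subseteq> T" using permutes_orbit_subset[OF assms(1,4)] .
  have "orbit p x = orbit (p \<circ> q) x"
  proof (rule orbit_cong0)
    show "x \<in> orbit p x" by (rule permutes_self_in_orbit[OF assms(5,1)])
    show "p \<in> orbit p x \<rightarrow> orbit p x" by (auto intro: orbit.step)
    fix y assume "y \<in> orbit p x"
    then have "q y = y" using sub assms(2,3) by (auto simp: permutes_def)
    then show "p y = (p \<circ> q) y" by simp
  qed
  then show ?thesis by simp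
qed

lemma permutes_comp_disjoint_commute:
  assumes "p permutes T" "q permutes U" "T \<inter> U = {}"
  shows "p \<circ> q = q \<circ> p"
proof
  fix x
  have pT: "p x \<in> T \<longleftrightarrow> x \<in> T" and qU: "q x \<in> U \<longleftrightarrow> x \<in> U"
    using assms by (auto simp: permutes_in_image)
  show "(p \<circ> q) x = (q \<circ> p) x"
  proof (cases "x \<in> T")
    case True
    then have "q x = x" "q (p x) = p x" using pT assms by (auto simp: permutes_def)
    then show ?thesis by simp
  next
    case False
    then have "p x = x" using assms by (auto simp: permutes_def)
    moreover have "p (q x) = q x"
    proof (cases "x \<in> U")
      case True
      then have "q x \<notin> T" using qU assms(3) by auto
      then show ?thesis using assms by (auto simp: permutes_def)
    next
      case False
      then have "q x = x" using assms by (auto simp: permutes_def)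
      then show ?thesis using \<open>p x = x\<close> by simp
    qed
    ultimately show ?thesis by simp
  qed
qed

lemma orbit_prod_disjoint:
  assumes "p permutes T" "q permutes U" "T \<inter> U = {}" "finite T" "finite U"
  shows "orbit_prod w (T \<union> U) (p \<circ> q) a = orbit_prod w T p a * orbit_prod w U q a"
proof -
  have 1: "orbit (p \<circ> q) ` T = orbit p ` T"
    using orbit_comp_disjoint[OF assms(1-3) _ assms(4)] by (intro image_cong) auto
  have 2: "orbit (p \<circ> q) ` U = orbit q ` U"
    unfolding permutes_comp_disjoint_commute[OF assms(1-3)]
    using orbit_comp_disjoint[OF assms(2,1) _ _ assms(5)] assms(3) by (intro image_cong) auto
  have "orbit p ` T \<inter> orbit q ` U = {}"
  proof -
    have "orbit p x \<noteq> orbit q y" if "x \<in> T" "y \<in> U" for x y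
      using permutes_orbit_subset[OF assms(1) that(1)] permutes_orbit_subset[OF assms(2) that(2)]
        permutes_self_in_orbit[OF assms(4,1), of x] assms(3) by blast
    then show ?thesis by auto
  qed
  then show ?thesis unfolding orbit_prod_def image_Un 1 2
    using assms(4,5) by (subst prod.union_disjoint) auto
qed

lemma orbit_prod_inv:
  assumes "finite S" "p permutes S"
  shows "orbit_prod w S (inv_into UNIV p) a = orbit_prod w S p a"
proof -
  have "orbit (inv_into UNIV p) x = orbit p x" for x
    by (rule orbit_inv_eq) (use assms permutation_permutes in metis)
  then show ?thesis by (simp add: orbit_prod_def)
qed

lemma orbit_conj:
  assumes "inj t" "s \<circ> t = t \<circ> p"
  shows "orbit s (t x) = t ` orbit p x"
proof -
  have st: "s (t y) = t (p y)" for y using assms(2) by (metis comp_apply)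
  have "y \<in> orbit p x \<Longrightarrow> t y \<in> orbit s (t x)" for y
    by (induction rule: orbit.induct) (simp_all add: orbit.intros flip: st)
  moreover have "y \<in> orbit s (t x) \<Longrightarrow> y \<in> t ` orbit p x" for y
    by (induction rule: orbit.induct) (auto simp: st intro: orbit.intros)
  ultimately show ?thesis by auto
qed

text \<open>\<open>s\<close> is the conjugate of \<open>p\<close> by \<open>t\<close>, written
  without an inverse. The exponent is constant because \<open>t\<close> moves the points of a cycle.
  The purpose is to exchange the two factors of a product.\<close>

lemma orbit_prod_conj:
  assumes "t permutes S" "s \<circ> t = t \<circ> p"
  shows "orbit_prod w S s (\<lambda>_. c) = orbit_prod w S p (\<lambda>_. c)"
proof -
  have inj: "inj t" using assms(1) permutes_inj by blast
  have "orbit s ` S = orbit s ` (t ` S)" using assms(1) by (simp add: permutes_image)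
  also have "\<dots> = image t ` (orbit p ` S)" by (simp add: image_image orbit_conj[OF inj assms(2)])
  finally have 1: "orbit s ` S = image t ` (orbit p ` S)" .
  have i2: "inj_on (image t) X" for X using inj by (meson inj_image_eq_iff inj_onI)
  show ?thesis unfolding orbit_prod_def 1
    by (subst prod.reindex[OF i2]) (auto intro!: prod.cong simp: card_image inj_on_subset[OF inj])
qed

section \<open>The genus bound\<close>

text \<open>Cycles of the product that avoid \<open>s\<close> and \<open>t\<close> are cycles of
  \<open>p\<close>, while the cycles of \<open>p\<close> through \<open>s\<close> or
  \<open>t\<close> are replaced by at most two new ones. If \<open>s\<close> and \<open>t\<close>
  lay in different cycles, these are joined into one.\<close>

lemma card_orbits_comp_transpose:
  assumes "finite S" "p permutes S" "s \<in> S" "t \<in> S" "s \<noteq> t"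
  shows "card (orbit (p \<circ> Transposition.transpose s t) ` S) \<le> card (orbit p ` S) + 1"
    and "t \<notin> orbit p s \<Longrightarrow> card (orbit (p \<circ> Transposition.transpose s t) ` S) + 1 \<le> card (orbit p ` S)"
proof -
  let ?q = "p \<circ> Transposition.transpose s t"
  have qp: "?q permutes S" by (intro permutes_compose permutes_swap_id assms)
  have sq: "x \<in> orbit ?q x" and sp: "x \<in> orbit p x" for x
    using permutes_self_in_orbit[OF assms(1) qp] permutes_self_in_orbit[OF assms(1,2)] by auto
  have incl: "orbit ?q ` S \<subseteq> (orbit p ` S - {orbit p s, orbit p t}) \<union> {orbit ?q s, orbit ?q t}"
  proof
    fix X assume "X \<in> orbit ?q ` S"
    then obtain x where x: "x \<in> S" "X = orbit ?q x" by auto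
    show "X \<in> (orbit p ` S - {orbit p s, orbit p t}) \<union> {orbit ?q s, orbit ?q t}"
    proof (cases "s \<in> X \<or> t \<in> X")
      case True
      then show ?thesis using x permutes_orbit_eq[OF assms(1) qp] by auto
    next
      case False
      have "orbit ?q x = orbit p x"
      proof (rule orbit_cong0)
        show "x \<in> orbit ?q x" by (rule sq)
        show "?q \<in> orbit ?q x \<rightarrow> orbit ?q x" by (auto intro: orbit.step[of _ ?q])
        fix y assume "y \<in> orbit ?q x"
        then have "y \<noteq> s" "y \<noteq> t" using False x by auto
        then show "?q y = p y" by simp
      qed
      then have "X = orbit p x" using x by simp
      moreover have "X \<noteq> orbit p s" "X \<noteq> orbit p t" using False sp by auto
      ultimately show ?thesis using x by auto
    qed
  qed
  have fin: "finite (orbit p ` S)" using assms by simp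
  have cs: "card (orbit ?q ` S) \<le> card (orbit p ` S - {orbit p s, orbit p t}) + card {orbit ?q s, orbit ?q t}"
    by (rule order_trans[OF card_mono[OF _ incl] card_Un_le]) (use fin in auto)
  have c2: "card {orbit ?q s, orbit ?q t} \<le> 2" by (simp add: card_insert_if)
  have "card (orbit p ` S - {orbit p s, orbit p t}) < card (orbit p ` S)"
    by (rule psubset_card_mono[OF fin]) (use assms in auto)
  then show "card (orbit ?q ` S) \<le> card (orbit p ` S) + 1" using cs c2 by linarith
  show "card (orbit ?q ` S) + 1 \<le> card (orbit p ` S)" if d: "t \<notin> orbit p s"
  proof -
    have ne: "orbit p s \<noteq> orbit p t" using d sp by auto
    have sn: "s \<notin> orbit p t" using ne permutes_orbit_eq[OF assms(1,2), of s t] by auto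
    \<comment> \<open>\<open>?q s = p t\<close>, and away from \<open>s\<close> and \<open>t\<close>
      the maps agree, so from \<open>s\<close> on the map \<open>?q\<close> runs through the whole
      \<open>p\<close>-cycle of \<open>t\<close>.\<close>
    have "orbit p t \<subseteq> orbit ?q s"
    proof
      fix y assume y: "y \<in> orbit p t"
      have "y \<in> orbit p t \<and> y \<in> orbit ?q s" using y
      proof induction
        case base
        have "?q s = p t" by simp
        then show ?case using orbit.base[of ?q s] orbit.base[of p t] by metis
      next
        case (step y)
        have "p y \<in> orbit ?q s"
        proof (cases "y = t")
          case True
          have "?q s = p t" by simp
          then show ?thesis using True orbit.base[of ?q s] by metis
        next
          case False
          have "y \<noteq> s" using step sn by auto
          then have "?q y = p y" using False by simp
          then show ?thesis using step orbit.step[of y ?q s] by metis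
        qed
        then show ?case using step orbit.step[of y p t] by metis
      qed
      then show "y \<in> orbit ?q s" by simp
    qed
    then have "t \<in> orbit ?q s" using sp by auto
    then have "orbit ?q t = orbit ?q s" using permutes_orbit_eq[OF assms(1) qp] by auto
    then have c1: "card {orbit ?q s, orbit ?q t} = 1" by simp
    have "card (orbit p ` S - {orbit p s, orbit p t}) + 2 = card (orbit p ` S)"
    proof -
      have "card (orbit p ` S - {orbit p s, orbit p t}) = card (orbit p ` S) - card {orbit p s, orbit p t}"
        by (rule card_Diff_subset) (use assms in auto)
      moreover have "card {orbit p s, orbit p t} = 2" using ne by simp
      moreover have "card {orbit p s, orbit p t} \<le> card (orbit p ` S)"
        by (rule card_mono[OF fin]) (use assms in auto)
      ultimately show ?thesis by linarith
    qed
    then show ?thesis using cs c1 by linarith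
  qed
qed

section \<open>Products of transpositions and orbit labels\<close>

lemma tprod_Nil [simp]: "tprod [] = id"
  by (simp add: tprod_def transps_def)

lemma tprod_Cons: "tprod ((s, t) # ts) = Transposition.transpose s t \<circ> tprod ts"
  by (simp add: tprod_def transps_def)

lemma tprod_append: "tprod (us @ ts) = tprod us \<circ> tprod ts"
  by (induction us) (auto simp: tprod_def transps_def o_assoc)

lemma tprod_permutes:
  assumes "\<forall>(s, t)\<in>set ts. s \<in> S \<and> t \<in> S" shows "tprod ts permutes S"
  using assms
proof (induction ts)
  case Nil show ?case unfolding tprod_Nil by (rule permutes_id)
next
  case (Cons a ts)
  obtain s t where a: "a = (s, t)" by (cases a)
  show ?case unfolding a tprod_Cons
    by (rule permutes_compose) (use Cons a in \<open>auto intro: permutes_swap_id\<close>)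
qed

lemma tprod_invariant:
  assumes "\<forall>(s, t)\<in>set ts. L s = L t" shows "L (tprod ts x) = L x"
  using assms
proof (induction ts arbitrary: x)
  case (Cons a ts)
  obtain s t where a: "a = (s, t)" by (cases a)
  have "L (Transposition.transpose s t y) = L y" for y using Cons.prems a by (auto simp: Transposition.transpose_def)
  then show ?case using Cons a by (simp add: tprod_Cons)
qed simp

text \<open>\<open>L\<close> labels the orbits of the generated group. Multiplying by \<open>(s t)\<close> either joins two cycles, at
  the cost of at most one label, or splits a cycle, in which case \<open>s\<close> and \<open>t\<close> already share a label.\<close>

lemma genus_labelling:
  assumes "finite S" "\<sigma> permutes S" "\<forall>(s, t)\<in>set ts. s \<in> S \<and> t \<in> S \<and> s < t"
  shows "\<exists>L :: nat \<Rightarrow> nat set. (\<forall>x. L (\<sigma> x) = L x) \<and> (\<forall>(s, t)\<in>set ts. L s = L t) \<and>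
     card (orbit (\<sigma> \<circ> tprod ts) ` S) + card (orbit \<sigma> ` S) \<le> length ts + 2 * card (L ` S)"
  using assms(3)
proof (induction ts rule: rev_induct)
  case Nil
  have "orbit \<sigma> (\<sigma> x) = orbit \<sigma> x" for x
    by (rule permutes_orbit_eq[OF assms(1,2)]) (rule orbit.base)
  then show ?case by (intro exI[of _ "orbit \<sigma>"]) simp
next
  case (snoc a ts)
  obtain s t where a: "a = (s, t)" by (cases a)
  have st: "s \<in> S" "t \<in> S" "s \<noteq> t" using snoc.prems a by auto
  have pre: "\<forall>(s, t)\<in>set ts. s \<in> S \<and> t \<in> S \<and> s < t" using snoc.prems by auto
  obtain L :: "nat \<Rightarrow> nat set" where L: "\<forall>x. L (\<sigma> x) = L x" "\<forall>(s, t)\<in>set ts. L s = L t"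
     "card (orbit (\<sigma> \<circ> tprod ts) ` S) + card (orbit \<sigma> ` S) \<le> length ts + 2 * card (L ` S)"
    by atomize_elim (rule snoc.IH[OF pre])
  let ?p = "\<sigma> \<circ> tprod ts"
  have tp: "tprod ts permutes S" by (rule tprod_permutes) (use snoc.prems in auto)
  have pp: "?p permutes S" by (rule permutes_compose[OF tp assms(2)])
  have eq: "\<sigma> \<circ> tprod (ts @ [a]) = ?p \<circ> Transposition.transpose s t"
    by (simp add: tprod_append a tprod_Cons o_assoc)
  have len: "length (ts @ [a]) = length ts + 1" by simp
  note c = card_orbits_comp_transpose[OF assms(1) pp st]
  show ?case
  proof (cases "t \<in> orbit ?p s")
    case True
    have "L (?p x) = L x" for x using L tprod_invariant[OF L(2)] by simp
    then have "L t = L s" by (rule orbit_invariant[OF _ True])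
    then have "\<forall>(s, t)\<in>set (ts @ [a]). L s = L t" using L(2) a by auto
    moreover have "card (orbit (?p \<circ> Transposition.transpose s t) ` S) + card (orbit \<sigma> ` S)
        \<le> length (ts @ [a]) + 2 * card (L ` S)"
      using c(1) L(3) len by linarith
    ultimately show ?thesis unfolding eq using L(1) by (intro exI[of _ L] conjI)
  next
    case False
    \<comment> \<open>The label of \<open>t\<close> is renamed to that of \<open>s\<close>. The
      sequence grows by one and at most one label is lost, so the right-hand side drops by at most
      one; the join of two cycles lowers the left-hand side by at least one.\<close>
    define L' where "L' = (\<lambda>x. if L x = L t then L s else L x)"
    have "L ` S - {L t} \<subseteq> L' ` S" by (auto simp: L'_def)
    then have "card (L ` S - {L t}) \<le> card (L' ` S)" using assms(1) by (intro card_mono) auto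
    then have "card (L ` S) \<le> card (L' ` S) + 1" using st assms(1) by auto
    then have "card (orbit (?p \<circ> Transposition.transpose s t) ` S) + card (orbit \<sigma> ` S) \<le> length (ts @ [a]) + 2 * card (L' ` S)"
      using c(2)[OF False] L(3) len by linarith
    moreover have "\<forall>x. L' (\<sigma> x) = L' x" using L by (simp add: L'_def)
    moreover have "\<forall>(s, t)\<in>set (ts @ [a]). L' s = L' t"
    proof (rule ballI, clarify)
      fix u v assume "(u, v) \<in> set (ts @ [a])"
      then consider "(u, v) \<in> set ts" | "u = s" "v = t" using a by auto
      then show "L' u = L' v"
      proof cases
        case 1
        then have "L u = L v" using L(2) by auto
        then show ?thesis by (simp only: L'_def)
      next
        case 2
        then show ?thesis by (simp add: L'_def)
      qed
    qed
    ultimately show ?thesis unfolding eq by (intro exI[of _ L'] conjI)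
  qed
qed

section \<open>Monotone sequences of transpositions and the loop equation\<close>

definition mono_lists :: "nat set \<Rightarrow> nat \<Rightarrow> (nat \<times> nat) list set" where
  "mono_lists S r = {ts. length ts = r \<and> sorted (map snd ts) \<and> (\<forall>(s, t)\<in>set ts. s \<in> S \<and> t \<in> S \<and> s < t)}"

text \<open>This is h_r, the complete homogeneous symmetric polynomial in the Jucys-Murphy elements
  of \<open>S\<close>, acting on \<open>f\<close> by left multiplication.\<close>

definition mono_sum :: "((nat \<Rightarrow> nat) \<Rightarrow> complex) \<Rightarrow> nat set \<Rightarrow> nat \<Rightarrow> (nat \<Rightarrow> nat) \<Rightarrow> complex" where
  "mono_sum f S r p = (\<Sum>ts\<in>mono_lists S r. f (tprod ts \<circ> p))"

text \<open>The generating function of the h_r, that is, the product over \<open>m\<close> in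
  \<open>S\<close> of the inverses of 1 - x J_m; it is used at x = -1/N.\<close>

definition mono_series :: "((nat \<Rightarrow> nat) \<Rightarrow> complex) \<Rightarrow> nat set \<Rightarrow> complex \<Rightarrow> (nat \<Rightarrow> nat) \<Rightarrow> complex" where
  "mono_series f S x p = (\<Sum>r. mono_sum f S r p * x ^ r)"

lemma mono_lists_subset: "mono_lists S r \<subseteq> {ts. set ts \<subseteq> S \<times> S \<and> length ts = r}"
  by (auto simp: mono_lists_def)

lemma finite_mono_lists: "finite S \<Longrightarrow> finite (mono_lists S r)"
  by (rule finite_subset[OF mono_lists_subset]) (simp add: finite_lists_length_eq)

text \<open>Monotonicity is thrown away and all lists of pairs are counted. This crude bound is the
  origin of the conditions of the form d^2 < N.\<close>

lemma card_mono_lists: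
  assumes "finite S" shows "card (mono_lists S r) \<le> ((card S)\<^sup>2) ^ r"
proof -
  have "card (mono_lists S r) \<le> card {ts. set ts \<subseteq> S \<times> S \<and> length ts = r}"
    by (rule card_mono[OF _ mono_lists_subset]) (use assms in \<open>simp add: finite_lists_length_eq\<close>)
  also have "\<dots> = ((card S)\<^sup>2) ^ r"
    using assms by (simp add: card_lists_length_eq card_cartesian_product power2_eq_square)
  finally show ?thesis .
qed

lemma mono_lists_0 [simp]: "mono_lists S 0 = {[]}"
  by (auto simp: mono_lists_def)

lemma mono_sum_0 [simp]: "mono_sum f S 0 p = f p"
  by (simp add: mono_sum_def)

lemma mono_lists_permutes: "ts \<in> mono_lists S r \<Longrightarrow> S \<subseteq> U \<Longrightarrow> tprod ts permutes U"
  by (rule permutes_subset[of _ S], rule tprod_permutes) (auto simp: mono_lists_def)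

text \<open>In a sorted sequence the transpositions with the largest entry \<open>m\<close> stand at
  the end, so the last one decides whether \<open>m\<close> occurs at all.\<close>

lemma mono_lists_insert:
  assumes "\<forall>x\<in>T. x < m"
  shows "mono_lists (insert m T) (Suc r) =
    mono_lists T (Suc r) \<union> (\<lambda>(k, ts). ts @ [(k, m)]) ` (T \<times> mono_lists (insert m T) r)"
    (is "?L = ?A \<union> ?B")
proof
  show "?L \<subseteq> ?A \<union> ?B"
  proof
    fix ts assume ts: "ts \<in> ?L"
    then have "ts \<noteq> []" by (auto simp: mono_lists_def)
    then obtain us k t where us: "ts = us @ [(k, t)]" by (metis prod.exhaust rev_exhaust)
    have k: "k < t" "k \<in> insert m T" "t \<in> insert m T" using ts us by (auto simp: mono_lists_def)
    show "ts \<in> ?A \<union> ?B"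
    proof (cases "t = m")
      case True
      then have "k \<in> T" using k by auto
      moreover have "us \<in> mono_lists (insert m T) r" using ts us by (auto simp: mono_lists_def sorted_append)
      ultimately show ?thesis using us True by auto
    next
      case False
      then have t: "t < m" using k assms by auto
      have "snd x \<le> t" if "x \<in> set ts" for x using ts us that by (auto simp: mono_lists_def sorted_append)
      then have "fst x \<in> T \<and> snd x \<in> T \<and> fst x < snd x" if "x \<in> set ts" for x
        using ts that t by (fastforce simp: mono_lists_def)
      then have "ts \<in> ?A" using ts by (fastforce simp: mono_lists_def)
      then show ?thesis by simp
    qed
  qed
  show "?A \<union> ?B \<subseteq> ?L"
  proof
    fix ts assume "ts \<in> ?A \<union> ?B"
    then show "ts \<in> ?L"
    proof
      assume "ts \<in> ?A" then show ?thesis by (fastforce simp: mono_lists_def)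
    next
      assume "ts \<in> ?B"
      then obtain k us where us: "k \<in> T" "us \<in> mono_lists (insert m T) r" "ts = us @ [(k, m)]" by auto
      have "snd x \<le> m" if "x \<in> set us" for x
        using us(2) that assms by (fastforce simp: mono_lists_def)
      then have "sorted (map snd ts)" using us by (auto simp: mono_lists_def sorted_append)
      then show ?thesis using us assms by (auto simp: mono_lists_def)
    qed
  qed
qed

text \<open>The recursion h_{r+1}(T, m) = h_{r+1}(T) + h_r(T, m) J_m. The transposition split off is
  the last of the list and hence the first to act on \<open>p\<close>.\<close>

lemma mono_sum_insert:
  assumes "finite T" "\<forall>x\<in>T. x < m"
  shows "mono_sum f (insert m T) (Suc r) p =
    mono_sum f T (Suc r) p + (\<Sum>k\<in>T. mono_sum f (insert m T) r (Transposition.transpose k m \<circ> p))"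
proof -
  let ?i = "\<lambda>(k, ts). ts @ [(k, m)] :: (nat \<times> nat) list"
  have inj: "inj_on ?i (T \<times> mono_lists (insert m T) r)" by (auto simp: inj_on_def)
  have fin: "finite (mono_lists T (Suc r))" "finite (T \<times> mono_lists (insert m T) r)"
    using assms finite_mono_lists by auto
  have m: "m \<notin> T" using assms by auto
  have disj: "mono_lists T (Suc r) \<inter> ?i ` (T \<times> mono_lists (insert m T) r) = {}"
    using m by (auto simp: mono_lists_def)
  have "mono_sum f (insert m T) (Suc r) p = mono_sum f T (Suc r) p +
      (\<Sum>ts\<in>?i ` (T \<times> mono_lists (insert m T) r). f (tprod ts \<circ> p))"
    unfolding mono_sum_def mono_lists_insert[OF assms(2)]
    using fin disj by (subst sum.union_disjoint) auto
  also have "(\<Sum>ts\<in>?i ` (T \<times> mono_lists (insert m T) r). f (tprod ts \<circ> p)) =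
      (\<Sum>(k, ts)\<in>T \<times> mono_lists (insert m T) r. f (tprod ts \<circ> (Transposition.transpose k m \<circ> p)))"
    by (subst sum.reindex[OF inj]) (auto intro!: sum.cong simp: tprod_append tprod_Cons o_assoc)
  also have "\<dots> = (\<Sum>k\<in>T. mono_sum f (insert m T) r (Transposition.transpose k m \<circ> p))"
    by (simp add: mono_sum_def sum.cartesian_product)
  finally show ?thesis .
qed

lemma norm_mono_sum_le:
  assumes "finite U" "S \<subseteq> U" "p permutes U" "\<And>q. q permutes U \<Longrightarrow> cmod (f q) \<le> C"
  shows "cmod (mono_sum f S r p) \<le> C * ((card U)\<^sup>2) ^ r"
proof -
  have C: "C \<ge> 0" using assms(4)[OF permutes_id] norm_ge_zero order_trans by blast
  have "cmod (mono_sum f S r p) \<le> (\<Sum>ts\<in>mono_lists S r. C)"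
    unfolding mono_sum_def
    by (rule sum_norm_le) (use assms mono_lists_permutes permutes_compose in blast)
  also have "\<dots> \<le> C * ((card S)\<^sup>2) ^ r"
    using card_mono_lists[of S r] finite_subset[OF assms(2,1)] C
    by (simp add: mult.commute mult_left_mono flip: of_nat_power)
  also have "\<dots> \<le> C * ((card U)\<^sup>2) ^ r"
    using C card_mono[OF assms(1,2)] by (auto intro!: mult_left_mono power_mono)
  finally show ?thesis by simp
qed

text \<open>The condition on \<open>x\<close> refers to the ambient \<open>U\<close>, so that it
  covers at once all subsets \<open>S\<close> met in an induction on the slots.\<close>

lemma summable_norm_mono_series:
  assumes "finite U" "S \<subseteq> U" "p permutes U" "\<And>q. q permutes U \<Longrightarrow> cmod (f q) \<le> C"
    and "cmod x * (card U)\<^sup>2 < 1"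
  shows "summable (\<lambda>r. cmod (mono_sum f S r p * x ^ r))"
proof (rule summable_comparison_test'[where N = 0])
  show "summable (\<lambda>r. C * ((card U)\<^sup>2 * cmod x) ^ r)"
    using assms(5) by (intro summable_mult summable_geometric) (simp add: mult.commute)
  fix r
  show "norm (cmod (mono_sum f S r p * x ^ r)) \<le> C * ((card U)\<^sup>2 * cmod x) ^ r"
    using mult_right_mono[OF norm_mono_sum_le[OF assms(1-4), where r = r], where c = "cmod x ^ r"]
    by (simp add: norm_mult norm_power power_mult_distrib mult.assoc)
qed

text \<open>Applying 1 - x J_m to the series of \<open>insert m T\<close> gives that of
  \<open>T\<close>: this is the geometric series for the inverse of 1 - x J_m.\<close>

lemma mono_series_insert:
  assumes "finite U" "insert m T \<subseteq> U" "p permutes U" "\<And>q. q permutes U \<Longrightarrow> cmod (f q) \<le> C"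
    and "cmod x * (card U)\<^sup>2 < 1" and "\<forall>y\<in>T. y < m"
  shows "mono_series f (insert m T) x p = mono_series f T x p +
     x * (\<Sum>k\<in>T. mono_series f (insert m T) x (Transposition.transpose k m \<circ> p))"
proof -
  have finT: "finite T" using finite_subset[OF assms(2,1)] by simp
  have TU: "T \<subseteq> U" using assms by auto
  have sum1: "summable (\<lambda>r. mono_sum f S r q * x ^ r)" if "S \<subseteq> U" "q permutes U" for S q
    using summable_norm_cancel[OF summable_norm_mono_series[OF assms(1) that assms(4,5)]] .
  have qU: "Transposition.transpose k m \<circ> p permutes U" if "k \<in> T" for k
    using that assms by (intro permutes_compose[OF assms(3)] permutes_swap_id) auto
  have s': "summable (\<lambda>r. mono_sum f T (Suc r) p * x ^ Suc r)"
    using summable_Suc_iff[THEN iffD2, OF sum1[OF TU assms(3)]] .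
  have "mono_series f (insert m T) x p = f p + (\<Sum>r. mono_sum f (insert m T) (Suc r) p * x ^ Suc r)"
    unfolding mono_series_def using suminf_split_head[OF sum1[OF assms(2,3)]] by simp
  also have "(\<lambda>r. mono_sum f (insert m T) (Suc r) p * x ^ Suc r) = (\<lambda>r. mono_sum f T (Suc r) p * x ^ Suc r
       + x * (\<Sum>k\<in>T. mono_sum f (insert m T) r (Transposition.transpose k m \<circ> p) * x ^ r))"
    by (simp add: mono_sum_insert[OF finT assms(6)] algebra_simps sum_distrib_left)
  also have "(\<Sum>r. mono_sum f T (Suc r) p * x ^ Suc r
       + x * (\<Sum>k\<in>T. mono_sum f (insert m T) r (Transposition.transpose k m \<circ> p) * x ^ r)) =
      (\<Sum>r. mono_sum f T (Suc r) p * x ^ Suc r) +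
      (\<Sum>r. x * (\<Sum>k\<in>T. mono_sum f (insert m T) r (Transposition.transpose k m \<circ> p) * x ^ r))"
    by (intro suminf_add[symmetric] summable_mult summable_sum) (rule s', rule sum1[OF assms(2) qU])
  also have "(\<Sum>r. x * (\<Sum>k\<in>T. mono_sum f (insert m T) r (Transposition.transpose k m \<circ> p) * x ^ r)) =
      x * (\<Sum>k\<in>T. mono_series f (insert m T) x (Transposition.transpose k m \<circ> p))"
    unfolding mono_series_def using sum1[OF assms(2) qU]
    by (simp add: suminf_mult summable_sum suminf_sum)
  also have "f p + ((\<Sum>r. mono_sum f T (Suc r) p * x ^ Suc r) +
      x * (\<Sum>k\<in>T. mono_series f (insert m T) x (Transposition.transpose k m \<circ> p))) =
      (f p + (\<Sum>r. mono_sum f T (Suc r) p * x ^ Suc r)) +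
      x * (\<Sum>k\<in>T. mono_series f (insert m T) x (Transposition.transpose k m \<circ> p))" by simp
  also have "f p + (\<Sum>r. mono_sum f T (Suc r) p * x ^ Suc r) = mono_series f T x p"
    unfolding mono_series_def using suminf_split_head[OF sum1[OF TU assms(3)]] by simp
  finally show ?thesis .
qed

lemma orbit_prod_cong_exponent:
  assumes "p permutes S" "\<And>x. x \<in> S \<Longrightarrow> a x = b x"
  shows "orbit_prod w S p a = orbit_prod w S p b"
  unfolding orbit_prod_def using permutes_orbit_subset[OF assms(1)] assms(2)
  by (intro prod.cong refl arg_cong[of _ _ w] sum.cong) auto

text \<open>The transpositions of the series multiply from the left, so a right factor passes
  through and can be moved from the permutation summed over to the argument.\<close>

lemma mono_series_comp_right:
  "mono_series (\<lambda>q. f (q \<circ> t \<circ> s)) S x p = mono_series (\<lambda>q. f (q \<circ> s)) S x (p \<circ> t)"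
  by (simp add: mono_series_def mono_sum_def o_assoc)

text \<open>The operator on the left of the loop equation is diagonally dominant.\<close>

lemma loop_operator_injective:
  fixes h :: "(nat \<Rightarrow> nat) \<Rightarrow> complex"
  assumes "finite U" "insert m T \<subseteq> U" "card T < N"
    and "\<And>p. p permutes U \<Longrightarrow> of_nat N * h p + (\<Sum>k\<in>T. h (Transposition.transpose k m \<circ> p)) = 0"
    and "p permutes U"
  shows "h p = 0"
proof -
  let ?P = "{q. q permutes U}"
  have finP: "finite ?P" using assms(1) finite_permutations by auto
  have finT: "finite T" using finite_subset[OF assms(2,1)] by simp
  define C where "C = Max ((\<lambda>q. cmod (h q)) ` ?P)"
  have "C \<in> (\<lambda>q. cmod (h q)) ` ?P" unfolding C_def using finP assms(5) by (intro Max_in) auto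
  then obtain q where q: "q permutes U" "C = cmod (h q)" by auto
  have le: "cmod (h r) \<le> C" if "r permutes U" for r
    unfolding C_def using finP that by (intro Max_ge) auto
  have "of_nat N * h q = - (\<Sum>k\<in>T. h (Transposition.transpose k m \<circ> q))"
    using assms(4)[OF q(1)] by (simp add: add_eq_0_iff)
  then have "real N * C = cmod (\<Sum>k\<in>T. h (Transposition.transpose k m \<circ> q))"
    using q by (metis norm_minus_cancel norm_mult norm_of_nat)
  also have "\<dots> \<le> (\<Sum>k\<in>T. C)"
    using assms(2) by (intro sum_norm_le le permutes_compose[OF q(1)] permutes_swap_id) auto
  also have "\<dots> = real (card T) * C" by simp
  finally have "real N * C \<le> real (card T) * C" .
  then have "C \<le> 0" using assms(3) by (meson mult_le_cancel_right not_le of_nat_less_iff)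
  then have "cmod (h p) \<le> 0" using le[OF assms(5)] by linarith
  then show ?thesis by simp
qed

text \<open>The largest slot \<open>m\<close> is eliminated first. Expanding \<open>(N + J\<^sub>m)\<^sup>-\<^sup>1\<close> yields the transpositions with
  larger entry \<open>m\<close>, and the terms on the right correspond to inserting \<open>m\<close> into \<open>\<sigma>\<close>.\<close>

theorem loop_solution:
  fixes g :: "(nat \<Rightarrow> nat) \<Rightarrow> (nat \<Rightarrow> nat) \<Rightarrow> complex"
  assumes U: "finite U" "(card U)\<^sup>2 < N"
    and loop: "\<And>S m a p. S \<subseteq> U \<Longrightarrow> m \<in> S \<Longrightarrow> (\<forall>l. l \<notin> S \<longrightarrow> a l = 0) \<Longrightarrow> p permutes U \<Longrightarrow>
      of_nat N * g a p + (\<Sum>k\<in>S - {m}. g a (Transposition.transpose k m \<circ> p)) =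
      w (a m) * g (a(m := 0)) p +
      (\<Sum>k\<in>S - {m}. g (a(k := a k + a m, m := 0)) (p \<circ> Transposition.transpose k m))"
    and bound: "\<And>q. q permutes U \<Longrightarrow> cmod (g (\<lambda>_. 0) q) \<le> C"
    and S: "S \<subseteq> U" and a: "\<forall>l. l \<notin> S \<longrightarrow> a l = 0" and p: "p permutes U"
  shows "g a p = (1 / of_nat N) ^ card S * (\<Sum>\<sigma> | \<sigma> permutes S. orbit_prod w S \<sigma> a *
      mono_series (\<lambda>q. g (\<lambda>_. 0) (q \<circ> \<sigma>)) S (- 1 / of_nat N) p)"
proof -
  have N: "N > 0" using U by auto
  define x :: complex where "x = - 1 / of_nat N"
  define f where "f = g (\<lambda>_. 0)"
  have x: "cmod x * (card U)\<^sup>2 < 1" using U N by (simp add: x_def norm_divide field_simps flip: of_nat_power)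
  have "finite S" using S U finite_subset by blast
  then have "\<lbrakk>S \<subseteq> U; \<forall>l. l \<notin> S \<longrightarrow> a l = 0; p permutes U\<rbrakk> \<Longrightarrow>
     g a p = (1 / of_nat N) ^ card S * (\<Sum>\<sigma> | \<sigma> permutes S. orbit_prod w S \<sigma> a *
      mono_series (\<lambda>q. f (q \<circ> \<sigma>)) S x p)" for a p
  proof (induction S arbitrary: a p rule: finite_linorder_max_induct)
    \<comment> \<open>No slot is left: \<open>a\<close> vanishes identically and only the empty
      sequence contributes.\<close>
    case empty
    then have "a = (\<lambda>_. 0)" by auto
    moreover have "mono_sum f {} r p = (if r = 0 then f p else 0)" for f r p
    proof -
      have "mono_lists {} r = (if r = 0 then {[]} else {})"
        using mono_lists_subset[of "{}" r] by auto
      then show ?thesis by (auto simp: mono_sum_def)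
    qed
    then have "mono_series f {} x p = f p" for f p
      by (simp add: mono_series_def if_distrib[of "\<lambda>y. y * _"] cong: if_cong)
         (subst suminf_finite[of "{0}"], auto)
    ultimately show ?case by (simp add: f_def orbit_prod_def permutes_empty)
  next
    case (insert m T)
    have mT: "m \<notin> T" using insert by auto
    have TU: "T \<subseteq> U" using insert by auto
    let ?\<tau> = "\<lambda>k. Transposition.transpose k m"
    \<comment> \<open>\<open>G\<close> is the claimed value as a function of \<open>p\<close>. It is
      shown to satisfy the same linear system as \<open>g a\<close>, and diagonal dominance then
      gives equality.\<close>
    define G where "G = (\<lambda>p. (1 / of_nat N) ^ card (insert m T) * (\<Sum>\<sigma> | \<sigma> permutes insert m T.
      orbit_prod w (insert m T) \<sigma> a * mono_series (\<lambda>q. f (q \<circ> \<sigma>)) (insert m T) x p))"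
    have bd: "cmod (f (q \<circ> \<sigma>)) \<le> C" if "\<sigma> permutes insert m T" "q permutes U" for \<sigma> q
      unfolding f_def using that insert.prems(1) by (intro bound permutes_compose) (auto intro: permutes_subset)
    \<comment> \<open>At x = -1/N, applying \<open>N + J_m\<close> removes \<open>m\<close> from the
      series and leaves a factor \<open>N\<close>, which lowers the power of 1/N in front by
      one.\<close>
    have rec: "of_nat N * mono_series (\<lambda>q. f (q \<circ> \<sigma>)) (insert m T) x p +
        (\<Sum>k\<in>T. mono_series (\<lambda>q. f (q \<circ> \<sigma>)) (insert m T) x (?\<tau> k \<circ> p)) =
        of_nat N * mono_series (\<lambda>q. f (q \<circ> \<sigma>)) T x p" if "\<sigma> permutes insert m T" "p permutes U" for \<sigma> p
      using mono_series_insert[OF U(1) insert.prems(1) that(2) bd[OF that(1)] x insert.hyps(2)] N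
      by (simp add: x_def field_simps)
    have Glin: "of_nat N * G p + (\<Sum>k\<in>T. G (?\<tau> k \<circ> p)) =
       w (a m) * g (a(m := 0)) p + (\<Sum>k\<in>T. g (a(k := a k + a m, m := 0)) (p \<circ> ?\<tau> k))"
      if p: "p permutes U" for p
    proof -
      let ?c = "(1 / of_nat N) ^ card T :: complex"
      have "of_nat N * G p + (\<Sum>k\<in>T. G (?\<tau> k \<circ> p)) = (1 / of_nat N) ^ card (insert m T) *
         (\<Sum>\<sigma> | \<sigma> permutes insert m T. orbit_prod w (insert m T) \<sigma> a *
           (of_nat N * mono_series (\<lambda>q. f (q \<circ> \<sigma>)) (insert m T) x p +
            (\<Sum>k\<in>T. mono_series (\<lambda>q. f (q \<circ> \<sigma>)) (insert m T) x (?\<tau> k \<circ> p))))"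
        unfolding G_def
        by (simp add: sum_distrib_left distrib_left sum.distrib mult_ac)
           (rule sum.swap)
      also have "\<dots> = (1 / of_nat N) ^ card (insert m T) *
         (\<Sum>\<sigma> | \<sigma> permutes insert m T. orbit_prod w (insert m T) \<sigma> a *
           (of_nat N * mono_series (\<lambda>q. f (q \<circ> \<sigma>)) T x p))"
        using rec p by (intro arg_cong2[of _ _ _ _ "(*)"] sum.cong refl) auto
      also have "\<dots> = ?c * (\<Sum>\<sigma> | \<sigma> permutes insert m T. orbit_prod w (insert m T) \<sigma> a *
           mono_series (\<lambda>q. f (q \<circ> \<sigma>)) T x p)"
        using N mT insert.hyps(1) by (simp add: sum_distrib_left mult_ac)
      \<comment> \<open>Every permutation of \<open>insert m T\<close> is (m b) composed with a
        permutation of \<open>T\<close>. The choice b = m gives a new fixed point and the factor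
        \<open>w (a m)\<close>; a choice b = k in \<open>T\<close> adds the exponent of
        \<open>m\<close> to that of \<open>k\<close>. These are the two kinds of terms on the right
        of the loop equation.\<close>
      also have "(\<Sum>\<sigma> | \<sigma> permutes insert m T. orbit_prod w (insert m T) \<sigma> a *
           mono_series (\<lambda>q. f (q \<circ> \<sigma>)) T x p) =
          (\<Sum>\<sigma> | \<sigma> permutes T. w (a m) * orbit_prod w T \<sigma> (a(m := 0)) * mono_series (\<lambda>q. f (q \<circ> \<sigma>)) T x p) +
          (\<Sum>k\<in>T. \<Sum>\<sigma> | \<sigma> permutes T. orbit_prod w T \<sigma> (a(k := a k + a m, m := 0)) *
             mono_series (\<lambda>q. f (q \<circ> \<sigma>)) T x (p \<circ> ?\<tau> k))"
      proof (subst sum_over_permutations_insert[OF insert.hyps(1) mT], subst sum.insert[OF insert.hyps(1) mT],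
          intro arg_cong2[of _ _ _ _ "(+)"] sum.cong refl)
        fix \<sigma> assume "\<sigma> \<in> {\<sigma>. \<sigma> permutes T}"
        then have \<sigma>: "\<sigma> permutes T" by simp
        have "orbit_prod w T \<sigma> a = orbit_prod w T \<sigma> (a(m := 0))"
          by (rule orbit_prod_cong_exponent[OF \<sigma>]) (use mT in auto)
        moreover have "Transposition.transpose m m \<circ> \<sigma> = \<sigma>" by simp
        ultimately show "orbit_prod w (insert m T) (Transposition.transpose m m \<circ> \<sigma>) a *
              mono_series (\<lambda>q. f (q \<circ> (Transposition.transpose m m \<circ> \<sigma>))) T x p =
              w (a m) * orbit_prod w T \<sigma> (a(m := 0)) * mono_series (\<lambda>q. f (q \<circ> \<sigma>)) T x p"
          by (simp only: orbit_prod_insert_fixed[OF insert.hyps(1) \<sigma> mT])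
        fix k assume k: "k \<in> T"
        have "orbit_prod w T \<sigma> (a(k := a k + a m)) = orbit_prod w T \<sigma> (a(k := a k + a m, m := 0))"
          by (rule orbit_prod_cong_exponent[OF \<sigma>]) (use mT in auto)
        then show "orbit_prod w (insert m T) (Transposition.transpose m k \<circ> \<sigma>) a *
              mono_series (\<lambda>q. f (q \<circ> (Transposition.transpose m k \<circ> \<sigma>))) T x p =
              orbit_prod w T \<sigma> (a(k := a k + a m, m := 0)) * mono_series (\<lambda>q. f (q \<circ> \<sigma>)) T x (p \<circ> ?\<tau> k)"
          using orbit_prod_insert_transpose[OF insert.hyps(1) \<sigma> mT k, of w a]
          by (simp add: transpose_commute[of m k] o_assoc mono_series_comp_right)
      qed
      also have "?c * \<dots> = w (a m) * g (a(m := 0)) p + (\<Sum>k\<in>T. g (a(k := a k + a m, m := 0)) (p \<circ> ?\<tau> k))"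
      proof -
        have 1: "g (a(m := 0)) p = ?c * (\<Sum>\<sigma> | \<sigma> permutes T. orbit_prod w T \<sigma> (a(m := 0)) * mono_series (\<lambda>q. f (q \<circ> \<sigma>)) T x p)"
          by (rule insert.IH) (use TU p insert.prems in auto)
        have 2: "g (a(k := a k + a m, m := 0)) (p \<circ> ?\<tau> k) = ?c * (\<Sum>\<sigma> | \<sigma> permutes T. orbit_prod w T \<sigma> (a(k := a k + a m, m := 0)) *
             mono_series (\<lambda>q. f (q \<circ> \<sigma>)) T x (p \<circ> ?\<tau> k))" if k: "k \<in> T" for k
        proof (rule insert.IH)
          show "p \<circ> ?\<tau> k permutes U"
            using k insert.prems by (intro permutes_compose[OF _ p] permutes_swap_id) auto
        qed (use TU insert.prems k in auto)
        show ?thesis using 1 2 by (simp add: sum_distrib_left distrib_left mult_ac)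
      qed
      finally show ?thesis .
    qed
    have "g a p - G p = 0"
    proof (rule loop_operator_injective[OF U(1) insert.prems(1), where N = N and h = "\<lambda>p. g a p - G p"])
      have "card T \<le> card U" using TU U by (intro card_mono) auto
      also have "card U \<le> (card U)\<^sup>2" by (simp add: power2_eq_square)
      finally show "card T < N" using U by simp
      fix p assume p: "p permutes U"
      show "of_nat N * (g a p - G p) + (\<Sum>k\<in>T. g a (?\<tau> k \<circ> p) - G (?\<tau> k \<circ> p)) = 0"
        using loop[OF insert.prems(1) _ insert.prems(2) p, of m] Glin[OF p] mT
        by (simp add: sum_subtractf algebra_simps)
    qed (rule insert.prems)
    then have "g a p = G p" by (simp only: right_minus_eq)
    then show ?case unfolding G_def .
  qed
  from this[OF S a p] show ?thesis by (simp add: x_def f_def)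
qed

section \<open>Decomposition into connected components\<close>

text \<open>Inclusion is enough for \<open>\<sigma>\<close>, since an injective map of a finite set
  into itself is onto. Closure under the third permutation \<open>\<rho>\<close> of the tuple is
  then automatic.\<close>

definition closed_under :: "(nat \<Rightarrow> nat) \<Rightarrow> (nat \<times> nat) list \<Rightarrow> nat set \<Rightarrow> bool" where
  "closed_under \<sigma> ts T \<longleftrightarrow> \<sigma> ` T \<subseteq> T \<and> (\<forall>(s, t)\<in>set ts. s \<in> T \<longleftrightarrow> t \<in> T)"

text \<open>Transitivity of the generated group, phrased through invariant subsets because these
  restrict to components without mention of group elements;
  \<open>transitive_iff_connected_on\<close> makes the link.\<close>

definition connected_on :: "nat set \<Rightarrow> (nat \<Rightarrow> nat) \<Rightarrow> (nat \<times> nat) list \<Rightarrow> bool" where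
  "connected_on S \<sigma> ts \<longleftrightarrow> (\<forall>T\<subseteq>S. T \<noteq> {} \<longrightarrow> closed_under \<sigma> ts T \<longrightarrow> T = S)"

text \<open>A pair \<open>(\<sigma>, ts)\<close> stands for the tuple \<open>(\<rho>, \<sigma>, \<tau>\<^sub>1, \<dots>, \<tau>\<^sub>r)\<close> with \<open>\<rho> = (\<sigma> \<tau>\<^sub>1 \<cdots> \<tau>\<^sub>r)\<^sup>-\<^sup>1\<close>, which has the
  same orbits as \<open>\<sigma> \<tau>\<^sub>1 \<cdots> \<tau>\<^sub>r\<close>.\<close>

definition mono_structs :: "nat set \<Rightarrow> nat \<Rightarrow> ((nat \<Rightarrow> nat) \<times> (nat \<times> nat) list) set" where
  "mono_structs S r = {\<sigma>. \<sigma> permutes S} \<times> mono_lists S r"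

definition conn_structs :: "nat set \<Rightarrow> nat \<Rightarrow> ((nat \<Rightarrow> nat) \<times> (nat \<times> nat) list) set" where
  "conn_structs S r = {(\<sigma>, ts) \<in> mono_structs S r. connected_on S \<sigma> ts}"

definition struct_weight ::
    "(nat \<Rightarrow> complex) \<Rightarrow> (nat \<Rightarrow> complex) \<Rightarrow> nat set \<Rightarrow> (nat \<Rightarrow> nat) \<times> (nat \<times> nat) list \<Rightarrow> complex" where
  "struct_weight v w S = (\<lambda>(\<sigma>, ts). orbit_prod v S (\<sigma> \<circ> tprod ts) (\<lambda>_. 1) * orbit_prod w S \<sigma> (\<lambda>_. 1))"

lemma finite_mono_structs: "finite S \<Longrightarrow> finite (mono_structs S r)"
  by (auto simp: mono_structs_def finite_permutations finite_mono_lists)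

lemma conn_structs_subset: "conn_structs S r \<subseteq> mono_structs S r"
  by (auto simp: conn_structs_def)

lemma perm_restrict_permutes:
  assumes "\<sigma> permutes S" "finite S" "T \<subseteq> S" "\<sigma> ` T \<subseteq> T"
  shows "perm_restrict \<sigma> T permutes T"
proof (rule bij_imp_permutes)
  have fT: "finite T" by (rule finite_subset[OF assms(3,2)])
  have inj: "inj_on \<sigma> T" using permutes_inj_on[OF assms(1)] .
  then have "\<sigma> ` T = T" using assms(4) fT by (simp add: endo_inj_surj)
  then have "bij_betw \<sigma> T T" using inj by (simp add: bij_betw_def)
  then show "bij_betw (perm_restrict \<sigma> T) T T"
    by (rule bij_betw_cong[THEN iffD1, rotated]) (simp add: perm_restrict_def)
qed (simp add: perm_restrict_def)

text \<open>\<open>T'\<close> is finite and \<open>\<sigma>\<close> injective, so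
  \<open>\<sigma>\<close> maps \<open>T'\<close> onto itself and sends no outside point into
  it.\<close>

lemma closed_under_Diff:
  assumes "\<sigma> permutes S" "finite S" "T \<subseteq> S" "closed_under \<sigma> ts T" "T' \<subseteq> T" "closed_under \<sigma> ts T'"
  shows "closed_under \<sigma> ts (T - T')"
proof -
  have "finite T'" by (rule finite_subset[OF order_trans[OF assms(5,3)] assms(2)])
  then have "\<sigma> ` T' = T'" using assms(6) permutes_inj_on[OF assms(1), of T'] by (simp add: closed_under_def endo_inj_surj)
  then have "\<sigma> ` (T - T') = \<sigma> ` T - T'" using permutes_inj[OF assms(1)] by (simp add: image_set_diff)
  then show ?thesis using assms(4,6) unfolding closed_under_def by fast
qed

text \<open>A transposition outside \<open>T\<close> commutes with the product of those inside
  \<open>T\<close>, so it can be moved to the right past them.\<close>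

lemma tprod_filter:
  assumes "\<forall>(s, t)\<in>set ts. s \<in> T \<longleftrightarrow> t \<in> T"
  shows "tprod ts = tprod (filter (\<lambda>(s, t). t \<in> T) ts) \<circ> tprod (filter (\<lambda>(s, t). t \<notin> T) ts)"
  using assms
proof (induction ts)
  case (Cons a ts)
  obtain s t where a: "a = (s, t)" by (cases a)
  let ?f = "filter (\<lambda>(s, t). t \<in> T) ts" and ?g = "filter (\<lambda>(s, t). t \<notin> T) ts"
  have IH: "tprod ts = tprod ?f \<circ> tprod ?g" using Cons by auto
  have st: "s \<in> T \<longleftrightarrow> t \<in> T" using Cons.prems a by auto
  show ?case
  proof (cases "t \<in> T")
    case True
    then show ?thesis by (simp only: a tprod_Cons IH filter.simps split if_True not_True_eq_False if_False o_assoc)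
  next
    case False
    have "Transposition.transpose s t permutes - T" using False st by (intro permutes_swap_id) auto
    moreover have "tprod ?f permutes T" by (rule tprod_permutes) (use Cons.prems in auto)
    ultimately have "Transposition.transpose s t \<circ> tprod ?f = tprod ?f \<circ> Transposition.transpose s t"
      by (intro permutes_comp_disjoint_commute[of _ "- T" _ T]) auto
    then show ?thesis using False by (simp only: a tprod_Cons IH filter.simps split if_True not_False_eq_True if_False o_assoc)
  qed
qed simp

text \<open>The orbit of \<open>x\<close> under the generated group, taken as a least closed set so
  that no words in the generators appear.\<close>

definition component :: "nat set \<Rightarrow> nat \<Rightarrow> (nat \<Rightarrow> nat) \<times> (nat \<times> nat) list \<Rightarrow> nat set" where
  "component S x = (\<lambda>(\<sigma>, ts). \<Inter>{T. T \<subseteq> S \<and> x \<in> T \<and> closed_under \<sigma> ts T})"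

lemma component_props:
  assumes "(\<sigma>, ts) \<in> mono_structs S r" "x \<in> S"
  shows "component S x (\<sigma>, ts) \<subseteq> S" "x \<in> component S x (\<sigma>, ts)"
    "closed_under \<sigma> ts (component S x (\<sigma>, ts))"
    "\<And>T. T \<subseteq> S \<Longrightarrow> x \<in> T \<Longrightarrow> closed_under \<sigma> ts T \<Longrightarrow> component S x (\<sigma>, ts) \<subseteq> T"
proof -
  have \<sigma>: "\<sigma> permutes S" and ts: "ts \<in> mono_lists S r" using assms(1) by (auto simp: mono_structs_def)
  have "closed_under \<sigma> ts S"
    using permutes_image[OF \<sigma>] ts by (auto simp: closed_under_def mono_lists_def)
  then show "component S x (\<sigma>, ts) \<subseteq> S" using assms(2) by (auto simp: component_def)
  show "x \<in> component S x (\<sigma>, ts)" by (simp add: component_def)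
  show "closed_under \<sigma> ts (component S x (\<sigma>, ts))"
    unfolding closed_under_def component_def by (auto simp: closed_under_def split: prod.splits)
  show "\<And>T. T \<subseteq> S \<Longrightarrow> x \<in> T \<Longrightarrow> closed_under \<sigma> ts T \<Longrightarrow> component S x (\<sigma>, ts) \<subseteq> T"
    by (auto simp: component_def)
qed

lemma mono_lists_filter:
  assumes "ts \<in> mono_lists S r" "\<And>s t. (s, t) \<in> set ts \<Longrightarrow> P (s, t) \<Longrightarrow> s \<in> T \<and> t \<in> T"
  shows "filter P ts \<in> mono_lists T (length (filter P ts))"
  using assms by (auto simp: mono_lists_def sorted_filter)

text \<open>Two monotone sequences on disjoint sets have no larger entry in common, so they can be merged into
  a monotone sequence in exactly one way, namely by a stable sort.\<close>

lemma sum_struct_weight_fiber: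
  assumes "finite S" "x \<in> S" "T \<subseteq> S" "x \<in> T"
  shows "(\<Sum>X | X \<in> mono_structs S r \<and> component S x X = T. struct_weight v w S X) =
    (\<Sum>q\<le>r. (\<Sum>X\<in>conn_structs T q. struct_weight v w T X) * (\<Sum>X\<in>mono_structs (S - T) (r - q). struct_weight v w (S - T) X))"
proof -
  have fT: "finite T" and fD: "finite (S - T)" using finite_subset[OF assms(3,1)] assms(1) by auto
  let ?D = "S - T"
  let ?I = "Sigma {..r} (\<lambda>q. conn_structs T q \<times> mono_structs ?D (r - q))"
  let ?A = "{X. X \<in> mono_structs S r \<and> component S x X = T}"
  define f1 where "f1 = filter (\<lambda>(s::nat, t). t \<in> T)"
  define f2 where "f2 = filter (\<lambda>(s::nat, t). t \<notin> T)"
  \<comment> \<open>\<open>j\<close> cuts a structure into its part on the component of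
    \<open>x\<close> and the rest; \<open>i\<close> reassembles the two by composing the
    permutations and sorting the lists by larger entry.\<close>
  define j where "j = (\<lambda>(\<sigma> :: nat \<Rightarrow> nat, ts). (length (f1 ts), (perm_restrict \<sigma> T, f1 ts), (perm_restrict \<sigma> ?D, f2 ts)))"
  define i where "i = (\<lambda>(q::nat, (\<sigma>1 :: nat \<Rightarrow> nat, ts1), (\<sigma>2 :: nat \<Rightarrow> nat, ts2)).
     (\<sigma>1 \<circ> \<sigma>2, sort_key snd (ts1 @ ts2) :: (nat \<times> nat) list))"
  have len: "length (f1 ts) + length (f2 ts) = length ts" for ts
  proof -
    have "f2 = filter (\<lambda>x. \<not> (case x of (s, t) \<Rightarrow> t \<in> T))" unfolding f2_def by (rule arg_cong[of _ _ filter]) auto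
    then show ?thesis unfolding f1_def using sum_length_filter_compl by metis
  qed
  have A: "\<sigma> permutes S" "ts \<in> mono_lists S r" "closed_under \<sigma> ts T"
      "perm_restrict \<sigma> T permutes T" "perm_restrict \<sigma> ?D permutes ?D"
      "f1 ts \<in> mono_lists T (length (f1 ts))" "f2 ts \<in> mono_lists ?D (r - length (f1 ts))" "length (f1 ts) \<le> r"
      "connected_on T (perm_restrict \<sigma> T) (f1 ts)"
      "perm_restrict \<sigma> T \<circ> perm_restrict \<sigma> ?D = \<sigma>" "sort_key snd (f1 ts @ f2 ts) = ts"
    if X: "(\<sigma>, ts) \<in> ?A" for \<sigma> ts
  proof -
    show \<sigma>: "\<sigma> permutes S" and ts: "ts \<in> mono_lists S r" using X by (auto simp: mono_structs_def)
    have Xm: "(\<sigma>, ts) \<in> mono_structs S r" and cT: "component S x (\<sigma>, ts) = T" using X by auto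
    note comp = component_props[OF Xm assms(2), unfolded cT]
    show cl: "closed_under \<sigma> ts T" by (rule comp(3))
    have clS: "closed_under \<sigma> ts S" using permutes_image[OF \<sigma>] ts by (auto simp: closed_under_def mono_lists_def)
    have clD: "closed_under \<sigma> ts ?D" using closed_under_Diff[OF \<sigma> assms(1) subset_refl clS assms(3) cl] .
    show p1: "perm_restrict \<sigma> T permutes T"
      by (rule perm_restrict_permutes[OF \<sigma> assms(1,3)]) (use cl in \<open>simp add: closed_under_def\<close>)
    show p2: "perm_restrict \<sigma> ?D permutes ?D"
      by (rule perm_restrict_permutes[OF \<sigma> assms(1)]) (use clD in \<open>auto simp: closed_under_def\<close>)
    show "f1 ts \<in> mono_lists T (length (f1 ts))"
      unfolding f1_def by (rule mono_lists_filter[OF ts]) (use cl in \<open>auto simp: closed_under_def\<close>)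
    have "f2 ts \<in> mono_lists ?D (length (f2 ts))"
      unfolding f2_def by (rule mono_lists_filter[OF ts]) (use cl ts in \<open>auto simp: closed_under_def mono_lists_def\<close>)
    moreover have "length (f2 ts) = r - length (f1 ts)" "length (f1 ts) \<le> r" using len[of ts] ts by (auto simp: mono_lists_def)
    ultimately show "f2 ts \<in> mono_lists ?D (r - length (f1 ts))" "length (f1 ts) \<le> r" by auto
    show "connected_on T (perm_restrict \<sigma> T) (f1 ts)"
      unfolding connected_on_def
    proof (intro allI impI)
      fix T' assume T': "T' \<subseteq> T" "T' \<noteq> {}" "closed_under (perm_restrict \<sigma> T) (f1 ts) T'"
      have "\<sigma> ` T' \<subseteq> T'"
      proof
        fix z assume "z \<in> \<sigma> ` T'"
        then obtain u where u: "u \<in> T'" "z = \<sigma> u" by auto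
        then have "perm_restrict \<sigma> T u \<in> T'" using T'(3) by (auto simp: closed_under_def)
        then show "z \<in> T'" using u T'(1) by (auto simp: perm_restrict_def)
      qed
      moreover have "s \<in> T' \<longleftrightarrow> t \<in> T'" if "(s, t) \<in> set ts" for s t
      proof (cases "t \<in> T")
        case True
        then have "(s, t) \<in> set (f1 ts)" using that by (auto simp: f1_def)
        then show ?thesis using T'(3) by (auto simp: closed_under_def)
      next
        case False
        then have "s \<notin> T" using cl that by (auto simp: closed_under_def)
        then show ?thesis using False T'(1) by auto
      qed
      ultimately have cT': "closed_under \<sigma> ts T'" by (auto simp: closed_under_def)
      \<comment> \<open>If the closed set contains \<open>x\<close>, minimality of the component
        gives all of \<open>T\<close>; otherwise its complement in \<open>T\<close> is closed and
        contains \<open>x\<close>, which would make \<open>T'\<close> empty.\<close>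
      show "T' = T"
      proof (cases "x \<in> T'")
        case True
        then show ?thesis using comp(4)[of T'] cT' T'(1) assms(3) by auto
      next
        case False
        have "closed_under \<sigma> ts (T - T')" by (rule closed_under_Diff[OF \<sigma> assms(1,3) cl T'(1) cT'])
        then have "T \<subseteq> T - T'" using comp(4)[of "T - T'"] False assms(3,4) by auto
        then show ?thesis using T' by auto
      qed
    qed
    show "perm_restrict \<sigma> T \<circ> perm_restrict \<sigma> ?D = \<sigma>"
    proof
      fix y
      have "\<sigma> y \<in> ?D" if "y \<in> ?D" using clD that by (auto simp: closed_under_def)
      moreover have "\<sigma> y = y" if "y \<notin> S" using \<sigma> that by (simp add: permutes_def)
      ultimately show "(perm_restrict \<sigma> T \<circ> perm_restrict \<sigma> ?D) y = \<sigma> y"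
        using assms(3) by (auto simp: perm_restrict_def)
    qed
    show "sort_key snd (f1 ts @ f2 ts) = ts"
    proof (rule properties_for_sort_key)
      have "mset (f1 ts @ f2 ts) = mset (filter (\<lambda>x. snd x \<in> T) ts) + mset (filter (\<lambda>x. \<not> snd x \<in> T) ts)"
        by (simp add: f1_def f2_def case_prod_unfold)
      then show "mset ts = mset (f1 ts @ f2 ts)" by (simp flip: multiset_partition)
      show "sorted (map snd ts)" using ts by (simp add: mono_lists_def)
      fix k
      \<comment> \<open>A larger entry lies either in \<open>T\<close> or outside it, so for each
        key only one of the two lists contributes, and it keeps the original order.\<close>
      show "filter (\<lambda>x. snd k = snd x) ts = filter (\<lambda>x. snd k = snd x) (f1 ts @ f2 ts)"
      proof (cases "snd k \<in> T")
        case True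
        have "filter (\<lambda>x. snd x \<in> T \<and> snd k = snd x) ts = filter (\<lambda>x. snd k = snd x) ts"
          by (rule filter_cong) (use True in auto)
        moreover have "filter (\<lambda>x. snd x \<notin> T \<and> snd k = snd x) ts = []" using True by (auto simp: filter_empty_conv)
        ultimately show ?thesis by (simp add: f1_def f2_def case_prod_unfold)
      next
        case False
        have "filter (\<lambda>x. snd x \<notin> T \<and> snd k = snd x) ts = filter (\<lambda>x. snd k = snd x) ts"
          by (rule filter_cong) (use False in auto)
        moreover have "filter (\<lambda>x. snd x \<in> T \<and> snd k = snd x) ts = []" using False by (auto simp: filter_empty_conv)
        ultimately show ?thesis by (simp add: f1_def f2_def case_prod_unfold)
      qed
    qed
  qed
  have B: "\<sigma>1 \<circ> \<sigma>2 permutes S" "sort_key snd (ts1 @ ts2) \<in> mono_lists S r"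
      "perm_restrict (\<sigma>1 \<circ> \<sigma>2) T = \<sigma>1" "perm_restrict (\<sigma>1 \<circ> \<sigma>2) ?D = \<sigma>2"
      "f1 (sort_key snd (ts1 @ ts2)) = ts1" "f2 (sort_key snd (ts1 @ ts2)) = ts2"
      "length ts1 = q" "component S x (\<sigma>1 \<circ> \<sigma>2, sort_key snd (ts1 @ ts2)) = T"
    if X: "(q, (\<sigma>1, ts1), (\<sigma>2, ts2)) \<in> ?I" for q \<sigma>1 ts1 \<sigma>2 ts2
  proof -
    have q: "q \<le> r" and p1: "\<sigma>1 permutes T" and p2: "\<sigma>2 permutes ?D" and t1: "ts1 \<in> mono_lists T q" and
      t2: "ts2 \<in> mono_lists ?D (r - q)" and con: "connected_on T \<sigma>1 ts1"
      using X by (auto simp: conn_structs_def mono_structs_def)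
    show p: "\<sigma>1 \<circ> \<sigma>2 permutes S"
      by (rule permutes_compose) (use p1 p2 assms(3) permutes_subset in auto)
    show ts: "sort_key snd (ts1 @ ts2) \<in> mono_lists S r"
      using t1 t2 q assms(3) by (auto simp: mono_lists_def)
    show "length ts1 = q" using t1 by (simp add: mono_lists_def)
    have s2: "\<sigma>2 y = y" if "y \<in> T" for y using p2 that by (auto simp: permutes_def)
    have s1: "\<sigma>1 y = y" if "y \<in> ?D" for y using p1 that by (auto simp: permutes_def)
    have s2D: "\<sigma>2 y \<in> ?D" if "y \<in> ?D" for y using permutes_in_image[OF p2, of y] that by simp
    show "perm_restrict (\<sigma>1 \<circ> \<sigma>2) T = \<sigma>1"
      using s2 p1 by (auto simp: perm_restrict_def fun_eq_iff permutes_def)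
    show "perm_restrict (\<sigma>1 \<circ> \<sigma>2) ?D = \<sigma>2"
    proof
      fix y show "perm_restrict (\<sigma>1 \<circ> \<sigma>2) ?D y = \<sigma>2 y"
      proof (cases "y \<in> ?D")
        case True
        then show ?thesis using s1[OF s2D[OF True]] by (simp only: perm_restrict_def o_apply if_True)
      next
        case False
        then show ?thesis using permutes_not_in[OF p2 False] by (simp only: perm_restrict_def if_False)
      qed
    qed
    have a1: "f1 ts1 = ts1" "f1 ts2 = []" "f2 ts1 = []" "f2 ts2 = ts2"
      using t1 t2 by (auto simp: f1_def f2_def mono_lists_def filter_id_conv filter_empty_conv)
    have srt: "sorted (map snd ts1)" "sorted (map snd ts2)" using t1 t2 by (auto simp: mono_lists_def)
    show "f1 (sort_key snd (ts1 @ ts2)) = ts1"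
      using a1 srt unfolding f1_def by (simp add: filter_sort sort_key_id_if_sorted)
    show "f2 (sort_key snd (ts1 @ ts2)) = ts2"
      using a1 srt unfolding f2_def by (simp add: filter_sort sort_key_id_if_sorted)
    have mem: "(\<sigma>1 \<circ> \<sigma>2, sort_key snd (ts1 @ ts2)) \<in> mono_structs S r" using p ts by (simp add: mono_structs_def)
    note comp = component_props[OF mem assms(2)]
    have "closed_under (\<sigma>1 \<circ> \<sigma>2) (sort_key snd (ts1 @ ts2)) T"
    proof -
      have "(\<sigma>1 \<circ> \<sigma>2) y \<in> T" if "y \<in> T" for y using s2[OF that] permutes_in_image[OF p1, of y] that by simp
      then show ?thesis using t1 t2 by (auto simp: closed_under_def mono_lists_def)
    qed
    then have 1: "component S x (\<sigma>1 \<circ> \<sigma>2, sort_key snd (ts1 @ ts2)) \<subseteq> T"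
      using comp(4) assms by auto
    let ?C = "component S x (\<sigma>1 \<circ> \<sigma>2, sort_key snd (ts1 @ ts2))"
    \<comment> \<open>The component of the merged structure lies in \<open>T\<close> and is closed
      for the first part, so connectedness of that part makes it all of \<open>T\<close>.\<close>
    have "closed_under \<sigma>1 ts1 ?C"
    proof -
      have "\<sigma>1 y \<in> ?C" if "y \<in> ?C" for y
      proof -
        have "(\<sigma>1 \<circ> \<sigma>2) y \<in> ?C" using comp(3) that by (auto simp: closed_under_def)
        then show ?thesis using s2 1 that by auto
      qed
      moreover have "s \<in> ?C \<longleftrightarrow> t \<in> ?C" if "(s, t) \<in> set ts1" for s t
        using comp(3) that by (auto simp: closed_under_def)
      ultimately show ?thesis by (auto simp: closed_under_def)
    qed
    then show "?C = T" using con 1 comp(2) by (auto simp: connected_on_def)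
  qed
  have "(\<Sum>X\<in>?A. struct_weight v w S X) =
    (\<Sum>(q, X1, X2)\<in>?I. struct_weight v w T X1 * struct_weight v w ?D X2)"
  proof (rule sum.reindex_bij_witness[where i = i and j = j])
    fix X assume X: "X \<in> ?A"
    obtain \<sigma> ts where Xe: "X = (\<sigma>, ts)" by (cases X)
    note a = A[OF X[unfolded Xe]]
    show "i (j X) = X" using a unfolding Xe i_def j_def by (simp only: split)
    show "j X \<in> ?I" using a unfolding Xe j_def by (simp add: conn_structs_def mono_structs_def)
    have cl: "\<forall>(s, t)\<in>set ts. s \<in> T \<longleftrightarrow> t \<in> T" using a(3) by (simp add: closed_under_def)
    let ?s1 = "perm_restrict \<sigma> T" and ?s2 = "perm_restrict \<sigma> ?D"
    have q1: "tprod (f1 ts) permutes T" by (rule mono_lists_permutes[OF a(6)]) simp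
    have q2: "tprod (f2 ts) permutes ?D" by (rule mono_lists_permutes[OF a(7)]) simp
    \<comment> \<open>Factors on \<open>T\<close> commute with factors on the complement, so the
      product separates into one permutation of each set and its cycles split accordingly.\<close>
    have com: "?s2 \<circ> tprod (f1 ts) = tprod (f1 ts) \<circ> ?s2"
      by (rule permutes_comp_disjoint_commute[OF a(5) q1]) auto
    have "\<sigma> \<circ> tprod ts = ?s1 \<circ> ?s2 \<circ> (tprod (f1 ts) \<circ> tprod (f2 ts))"
      using tprod_filter[OF cl] a(10) by (simp only: f1_def f2_def)
    also have "\<dots> = ?s1 \<circ> (?s2 \<circ> tprod (f1 ts)) \<circ> tprod (f2 ts)" by (simp only: o_assoc)
    also have "\<dots> = (?s1 \<circ> tprod (f1 ts)) \<circ> (?s2 \<circ> tprod (f2 ts))" unfolding com by (simp only: o_assoc)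
    finally have e: "\<sigma> \<circ> tprod ts = (?s1 \<circ> tprod (f1 ts)) \<circ> (?s2 \<circ> tprod (f2 ts))" .
    have S: "S = T \<union> ?D" using assms by auto
    have dj: "T \<inter> ?D = {}" by auto
    have w1: "orbit_prod v S (\<sigma> \<circ> tprod ts) (\<lambda>_. 1) =
       orbit_prod v T (?s1 \<circ> tprod (f1 ts)) (\<lambda>_. 1) * orbit_prod v ?D (?s2 \<circ> tprod (f2 ts)) (\<lambda>_. 1)"
      unfolding e using orbit_prod_disjoint[OF permutes_compose[OF q1 a(4)] permutes_compose[OF q2 a(5)] dj fT fD, of v "\<lambda>_. 1"] S
      by metis
    have w2: "orbit_prod w S \<sigma> (\<lambda>_. 1) = orbit_prod w T ?s1 (\<lambda>_. 1) * orbit_prod w ?D ?s2 (\<lambda>_. 1)"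
      using orbit_prod_disjoint[OF a(4,5) dj fT fD, of w "\<lambda>_. 1"] S a(10) by metis
    show "(case j X of (q, X1, X2) \<Rightarrow> struct_weight v w T X1 * struct_weight v w ?D X2) = struct_weight v w S X"
      unfolding Xe j_def struct_weight_def split w1 w2 by (simp only: mult_ac)
  next
    fix Y assume Y: "Y \<in> ?I"
    obtain q \<sigma>1 ts1 \<sigma>2 ts2 where Ye: "Y = (q, (\<sigma>1, ts1), (\<sigma>2, ts2))" by (cases Y) auto
    note b = B[OF Y[unfolded Ye]]
    show "j (i Y) = Y" unfolding Ye i_def j_def split b by (rule refl)
    show "i Y \<in> ?A" using b unfolding Ye i_def by (simp add: mono_structs_def)
  qed
  also have "\<dots> = (\<Sum>q\<le>r. \<Sum>(X1, X2)\<in>conn_structs T q \<times> mono_structs ?D (r - q). struct_weight v w T X1 * struct_weight v w ?D X2)"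
    by (subst sum.Sigma) (auto simp: finite_mono_structs fT fD finite_subset[OF conn_structs_subset])
  also have "\<dots> = (\<Sum>q\<le>r. (\<Sum>X\<in>conn_structs T q. struct_weight v w T X) * (\<Sum>X\<in>mono_structs ?D (r - q). struct_weight v w ?D X))"
    by (simp add: sum_product sum.cartesian_product)
  finally show ?thesis .
qed

text \<open>Structures are grouped by the component of \<open>x\<close>. The length splits as q + (r
  - q), so that the generating functions will multiply.\<close>

lemma sum_struct_weight_decompose:
  assumes "finite S" "x \<in> S"
  shows "(\<Sum>X\<in>mono_structs S r. struct_weight v w S X) =
    (\<Sum>T | T \<subseteq> S \<and> x \<in> T. \<Sum>q\<le>r. (\<Sum>X\<in>conn_structs T q. struct_weight v w T X) *
       (\<Sum>X\<in>mono_structs (S - T) (r - q). struct_weight v w (S - T) X))"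
proof -
  have "(\<Sum>X\<in>mono_structs S r. struct_weight v w S X) =
    (\<Sum>T | T \<subseteq> S \<and> x \<in> T. \<Sum>X | X \<in> mono_structs S r \<and> component S x X = T. struct_weight v w S X)"
  proof (rule sum.group[symmetric])
    show "component S x ` mono_structs S r \<subseteq> {T. T \<subseteq> S \<and> x \<in> T}"
    proof (rule image_subsetI)
      fix X assume "X \<in> mono_structs S r"
      then show "component S x X \<in> {T. T \<subseteq> S \<and> x \<in> T}"
        using component_props(1,2)[OF _ assms(2), of "fst X" "snd X" r] by simp
    qed
  qed (use assms finite_mono_structs in auto)
  also have "\<dots> = (\<Sum>T | T \<subseteq> S \<and> x \<in> T. \<Sum>q\<le>r. (\<Sum>X\<in>conn_structs T q. struct_weight v w T X) *
       (\<Sum>X\<in>mono_structs (S - T) (r - q). struct_weight v w (S - T) X))"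
    by (intro sum.cong refl sum_struct_weight_fiber) (use assms in auto)
  finally show ?thesis .
qed

section \<open>Haar integration on the unitary group\<close>

lemma mat_mult_entry:
  assumes "A \<in> carrier_mat n m" "B \<in> carrier_mat m k" "i < n" "j < k"
  shows "(A * B) $$ (i, j) = (\<Sum>l<m. A $$ (i, l) * B $$ (l, j))"
  using assms by (auto simp: scalar_prod_def atLeast0LessThan intro!: sum.cong)

lemma mat_adjoint_carrier: "A \<in> carrier_mat n m \<Longrightarrow> mat_adjoint A \<in> carrier_mat m n"
  by (auto simp: mat_adjoint_def)

lemma mat_adjoint_entry:
  fixes A :: "complex mat"
  assumes "A \<in> carrier_mat n m" "i < m" "j < n"
  shows "mat_adjoint A $$ (i, j) = cnj (A $$ (j, i))"
  using assms by (auto simp: mat_adjoint_def mat_of_rows_index conjugate_complex_def)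

lemma mat_trace_mult_commute:
  assumes "A \<in> carrier_mat n n" "B \<in> carrier_mat n n"
  shows "mat_trace (A * B) = mat_trace (B * A)"
proof -
  have "mat_trace (A * B) = (\<Sum>i<n. \<Sum>l<n. A $$ (i, l) * B $$ (l, i))"
    using assms by (auto simp: mat_trace_def mat_mult_entry[OF assms] simp del: index_mult_mat(1) intro!: sum.cong)
  also have "\<dots> = (\<Sum>l<n. \<Sum>i<n. B $$ (l, i) * A $$ (i, l))"
    by (subst sum.swap) (simp add: mult.commute)
  also have "\<dots> = mat_trace (B * A)"
    using assms by (auto simp: mat_trace_def mat_mult_entry[OF assms(2,1)] simp del: index_mult_mat(1) intro!: sum.cong)
  finally show ?thesis .
qed

lemma pow_mat_add:
  assumes "A \<in> carrier_mat n n"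
  shows "A ^\<^sub>m a * A ^\<^sub>m b = A ^\<^sub>m (a + b)"
proof (induction b)
  case 0
  then show ?case using assms by simp
next
  case (Suc b)
  have "A ^\<^sub>m a * A ^\<^sub>m Suc b = (A ^\<^sub>m a * A ^\<^sub>m b) * A"
    using assms by (simp add: assoc_mult_mat[of _ n n _ n _ n])
  then show ?case using Suc by simp
qed

section \<open>Comparison of linear coefficients\<close>

lemma sum_over_singletons:
  fixes e :: "'a set \<Rightarrow> complex"
  assumes "finite S"
  shows "(\<Sum>L\<in>Pow S. if card L = 1 then e L else 0) = (\<Sum>l\<in>S. e {l})"
proof -
  have "(\<Sum>L\<in>Pow S. if card L = 1 then e L else 0) = (\<Sum>L | L \<in> Pow S \<and> card L = 1. e L)"
    using assms by (subst sum.inter_filter) auto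
  also have "{L. L \<in> Pow S \<and> card L = 1} = (\<lambda>l. {l}) ` S" by (auto simp: card_1_singleton_iff)
  also have "(\<Sum>L\<in>(\<lambda>l. {l}) ` S. e L) = (\<Sum>l\<in>S. e {l})" by (subst sum.reindex) auto
  finally show ?thesis .
qed

text \<open>Both sides are polynomials in \<open>c\<close> agreeing at infinitely many points, and
  only singletons contribute to the coefficient of c^1.\<close>

lemma linear_coeff_eq:
  fixes e e' :: "'a set \<Rightarrow> complex"
  assumes "finite S" "infinite C"
    "\<And>c. c \<in> C \<Longrightarrow> (\<Sum>L\<in>Pow S. c ^ card L * e L) = (\<Sum>L\<in>Pow S. c ^ card L * e' L)"
  shows "(\<Sum>l\<in>S. e {l}) = (\<Sum>l\<in>S. e' {l})"
proof -
  define P where "P = (\<Sum>L\<in>Pow S. monom (e L - e' L) (card L))"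
  have "poly P c = 0" if "c \<in> C" for c
    using assms(3)[OF that] by (simp add: P_def poly_sum poly_monom algebra_simps sum_subtractf)
  then have "C \<subseteq> {c. poly P c = 0}" by auto
  then have "P = 0" using poly_roots_finite[of P] assms(2) finite_subset by auto
  then have "coeff P 1 = 0" by simp
  also have "coeff P 1 = (\<Sum>L\<in>Pow S. if card L = 1 then e L - e' L else 0)"
    by (simp add: P_def coeff_sum)
  also have "\<dots> = (\<Sum>l\<in>S. e {l} - e' {l})" using sum_over_singletons[OF assms(1), of "\<lambda>L. e L - e' L"] .
  finally show ?thesis by (simp add: sum_subtractf)
qed

lemma infinite_shifted_circle: "infinite {c. cmod (1 + c) = 1}"
proof
  assume fin: "finite {c. cmod (1 + c) = 1}"
  \<comment> \<open>For this \<open>c\<close> the number 1 + c has real part \<open>r\<close> and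
    modulus 1: the points form a quarter of the unit circle shifted by -1.\<close>
  let ?f = "\<lambda>r::real. Complex (r - 1) (sqrt (1 - r\<^sup>2))"
  have "?f ` {0..1} \<subseteq> {c. cmod (1 + c) = 1}"
    by (auto simp: cmod_def power_le_one abs_square_le_1)
  then have "finite (?f ` {0..1})" using fin finite_subset by auto
  moreover have "inj_on ?f {0..1}" by (auto simp: inj_on_def)
  ultimately have "finite {0..1::real}" by (rule finite_imageD)
  then show False by (simp add: infinite_Icc)
qed

section \<open>Bounded measurable functions and invariance of the Haar integral\<close>

locale unitary_haar =
  fixes N :: nat and \<kappa> :: "complex mat measure"
  assumes haar: "is_unitary_haar N \<kappa>"
begin

sublocale prob_space \<kappa>
  using haar by (simp add: is_unitary_haar_def)

lemma space_eq: "space \<kappa> = unitary_group N"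
  using haar by (simp add: is_unitary_haar_def)

lemma unitaryD:
  assumes "U \<in> unitary_group N"
  shows "U \<in> carrier_mat N N" "mat_adjoint U \<in> carrier_mat N N"
    "U * mat_adjoint U = 1\<^sub>m N" "mat_adjoint U * U = 1\<^sub>m N"
  using assms mat_adjoint_carrier by (auto simp: unitary_group_def)

lemma mult_N [simp]: "A \<in> carrier_mat N N \<Longrightarrow> B \<in> carrier_mat N N \<Longrightarrow> A * B \<in> carrier_mat N N"
  by (rule mult_carrier_mat)

lemma assoc_N: "A \<in> carrier_mat N N \<Longrightarrow> B \<in> carrier_mat N N \<Longrightarrow> C \<in> carrier_mat N N \<Longrightarrow> (A * B) * C = A * (B * C)"
  by (rule assoc_mult_mat)

lemma unitary_cancel:
  assumes "U \<in> unitary_group N" "C \<in> carrier_mat N N"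
  shows "mat_adjoint U * (U * C) = C" "U * (mat_adjoint U * C) = C"
  using unitaryD[OF assms(1)] assms(2) assoc_N[of "mat_adjoint U" U C] assoc_N[of U "mat_adjoint U" C] by auto

lemma adjoint_mult:
  assumes "A \<in> carrier_mat N N" "B \<in> carrier_mat N N"
  shows "mat_adjoint (A * B) = mat_adjoint B * mat_adjoint (A :: complex mat)"
proof (rule eq_matI)
  note c = mat_adjoint_carrier[OF assms(1)] mat_adjoint_carrier[OF assms(2)] mat_adjoint_carrier[OF mult_N[OF assms]]
  fix i j assume "i < dim_row (mat_adjoint B * mat_adjoint A)" "j < dim_col (mat_adjoint B * mat_adjoint A)"
  then have ij: "i < N" "j < N" using c by auto
  show "mat_adjoint (A * B) $$ (i, j) = (mat_adjoint B * mat_adjoint A) $$ (i, j)"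
    using ij by (simp add: mat_adjoint_entry[OF mult_N[OF assms] ij] mat_mult_entry[OF assms]
        mat_mult_entry[OF c(2,1)] mat_adjoint_entry[OF assms(1)] mat_adjoint_entry[OF assms(2)] mult.commute)
qed (use assms mat_adjoint_carrier[OF assms(1)] mat_adjoint_carrier[OF assms(2)] mat_adjoint_carrier[OF mult_N[OF assms]] in auto)

lemma unitary_mult:
  assumes "V \<in> unitary_group N" "U \<in> unitary_group N"
  shows "V * U \<in> unitary_group N"
proof -
  note v = unitaryD[OF assms(1)] and u = unitaryD[OF assms(2)]
  have "(V * U) * (mat_adjoint U * mat_adjoint V) = V * (U * (mat_adjoint U * mat_adjoint V))"
    using u v by (intro assoc_N) auto
  also have "\<dots> = 1\<^sub>m N" using u v unitary_cancel(2)[OF assms(2) v(2)] by simp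
  finally have 1: "(V * U) * (mat_adjoint U * mat_adjoint V) = 1\<^sub>m N" .
  have "(mat_adjoint U * mat_adjoint V) * (V * U) = mat_adjoint U * (mat_adjoint V * (V * U))"
    using u v by (intro assoc_N) auto
  also have "\<dots> = 1\<^sub>m N" using u v unitary_cancel(1)[OF assms(1) u(1)] by simp
  finally have 2: "(mat_adjoint U * mat_adjoint V) * (V * U) = 1\<^sub>m N" .
  show ?thesis using 1 2 u v by (simp add: unitary_group_def adjoint_mult)
qed

lemma measurable_entry:
  assumes "i < N" "j < N" shows "(\<lambda>U. U $$ (i, j)) \<in> borel_measurable \<kappa>"
proof -
  let ?f = "\<lambda>U. \<lambda>ij \<in> {..<N} \<times> {..<N}. U $$ ij :: complex"
  let ?P = "Pi\<^sub>M ({..<N} \<times> {..<N}) (\<lambda>_. borel :: complex measure)"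
  have "?f \<in> measurable (vimage_algebra (unitary_group N) ?f ?P) ?P"
    by (rule measurable_vimage_algebra1) (auto simp: space_PiM)
  then have m: "?f \<in> measurable \<kappa> ?P"
    using haar by (subst measurable_cong_sets[of \<kappa> "unitary_borel N"]) (auto simp: is_unitary_haar_def unitary_borel_def)
  have "(\<lambda>\<omega>. \<omega> (i, j)) \<in> measurable ?P borel" by (rule measurable_component_singleton) (use assms in auto)
  from measurable_compose[OF m this] show ?thesis using assms by simp
qed

text \<open>This class is closed under sums, products and conjugation and consists of integrable
  functions, so integrability of any polynomial in the entries and their conjugates follows from its
  shape.\<close>

definition bdd_measurable :: "(complex mat \<Rightarrow> complex) \<Rightarrow> bool" where
  "bdd_measurable f \<longleftrightarrow> f \<in> borel_measurable \<kappa> \<and> (\<exists>C. \<forall>U\<in>space \<kappa>. cmod (f U) \<le> C)"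

lemma bdd_measurable_const [intro, simp]: "bdd_measurable (\<lambda>_. c)"
  by (auto simp: bdd_measurable_def)

lemma bdd_measurable_add [intro]: "bdd_measurable f \<Longrightarrow> bdd_measurable g \<Longrightarrow> bdd_measurable (\<lambda>U. f U + g U)"
  unfolding bdd_measurable_def
proof (elim conjE exE, intro conjI)
  fix C D assume "\<forall>U\<in>space \<kappa>. cmod (f U) \<le> C" "\<forall>U\<in>space \<kappa>. cmod (g U) \<le> D"
  then have "\<forall>U\<in>space \<kappa>. cmod (f U + g U) \<le> C + D" by (meson add_mono norm_triangle_ineq order_trans)
  then show "\<exists>C. \<forall>U\<in>space \<kappa>. cmod (f U + g U) \<le> C" ..
qed auto

lemma bdd_measurable_mult [intro]: "bdd_measurable f \<Longrightarrow> bdd_measurable g \<Longrightarrow> bdd_measurable (\<lambda>U. f U * g U)"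
  unfolding bdd_measurable_def
proof (elim conjE exE, intro conjI)
  fix C D assume b: "\<forall>U\<in>space \<kappa>. cmod (f U) \<le> C" "\<forall>U\<in>space \<kappa>. cmod (g U) \<le> D"
  have "cmod (f U * g U) \<le> C * D" if "U \<in> space \<kappa>" for U
    unfolding norm_mult using b that by (intro mult_mono) (auto intro: order_trans[OF norm_ge_zero])
  then show "\<exists>C. \<forall>U\<in>space \<kappa>. cmod (f U * g U) \<le> C" by auto
qed auto

lemma bdd_measurable_cnj: "bdd_measurable f \<Longrightarrow> bdd_measurable (\<lambda>U. cnj (f U))"
  unfolding bdd_measurable_def
  by (auto intro!: measurable_compose[OF _ borel_measurable_continuous_onI[of cnj]] continuous_intros)

lemma bdd_measurable_sum: "(\<And>x. x \<in> X \<Longrightarrow> bdd_measurable (f x)) \<Longrightarrow> bdd_measurable (\<lambda>U. \<Sum>x\<in>X. f x U)"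
  by (induction X rule: infinite_finite_induct) auto

lemma bdd_measurable_prod: "(\<And>x. x \<in> X \<Longrightarrow> bdd_measurable (f x)) \<Longrightarrow> bdd_measurable (\<lambda>U. \<Prod>x\<in>X. f x U)"
  by (induction X rule: infinite_finite_induct) auto

lemma bdd_measurable_cong: "bdd_measurable f \<Longrightarrow> (\<And>U. U \<in> unitary_group N \<Longrightarrow> f U = g U) \<Longrightarrow> bdd_measurable g"
  using measurable_cong[of \<kappa> f g borel] by (auto simp: bdd_measurable_def space_eq)

lemma bdd_measurable_integrable: "bdd_measurable f \<Longrightarrow> integrable \<kappa> f"
  unfolding bdd_measurable_def by (elim conjE exE) (rule integrable_const_bound, auto)

text \<open>The rows of a unitary matrix have l2 norm 1.\<close>

lemma bdd_measurable_entry: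
  assumes "i < N" "j < N" shows "bdd_measurable (\<lambda>U. U $$ (i, j))"
proof -
  have "cmod (U $$ (i, j)) \<le> 1" if U: "U \<in> space \<kappa>" for U
  proof -
    note u = unitaryD[OF U[unfolded space_eq]]
    have "1 = (U * mat_adjoint U) $$ (i, i)" using u(3) assms by simp
    also have "\<dots> = (\<Sum>l<N. U $$ (i, l) * cnj (U $$ (i, l)))"
      using assms by (simp add: mat_mult_entry[OF u(1,2)] mat_adjoint_entry[OF u(1)])
    also have "\<dots> = of_real (\<Sum>l<N. (cmod (U $$ (i, l)))\<^sup>2)" by (simp add: complex_norm_square del: of_real_power)
    finally have "(\<Sum>l<N. (cmod (U $$ (i, l)))\<^sup>2) = 1" by (metis of_real_eq_1_iff)
    moreover have "(cmod (U $$ (i, j)))\<^sup>2 \<le> (\<Sum>l<N. (cmod (U $$ (i, l)))\<^sup>2)"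
      using assms by (intro member_le_sum) auto
    ultimately show ?thesis by (simp add: power_le_one_iff abs_square_le_1)
  qed
  then show ?thesis using measurable_entry[OF assms] by (auto simp: bdd_measurable_def)
qed

text \<open>Integrals against \<open>distr\<close> are transported along measurable maps only.
  Multiplication by \<open>V\<close> is measurable because the entries of the product are linear in
  those of \<open>U\<close>.\<close>

lemma integral_left_invariant:
  assumes "V \<in> unitary_group N" "bdd_measurable f"
  shows "(\<integral>U. f (V * U) \<partial>\<kappa>) = (\<integral>U. f U \<partial>\<kappa>)"
proof -
  let ?f = "\<lambda>U. \<lambda>ij \<in> {..<N} \<times> {..<N}. U $$ ij :: complex"
  let ?P = "Pi\<^sub>M ({..<N} \<times> {..<N}) (\<lambda>_. borel :: complex measure)"
  have "(\<lambda>U. V * U) \<in> measurable \<kappa> (vimage_algebra (unitary_group N) ?f ?P)"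
  proof (rule measurable_vimage_algebra2)
    show "(*) V \<in> space \<kappa> \<rightarrow> unitary_group N" using unitary_mult[OF assms(1)] by (auto simp: space_eq)
    show "(\<lambda>U. ?f (V * U)) \<in> measurable \<kappa> ?P"
    proof (rule measurable_restrict)
      fix ij assume ij: "ij \<in> {..<N} \<times> {..<N}"
      obtain i j where e: "ij = (i, j)" "i < N" "j < N" using ij by auto
      have "bdd_measurable (\<lambda>U. \<Sum>l<N. V $$ (i, l) * U $$ (l, j))"
        using e by (intro bdd_measurable_sum bdd_measurable_mult bdd_measurable_const bdd_measurable_entry) auto
      then have "bdd_measurable (\<lambda>U. (V * U) $$ (i, j))"
        by (rule bdd_measurable_cong) (simp add: mat_mult_entry[OF unitaryD(1)[OF assms(1)] unitaryD(1) e(2,3)])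
      then show "(\<lambda>U. (V * U) $$ ij) \<in> borel_measurable \<kappa>" by (simp add: e bdd_measurable_def)
    qed
  qed
  then have m: "(\<lambda>U. V * U) \<in> measurable \<kappa> \<kappa>"
    using haar by (subst measurable_cong_sets[of \<kappa> \<kappa> \<kappa> "unitary_borel N"]) (auto simp: is_unitary_haar_def unitary_borel_def)
  have "(\<integral>U. f U \<partial>\<kappa>) = (\<integral>U. f U \<partial>(distr \<kappa> \<kappa> (\<lambda>U. V * U)))"
    using haar assms(1) by (simp add: is_unitary_haar_def)
  also have "\<dots> = (\<integral>U. f (V * U) \<partial>\<kappa>)"
    by (rule integral_distr[OF m]) (use assms in \<open>simp add: bdd_measurable_def\<close>)
  finally show ?thesis by simp
qed

text \<open>For unitary \<open>U\<close> this is the a-th power of \<open>conj_pow B 1 U\<close>.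
  With the power taken of \<open>B\<close>, exponents add and a = 0 gives the identity.\<close>

definition conj_pow :: "complex mat \<Rightarrow> nat \<Rightarrow> complex mat \<Rightarrow> complex mat" where
  "conj_pow B a U = U * B ^\<^sub>m a * mat_adjoint U"

end

locale unitary_haar_conj = unitary_haar +
  fixes B :: "complex mat"
  assumes B: "B \<in> carrier_mat N N"
begin

abbreviation X :: "nat \<Rightarrow> complex mat \<Rightarrow> complex mat" where "X \<equiv> conj_pow B"

lemma Bpow: "B ^\<^sub>m a \<in> carrier_mat N N"
  using B by simp

lemma X_carrier: "U \<in> unitary_group N \<Longrightarrow> X a U \<in> carrier_mat N N"
  using unitaryD Bpow by (simp add: conj_pow_def)

lemma X_mult:
  assumes "U \<in> unitary_group N" shows "X a U * X b U = X (a + b) U"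
proof -
  note u = unitaryD[OF assms]
  have "X a U * X b U = U * (B ^\<^sub>m a * (mat_adjoint U * (U * (B ^\<^sub>m b * mat_adjoint U))))"
    using u Bpow by (simp add: conj_pow_def assoc_N)
  also have "\<dots> = U * (B ^\<^sub>m a * (B ^\<^sub>m b * mat_adjoint U))"
    using u Bpow by (subst unitary_cancel(1)[OF assms]) auto
  also have "\<dots> = U * ((B ^\<^sub>m a * B ^\<^sub>m b) * mat_adjoint U)"
    using u Bpow by (simp only: assoc_N)
  also have "\<dots> = X (a + b) U" using u Bpow by (simp add: conj_pow_def pow_mat_add[OF B] assoc_N)
  finally show ?thesis .
qed

lemma X_mult_entry:
  assumes "U \<in> unitary_group N" "i < N" "j < N"
  shows "(\<Sum>p<N. X a U $$ (i, p) * X b U $$ (p, j)) = X (a + b) U $$ (i, j)"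
  using X_mult[OF assms(1), of a b] mat_mult_entry[OF X_carrier[OF assms(1)] X_carrier[OF assms(1)] assms(2,3), of a b]
  by simp

lemma X_0_entry:
  assumes "U \<in> unitary_group N" "i < N" "j < N"
  shows "X 0 U $$ (i, j) = (if i = j then 1 else 0)"
proof -
  have "B ^\<^sub>m 0 = 1\<^sub>m N" using B by simp
  then have "X 0 U = 1\<^sub>m N" using unitaryD[OF assms(1)] by (simp add: conj_pow_def)
  then show ?thesis using assms by simp
qed

lemma X_trace:
  assumes "U \<in> unitary_group N"
  shows "(\<Sum>p<N. X a U $$ (p, p)) = mat_trace (B ^\<^sub>m a)"
proof -
  note u = unitaryD[OF assms]
  have "(\<Sum>p<N. X a U $$ (p, p)) = mat_trace (X a U)" using X_carrier[OF assms, of a] by (auto simp: mat_trace_def)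
  also have "\<dots> = mat_trace (mat_adjoint U * (U * B ^\<^sub>m a))"
    unfolding conj_pow_def by (rule mat_trace_mult_commute) (use u Bpow in auto)
  also have "\<dots> = mat_trace (B ^\<^sub>m a)" using unitary_cancel(1)[OF assms Bpow] by simp
  finally show ?thesis .
qed

lemma bdd_measurable_X:
  assumes "i < N" "j < N" shows "bdd_measurable (\<lambda>U. X a U $$ (i, j))"
proof -
  have "bdd_measurable (\<lambda>U. \<Sum>q<N. (\<Sum>p<N. U $$ (i, p) * (B ^\<^sub>m a) $$ (p, q)) * cnj (U $$ (j, q)))"
    using assms by (intro bdd_measurable_sum bdd_measurable_mult bdd_measurable_const bdd_measurable_entry bdd_measurable_cnj) auto
  then show ?thesis
  proof (rule bdd_measurable_cong)
    fix U assume U: "U \<in> unitary_group N"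
    note u = unitaryD[OF U]
    show "(\<Sum>q<N. (\<Sum>p<N. U $$ (i, p) * (B ^\<^sub>m a) $$ (p, q)) * cnj (U $$ (j, q))) = X a U $$ (i, j)"
      unfolding conj_pow_def
      by (subst mat_mult_entry[OF mult_N[OF u(1) Bpow] u(2) assms])
         (auto simp: mat_mult_entry[OF u(1) Bpow assms(1)] mat_adjoint_entry[OF u(1) _ assms(2)] simp del: index_mult_mat intro!: sum.cong)
  qed
qed

text \<open>Conjugation by \<open>V\<close> with the adjoint of \<open>V\<close> multiplied away.
  After substituting \<open>U\<close> for \<open>V * U\<close> under the integral, each factor is
  linear in \<open>V\<close>, so for V = 1 + c K only \<open>c\<close> occurs and not its
  conjugate.\<close>

lemma X_left_mult:
  assumes "V \<in> unitary_group N" "U \<in> unitary_group N"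
  shows "X a (V * U) * V = V * X a U"
proof -
  note u = unitaryD[OF assms(2)] and v = unitaryD[OF assms(1)]
  have "X a (V * U) * V = V * (U * (B ^\<^sub>m a * (mat_adjoint U * (mat_adjoint V * V))))"
    using u v Bpow by (simp add: conj_pow_def adjoint_mult assoc_N)
  also have "\<dots> = V * X a U" using u v Bpow by (simp add: conj_pow_def assoc_N)
  finally show ?thesis .
qed

definition tensor_moment :: "nat set \<Rightarrow> (nat \<Rightarrow> nat) \<Rightarrow> (nat \<Rightarrow> nat) \<Rightarrow> (nat \<Rightarrow> nat) \<Rightarrow> complex" where
  "tensor_moment S a i j = (\<integral>U. (\<Prod>l\<in>S. X (a l) U $$ (i l, j l)) \<partial>\<kappa>)"

lemma tensor_commute:
  assumes "V \<in> unitary_group N" "i \<in> S \<rightarrow> {..<N}" "j \<in> S \<rightarrow> {..<N}"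
  shows "(\<integral>U. (\<Prod>l\<in>S. (V * X (a l) U) $$ (i l, j l)) \<partial>\<kappa>) = (\<integral>U. (\<Prod>l\<in>S. (X (a l) U * V) $$ (i l, j l)) \<partial>\<kappa>)"
proof -
  have v: "V \<in> carrier_mat N N" by (rule unitaryD[OF assms(1)])
  have "bdd_measurable (\<lambda>U. \<Prod>l\<in>S. \<Sum>p<N. X (a l) U $$ (i l, p) * V $$ (p, j l))"
    using assms by (intro bdd_measurable_prod bdd_measurable_sum bdd_measurable_mult bdd_measurable_X bdd_measurable_const) auto
  then have b: "bdd_measurable (\<lambda>U. \<Prod>l\<in>S. (X (a l) U * V) $$ (i l, j l))"
    by (rule bdd_measurable_cong) (use assms in \<open>auto intro!: prod.cong simp: mat_mult_entry[OF X_carrier v] Pi_iff simp del: index_mult_mat(1)\<close>)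
  have "(\<integral>U. (\<Prod>l\<in>S. (V * X (a l) U) $$ (i l, j l)) \<partial>\<kappa>) = (\<integral>U. (\<Prod>l\<in>S. (X (a l) (V * U) * V) $$ (i l, j l)) \<partial>\<kappa>)"
    by (rule Bochner_Integration.integral_cong[OF refl]) (simp only: X_left_mult[OF assms(1)] space_eq)
  also have "\<dots> = (\<integral>U. (\<Prod>l\<in>S. (X (a l) U * V) $$ (i l, j l)) \<partial>\<kappa>)"
    by (rule integral_left_invariant[OF assms(1) b])
  finally show ?thesis .
qed

end

section \<open>The loop equation for tensor moments\<close>

context unitary_haar_conj
begin

lemma bdd_measurable_prod_X: "i \<in> S \<rightarrow> {..<N} \<Longrightarrow> j \<in> S \<rightarrow> {..<N} \<Longrightarrow> bdd_measurable (\<lambda>U. \<Prod>l\<in>S. X (a l) U $$ (i l, j l))"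
  by (intro bdd_measurable_prod bdd_measurable_X) auto

text \<open>For the projection \<open>K = x x\<^sup>*\<close> the matrix \<open>1 + c K\<close> is unitary whenever \<open>|1 + c| = 1\<close>. Invariance is
  a polynomial identity in \<open>c\<close> with infinitely many solutions, and its linear coefficient is the claim.
  This avoids differentiating under the integral.\<close>

lemma infinitesimal_commute_rank_one:
  assumes S: "finite S" "i \<in> S \<rightarrow> {..<N}" "j \<in> S \<rightarrow> {..<N}"
    and x: "(\<Sum>m<N. x m * cnj (x m)) = 1"
  shows "(\<Sum>l\<in>S. \<Sum>u<N. x (i l) * cnj (x u) * tensor_moment S a (i(l := u)) j) =
    (\<Sum>l\<in>S. \<Sum>u<N. x u * cnj (x (j l)) * tensor_moment S a i (j(l := u)))"
proof -
  define k where "k = (\<lambda>u v. x u * cnj (x v))"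
  have kk: "(\<Sum>m<N. k u m * k m v) = k u v" for u v
  proof -
    have "(\<Sum>m<N. k u m * k m v) = x u * cnj (x v) * (\<Sum>m<N. x m * cnj (x m))"
      by (simp add: k_def sum_distrib_left mult_ac)
    then show ?thesis by (simp add: x k_def)
  qed
  have kc: "cnj (k u v) = k v u" for u v by (simp add: k_def)
  define V where "V = (\<lambda>c. mat N N (\<lambda>(p, q). (if p = q then 1 else 0) + c * k p q))"
  have Vc: "V c \<in> carrier_mat N N" for c by (simp add: V_def)
  have Ve: "V c $$ (p, q) = (if p = q then 1 else 0) + c * k p q" if "p < N" "q < N" for c p q
    using that by (simp add: V_def)
  have VU: "V c \<in> unitary_group N" if c: "cmod (1 + c) = 1" for c
  proof -
    \<comment> \<open>This is |1 + c| = 1 written out. As K is a projection, the left side is the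
      coefficient of K in \<open>V c\<close> times its adjoint.\<close>
    have cc: "c + cnj c + c * cnj c = 0"
    proof -
      have "(1 + c) * cnj (1 + c) = 1" using c by (simp add: complex_norm_square[symmetric] del: complex_cnj_add)
      then show ?thesis by (simp add: algebra_simps)
    qed
    have "V c * mat_adjoint (V c) = 1\<^sub>m N"
    proof (rule eq_matI)
      fix p q assume "p < dim_row (1\<^sub>m N :: complex mat)" "q < dim_col (1\<^sub>m N :: complex mat)"
      then have pq: "p < N" "q < N" by auto
      have "(V c * mat_adjoint (V c)) $$ (p, q) = (\<Sum>m<N. V c $$ (p, m) * cnj (V c $$ (q, m)))"
        using pq by (simp add: mat_mult_entry[OF Vc mat_adjoint_carrier[OF Vc]] mat_adjoint_entry[OF Vc] del: index_mult_mat(1))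
      also have "\<dots> = (\<Sum>m<N. ((if p = m then 1 else 0) + c * k p m) * ((if q = m then 1 else 0) + cnj c * k m q))"
        using pq by (intro sum.cong refl) (simp add: Ve kc)
      also have "\<dots> = (\<Sum>m<N. (if p = m then (if q = m then 1 else 0) else 0) + (if p = m then cnj c * k m q else 0) +
           (if q = m then c * k p m else 0) + c * cnj c * (k p m * k m q))"
        by (intro sum.cong refl) (simp add: algebra_simps)
      also have "\<dots> = (if p = q then 1 else 0) + (cnj c * k p q + c * k p q + c * cnj c * k p q)"
        using pq by (simp add: sum.distrib kk sum_distrib_left[symmetric])
      also have "cnj c * k p q + c * k p q + c * cnj c * k p q = (c + cnj c + c * cnj c) * k p q" by (simp add: algebra_simps)
      finally show "(V c * mat_adjoint (V c)) $$ (p, q) = 1\<^sub>m N $$ (p, q)" using pq cc by simp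
    qed (use Vc mat_adjoint_carrier[OF Vc] in auto)
    then show ?thesis
      using Vc mat_mult_left_right_inverse[OF Vc mat_adjoint_carrier[OF Vc]] by (simp add: unitary_group_def)
  qed
  \<comment> \<open>With K the projection, \<open>y\<close> and \<open>z\<close> are the entries of
    K X and X K, and \<open>w\<close> is that of X. In the expansion over slots, \<open>e L\<close>
    and \<open>e' L\<close> collect the terms with K in the slots \<open>L\<close>.\<close>
  define y where "y = (\<lambda>l U. \<Sum>u<N. k (i l) u * X (a l) U $$ (u, j l))"
  define z where "z = (\<lambda>l U. \<Sum>u<N. X (a l) U $$ (i l, u) * k u (j l))"
  define w where "w = (\<lambda>l U. X (a l) U $$ (i l, j l))"
  define e where "e = (\<lambda>L. \<integral>U. (\<Prod>l\<in>L. y l U) * (\<Prod>l\<in>S - L. w l U) \<partial>\<kappa>)"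
  define e' where "e' = (\<lambda>L. \<integral>U. (\<Prod>l\<in>L. z l U) * (\<Prod>l\<in>S - L. w l U) \<partial>\<kappa>)"
  have il: "i l < N" "j l < N" if "l \<in> S" for l using S that by auto
  have bw: "bdd_measurable (w l)" if "l \<in> S" for l unfolding w_def using il[OF that] by (rule bdd_measurable_X)
  have by': "bdd_measurable (y l)" if "l \<in> S" for l unfolding y_def using il[OF that] by (intro bdd_measurable_sum bdd_measurable_mult bdd_measurable_const bdd_measurable_X) auto
  have bz: "bdd_measurable (z l)" if "l \<in> S" for l unfolding z_def using il[OF that] by (intro bdd_measurable_sum bdd_measurable_mult bdd_measurable_const bdd_measurable_X) auto
  have expand: "(\<integral>U. (\<Prod>l\<in>S. w l U + c * h l U) \<partial>\<kappa>) =
      (\<Sum>L\<in>Pow S. c ^ card L * (\<integral>U. (\<Prod>l\<in>L. h l U) * (\<Prod>l\<in>S - L. w l U) \<partial>\<kappa>))"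
    if "\<And>l. l \<in> S \<Longrightarrow> bdd_measurable (h l)" for h c
  proof -
    have b: "bdd_measurable (\<lambda>U. (\<Prod>l\<in>L. h l U) * (\<Prod>l\<in>S - L. w l U))" if "L \<in> Pow S" for L
      using that bw \<open>\<And>l. l \<in> S \<Longrightarrow> bdd_measurable (h l)\<close> by (intro bdd_measurable_mult bdd_measurable_prod) auto
    have "(\<integral>U. (\<Prod>l\<in>S. w l U + c * h l U) \<partial>\<kappa>) =
      (\<integral>U. (\<Sum>L\<in>Pow S. c ^ card L * ((\<Prod>l\<in>L. h l U) * (\<Prod>l\<in>S - L. w l U))) \<partial>\<kappa>)"
    proof (rule Bochner_Integration.integral_cong[OF refl])
      fix U
      have "(\<Prod>l\<in>S. w l U + c * h l U) = (\<Prod>l\<in>S. c * h l U + w l U)" by (simp add: add.commute)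
      also have "\<dots> = (\<Sum>L\<in>Pow S. (\<Prod>l\<in>L. c * h l U) * (\<Prod>l\<in>S - L. w l U))" by (rule prod_add[OF S(1)])
      finally show "(\<Prod>l\<in>S. w l U + c * h l U) = (\<Sum>L\<in>Pow S. c ^ card L * ((\<Prod>l\<in>L. h l U) * (\<Prod>l\<in>S - L. w l U)))"
        by (simp add: prod.distrib mult.assoc)
    qed
    also have "\<dots> = (\<Sum>L\<in>Pow S. \<integral>U. c ^ card L * ((\<Prod>l\<in>L. h l U) * (\<Prod>l\<in>S - L. w l U)) \<partial>\<kappa>)"
      by (rule Bochner_Integration.integral_sum) (use b in \<open>auto intro!: bdd_measurable_integrable bdd_measurable_mult[OF bdd_measurable_const]\<close>)
    finally show ?thesis by simp
  qed
  have "(\<Sum>L\<in>Pow S. c ^ card L * e L) = (\<Sum>L\<in>Pow S. c ^ card L * e' L)" if c: "cmod (1 + c) = 1" for c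
  proof -
    have 1: "(V c * X (a l) U) $$ (i l, j l) = w l U + c * y l U" if "l \<in> S" "U \<in> unitary_group N" for l U
    proof -
      have "(V c * X (a l) U) $$ (i l, j l) = (\<Sum>u<N. (if i l = u then X (a l) U $$ (u, j l) else 0) + c * (k (i l) u * X (a l) U $$ (u, j l)))"
        unfolding mat_mult_entry[OF Vc X_carrier[OF that(2)] il[OF that(1)]]
        by (rule sum.cong[OF refl]) (use il[OF that(1)] in \<open>simp add: Ve algebra_simps\<close>)
      also have "\<dots> = w l U + c * y l U" using il[OF that(1)] by (simp add: sum.distrib w_def y_def sum_distrib_left)
      finally show ?thesis .
    qed
    have 2: "(X (a l) U * V c) $$ (i l, j l) = w l U + c * z l U" if "l \<in> S" "U \<in> unitary_group N" for l U
    proof -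
      have "(X (a l) U * V c) $$ (i l, j l) = (\<Sum>u<N. (if u = j l then X (a l) U $$ (i l, u) else 0) + c * (X (a l) U $$ (i l, u) * k u (j l)))"
        unfolding mat_mult_entry[OF X_carrier[OF that(2)] Vc il[OF that(1)]]
        by (rule sum.cong[OF refl]) (use il[OF that(1)] in \<open>simp add: Ve algebra_simps\<close>)
      also have "\<dots> = w l U + c * z l U" using il[OF that(1)] by (simp add: sum.distrib w_def z_def sum_distrib_left)
      finally show ?thesis .
    qed
    have "(\<Sum>L\<in>Pow S. c ^ card L * e L) = (\<integral>U. (\<Prod>l\<in>S. w l U + c * y l U) \<partial>\<kappa>)"
      unfolding e_def by (rule expand[symmetric]) (rule by')
    also have "\<dots> = (\<integral>U. (\<Prod>l\<in>S. (V c * X (a l) U) $$ (i l, j l)) \<partial>\<kappa>)"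
      by (rule Bochner_Integration.integral_cong[OF refl]) (simp add: 1 space_eq cong: prod.cong del: index_mult_mat(1))
    also have "\<dots> = (\<integral>U. (\<Prod>l\<in>S. (X (a l) U * V c) $$ (i l, j l)) \<partial>\<kappa>)"
      by (rule tensor_commute[OF VU[OF c] S(2,3)])
    also have "\<dots> = (\<integral>U. (\<Prod>l\<in>S. w l U + c * z l U) \<partial>\<kappa>)"
      by (rule Bochner_Integration.integral_cong[OF refl]) (simp add: 2 space_eq cong: prod.cong del: index_mult_mat(1))
    also have "\<dots> = (\<Sum>L\<in>Pow S. c ^ card L * e' L)"
      unfolding e'_def by (rule expand) (rule bz)
    finally show ?thesis .
  qed
  then have "(\<Sum>l\<in>S. e {l}) = (\<Sum>l\<in>S. e' {l})"
    by (intro linear_coeff_eq[OF S(1) infinite_shifted_circle]) auto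
  moreover have "e {l} = (\<Sum>u<N. x (i l) * cnj (x u) * tensor_moment S a (i(l := u)) j)" if l: "l \<in> S" for l
  proof -
    have *: "(\<Prod>m\<in>{l}. y m U) * (\<Prod>m\<in>S - {l}. w m U) = (\<Sum>u<N. k (i l) u * (\<Prod>m\<in>S. X (a m) U $$ ((i(l := u)) m, j m)))" for U
      by (simp add: y_def w_def sum_distrib_right mult.assoc prod.remove[OF S(1) l])
    show ?thesis unfolding e_def * tensor_moment_def k_def
      by (subst Bochner_Integration.integral_sum)
         (use S l in \<open>auto intro!: bdd_measurable_integrable bdd_measurable_mult[OF bdd_measurable_const] bdd_measurable_prod_X\<close>)
  qed
  moreover have "e' {l} = (\<Sum>u<N. x u * cnj (x (j l)) * tensor_moment S a i (j(l := u)))" if l: "l \<in> S" for l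
  proof -
    have *: "(\<Prod>m\<in>{l}. z m U) * (\<Prod>m\<in>S - {l}. w m U) = (\<Sum>u<N. k u (j l) * (\<Prod>m\<in>S. X (a m) U $$ (i m, (j(l := u)) m)))" for U
      by (simp add: z_def w_def sum_distrib_right mult.assoc mult.left_commute prod.remove[OF S(1) l])
    show ?thesis unfolding e'_def * tensor_moment_def k_def
      by (subst Bochner_Integration.integral_sum)
         (use S l in \<open>auto intro!: bdd_measurable_integrable bdd_measurable_mult[OF bdd_measurable_const] bdd_measurable_prod_X\<close>)
  qed
  ultimately show ?thesis by simp
qed

text \<open>By polarisation, matrix units are combinations of rank one projections.\<close>

lemma infinitesimal_commute:
  assumes S: "finite S" "i \<in> S \<rightarrow> {..<N}" "j \<in> S \<rightarrow> {..<N}" and pq: "p < N" "q < N"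
  shows "(\<Sum>l\<in>S. (if i l = p then tensor_moment S a (i(l := q)) j else 0)) = (\<Sum>l\<in>S. (if j l = q then tensor_moment S a i (j(l := p)) else 0))"
proof -
  \<comment> \<open>\<open>D\<close> is the difference of the two sides for an arbitrary matrix
    \<open>k\<close> in place of the projection. It is linear in \<open>k\<close> and vanishes on
    projections of rank one.\<close>
  define D where "D = (\<lambda>k :: nat \<Rightarrow> nat \<Rightarrow> complex. (\<Sum>l\<in>S. \<Sum>u<N. k (i l) u * tensor_moment S a (i(l := u)) j) -
    (\<Sum>l\<in>S. \<Sum>u<N. k u (j l) * tensor_moment S a i (j(l := u))))"
  define E where "E = (\<lambda>(p :: nat) (q :: nat) (u :: nat) (v :: nat). if u = p \<and> v = q then 1 else 0 :: complex)"
  have R: "D (\<lambda>u v. x u * cnj (x v)) = 0" if "(\<Sum>m<N. x m * cnj (x m)) = 1" for x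
    using infinitesimal_commute_rank_one[OF S that, of a] by (simp add: D_def)
  have lin: "D (\<lambda>u v. \<alpha> * k u v + k' u v) = \<alpha> * D k + D k'" for \<alpha> k k'
    by (simp add: D_def algebra_simps sum.distrib sum_distrib_left)
  have diag: "D (E p p) = 0" if "p < N" for p
  proof -
    have "E p p = (\<lambda>u v. (if u = p then 1 else 0) * cnj (if v = p then 1 else 0))"
      by (auto simp: E_def fun_eq_iff)
    moreover have "(\<Sum>m<N. (if m = p then 1 else 0) * cnj (if m = p then 1 else 0)) = (1::complex)"
    proof -
      have "(\<Sum>m<N. (if m = p then 1 else 0) * cnj (if m = p then 1 else 0)) = (\<Sum>m<N. if m = p then 1 else 0 :: complex)"
        by (intro sum.cong) auto
      then show ?thesis using that by simp
    qed
    ultimately show ?thesis using R[of "\<lambda>u. if u = p then 1 else 0"] by simp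
  qed
  have "D (E p q) = 0"
  proof (cases "p = q")
    case True
    then show ?thesis using diag pq by simp
  next
    case False
    have off: "cnj \<omega> * D (E p q) + \<omega> * D (E q p) = 0" if \<omega>: "\<omega> * cnj \<omega> = 1" for \<omega>
    proof -
      \<comment> \<open>The unit vector (e_p + omega e_q) / sqrt 2. Its projection is half of E_pp +
        E_qq + cnj(omega) E_pq + omega E_qp, and the diagonal terms are already known to vanish
        under \<open>D\<close>.\<close>
      define x where "x = (\<lambda>u. if u = p then 1 / complex_of_real (sqrt 2) else if u = q then \<omega> / complex_of_real (sqrt 2) else 0)"
      have s2: "complex_of_real (sqrt 2) * complex_of_real (sqrt 2) = 2"
        by (metis abs_numeral of_real_mult of_real_numeral real_sqrt_mult_self)
      have e: "x u * cnj (x v) = 1/2 * E p p u v + (1/2 * E q q u v + (cnj \<omega> / 2 * E p q u v + (\<omega> / 2 * E q p u v + 0)))" for u v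
        using False \<omega> by (auto simp: x_def E_def s2)
      have "(\<Sum>m<N. x m * cnj (x m)) = (\<Sum>m<N. (if m = p then 1/2 else 0) + (if m = q then 1/2 else 0))"
        using False \<omega> by (intro sum.cong) (auto simp: x_def s2)
      then have "(\<Sum>m<N. x m * cnj (x m)) = 1" using pq by (simp add: sum.distrib)
      from R[OF this] have "1/2 * D (E p p) + (1/2 * D (E q q) + (cnj \<omega> / 2 * D (E p q) + (\<omega> / 2 * D (E q p) + D (\<lambda>u v. 0)))) = 0"
        unfolding e lin .
      moreover have "D (\<lambda>u v. 0) = 0" by (simp add: D_def)
      ultimately have "cnj \<omega> / 2 * D (E p q) + \<omega> / 2 * D (E q p) = 0"
        using diag[OF pq(1)] diag[OF pq(2)] by (simp only: mult_zero_right add_0_left add_0_right)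
      then have "2 * (cnj \<omega> / 2 * D (E p q) + \<omega> / 2 * D (E q p)) = 0" by (simp only: mult_zero_right)
      then show ?thesis by (simp only: distrib_left) simp
    qed
    \<comment> \<open>omega = 1 gives the sum of the two off-diagonal values, omega = i their
      difference.\<close>
    from off[of 1] off[of \<i>] have "D (E p q) + D (E q p) = 0" "- \<i> * D (E p q) + \<i> * D (E q p) = 0" by simp_all
    then have "D (E q p) = - D (E p q)" "\<i> * (D (E q p) - D (E p q)) = 0" by (simp_all add: eq_neg_iff_add_eq_0 add.commute algebra_simps)
    then show ?thesis by simp
  qed
  moreover have "(\<Sum>u<N. E p q (i l) u * tensor_moment S a (i(l := u)) j) = (if i l = p then tensor_moment S a (i(l := q)) j else 0)" for l
  proof -
    have "(\<Sum>u<N. E p q (i l) u * tensor_moment S a (i(l := u)) j) = (\<Sum>u<N. if u = q then (if i l = p then tensor_moment S a (i(l := q)) j else 0) else 0)"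
      by (intro sum.cong) (auto simp: E_def)
    then show ?thesis using pq by simp
  qed
  moreover have "(\<Sum>u<N. E p q u (j l) * tensor_moment S a i (j(l := u))) = (if j l = q then tensor_moment S a i (j(l := p)) else 0)" for l
  proof -
    have "(\<Sum>u<N. E p q u (j l) * tensor_moment S a i (j(l := u))) = (\<Sum>u<N. if u = p then (if j l = q then tensor_moment S a i (j(l := p)) else 0) else 0)"
      by (intro sum.cong) (auto simp: E_def)
    then show ?thesis using pq by simp
  qed
  ultimately show ?thesis by (simp add: D_def)
qed

lemma tensor_moment_cong: "(\<And>l. l \<in> S \<Longrightarrow> a l = a' l \<and> i l = i' l \<and> j l = j' l) \<Longrightarrow> tensor_moment S a i j = tensor_moment S a' i' j'"
  unfolding tensor_moment_def by (rule Bochner_Integration.integral_cong[OF refl]) (simp cong: prod.cong)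

lemma tensor_moment_permute:
  assumes "t permutes S" shows "tensor_moment S (a \<circ> t) (i \<circ> t) (j \<circ> t) = tensor_moment S a i j"
  unfolding tensor_moment_def
  using prod.permute[OF assms, of "\<lambda>l. X (a l) _ $$ (i l, j l)"] by (simp add: o_def)

text \<open>The commutation identity is applied to the matrix unit in position (p, i m), with the
  row index of slot \<open>m\<close> set to p, and summed over p. On the left, slot \<open>m\<close>
  contributes N equal terms and any other slot k a swap of row indices. On the right, slot
  \<open>m\<close> produces a trace, and slot k contracts X^(a k) with X^(a m).\<close>

lemma loop_equation_full:
  assumes S: "finite S" "i \<in> S \<rightarrow> {..<N}" "j \<in> S \<rightarrow> {..<N}" and m: "m \<in> S"
  shows "of_nat N * tensor_moment S a i j + (\<Sum>k\<in>S - {m}. tensor_moment S a (i \<circ> Transposition.transpose k m) j) =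
    mat_trace (B ^\<^sub>m a m) * tensor_moment S (a(m := 0)) i j +
    (\<Sum>k\<in>S - {m}. tensor_moment S (a(k := a k + a m, m := 0)) i (j \<circ> Transposition.transpose k m))"
proof -
  have il: "i l < N" "j l < N" if "l \<in> S" for l using S that by auto
  let ?R = "\<lambda>U. \<Prod>l\<in>S - {m}. X (a l) U $$ (i l, j l)"
  \<comment> \<open>The sum over p closes slot \<open>m\<close> to a trace. The vacated slot is an
    identity matrix, whose entry encodes the condition i m = j m.\<close>
  have c1: "(\<Sum>p<N. if j m = i m then tensor_moment S a (i(m := p)) (j(m := p)) else 0) = mat_trace (B ^\<^sub>m a m) * tensor_moment S (a(m := 0)) i j"
  proof -
    have 1: "tensor_moment S (a(m := 0)) i j = (if i m = j m then (\<integral>U. ?R U \<partial>\<kappa>) else 0)"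
    proof -
      have "tensor_moment S (a(m := 0)) i j = (\<integral>U. (if i m = j m then ?R U else 0) \<partial>\<kappa>)"
        unfolding tensor_moment_def
      proof (rule Bochner_Integration.integral_cong[OF refl])
        fix U assume "U \<in> space \<kappa>"
        then show "(\<Prod>l\<in>S. X ((a(m := 0)) l) U $$ (i l, j l)) = (if i m = j m then ?R U else 0)"
          using X_0_entry[of U "i m" "j m"] il[OF m] by (simp add: prod.remove[OF S(1) m] space_eq)
      qed
      then show ?thesis by simp
    qed
    have "(\<Sum>p<N. tensor_moment S a (i(m := p)) (j(m := p))) = mat_trace (B ^\<^sub>m a m) * (\<integral>U. ?R U \<partial>\<kappa>)"
    proof -
      have "(\<Sum>p<N. tensor_moment S a (i(m := p)) (j(m := p))) =
         (\<integral>U. (\<Sum>p<N. \<Prod>l\<in>S. X (a l) U $$ ((i(m := p)) l, (j(m := p)) l)) \<partial>\<kappa>)"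
        unfolding tensor_moment_def by (rule Bochner_Integration.integral_sum[symmetric])
          (use S m in \<open>auto intro!: bdd_measurable_integrable bdd_measurable_prod_X\<close>)
      also have "\<dots> = (\<integral>U. mat_trace (B ^\<^sub>m a m) * ?R U \<partial>\<kappa>)"
      proof (rule Bochner_Integration.integral_cong[OF refl])
        fix U assume "U \<in> space \<kappa>"
        then have U: "U \<in> unitary_group N" by (simp add: space_eq)
        have "(\<Sum>p<N. \<Prod>l\<in>S. X (a l) U $$ ((i(m := p)) l, (j(m := p)) l)) = (\<Sum>p<N. X (a m) U $$ (p, p) * ?R U)"
          by (simp add: prod.remove[OF S(1) m])
        then show "(\<Sum>p<N. \<Prod>l\<in>S. X (a l) U $$ ((i(m := p)) l, (j(m := p)) l)) = mat_trace (B ^\<^sub>m a m) * ?R U"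
          by (simp add: sum_distrib_right[symmetric] X_trace[OF U])
      qed
      finally show ?thesis by simp
    qed
    then show ?thesis using 1 by auto
  qed
  \<comment> \<open>The summed index joins slot \<open>k\<close> to slot \<open>m\<close>. The
    vacated slot becomes an identity whose entry forces i m = j k, while the column index j m passes
    to slot \<open>k\<close>; hence the swap of column indices.\<close>
  have c2: "(\<Sum>p<N. if j k = i m then tensor_moment S a (i(m := p)) (j(k := p)) else 0) = tensor_moment S (a(k := a k + a m, m := 0)) i (j \<circ> Transposition.transpose k m)"
    if k: "k \<in> S - {m}" for k
  proof -
    have k': "k \<in> S" "k \<noteq> m" and k2: "k \<in> S - {m}" using k by auto
    let ?R = "\<lambda>U. \<Prod>l\<in>S - {m} - {k}. X (a l) U $$ (i l, j l)"
    have fin: "finite (S - {m})" using S by simp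
    have 1: "tensor_moment S (a(k := a k + a m, m := 0)) i (j \<circ> Transposition.transpose k m) =
       (if i m = j k then (\<integral>U. X (a k + a m) U $$ (i k, j m) * ?R U \<partial>\<kappa>) else 0)"
    proof -
      have "tensor_moment S (a(k := a k + a m, m := 0)) i (j \<circ> Transposition.transpose k m) =
          (\<integral>U. (if i m = j k then X (a k + a m) U $$ (i k, j m) * ?R U else 0) \<partial>\<kappa>)"
        unfolding tensor_moment_def
      proof (rule Bochner_Integration.integral_cong[OF refl])
        fix U assume "U \<in> space \<kappa>"
        then have U: "U \<in> unitary_group N" by (simp add: space_eq)
        have "(\<Prod>l\<in>S - {m} - {k}. X ((a(k := a k + a m, m := 0)) l) U $$ (i l, (j \<circ> Transposition.transpose k m) l)) = ?R U"
        proof (rule prod.cong[OF refl])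
          fix l assume "l \<in> S - {m} - {k}"
          then have "l \<noteq> m" "l \<noteq> k" by auto
          then show "X ((a(k := a k + a m, m := 0)) l) U $$ (i l, (j \<circ> Transposition.transpose k m) l) = X (a l) U $$ (i l, j l)"
            by simp
        qed
        then show "(\<Prod>l\<in>S. X ((a(k := a k + a m, m := 0)) l) U $$ (i l, (j \<circ> Transposition.transpose k m) l)) =
           (if i m = j k then X (a k + a m) U $$ (i k, j m) * ?R U else 0)"
          using X_0_entry[OF U, of "i m" "j k"] il[OF m] il[OF k'(1)] k'
          by (simp add: prod.remove[OF S(1) m] prod.remove[OF fin k2])
      qed
      then show ?thesis by simp
    qed
    have "(\<Sum>p<N. tensor_moment S a (i(m := p)) (j(k := p))) = (\<integral>U. X (a k + a m) U $$ (i k, j m) * ?R U \<partial>\<kappa>)"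
    proof -
      have "(\<Sum>p<N. tensor_moment S a (i(m := p)) (j(k := p))) =
         (\<integral>U. (\<Sum>p<N. \<Prod>l\<in>S. X (a l) U $$ ((i(m := p)) l, (j(k := p)) l)) \<partial>\<kappa>)"
        unfolding tensor_moment_def by (rule Bochner_Integration.integral_sum[symmetric])
          (use S m k' in \<open>auto intro!: bdd_measurable_integrable bdd_measurable_prod_X\<close>)
      also have "\<dots> = (\<integral>U. X (a k + a m) U $$ (i k, j m) * ?R U \<partial>\<kappa>)"
      proof (rule Bochner_Integration.integral_cong[OF refl])
        fix U assume "U \<in> space \<kappa>"
        then have U: "U \<in> unitary_group N" by (simp add: space_eq)
        have "(\<Prod>l\<in>S - {m} - {k}. X (a l) U $$ ((i(m := p)) l, (j(k := p)) l)) = ?R U" for p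
        proof (rule prod.cong[OF refl])
          fix l assume "l \<in> S - {m} - {k}"
          then have "l \<noteq> m" "l \<noteq> k" by auto
          then show "X (a l) U $$ ((i(m := p)) l, (j(k := p)) l) = X (a l) U $$ (i l, j l)" by simp
        qed
        then have "(\<Sum>p<N. \<Prod>l\<in>S. X (a l) U $$ ((i(m := p)) l, (j(k := p)) l)) =
            (\<Sum>p<N. (X (a k) U $$ (i k, p) * X (a m) U $$ (p, j m)) * ?R U)"
          using k' by (simp add: prod.remove[OF S(1) m] prod.remove[OF fin k2] mult_ac)
        then show "(\<Sum>p<N. \<Prod>l\<in>S. X (a l) U $$ ((i(m := p)) l, (j(k := p)) l)) = X (a k + a m) U $$ (i k, j m) * ?R U"
          using X_mult_entry[OF U, of "i k" "j m" "a k" "a m"] il[OF m] il[OF k'(1)]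
          by (simp add: sum_distrib_right[symmetric])
      qed
      finally show ?thesis .
    qed
    then show ?thesis using 1 by auto
  qed
  have main: "(\<Sum>l\<in>S. (if (i(m := p)) l = p then tensor_moment S a (i(m := p, l := i m)) j else 0)) =
      (\<Sum>l\<in>S. (if j l = i m then tensor_moment S a (i(m := p)) (j(l := p)) else 0))" if "p < N" for p
    by (rule infinitesimal_commute) (use S m il[OF m] that in auto)
  have left: "(\<Sum>p<N. \<Sum>l\<in>S. (if (i(m := p)) l = p then tensor_moment S a (i(m := p, l := i m)) j else 0)) =
     of_nat N * tensor_moment S a i j + (\<Sum>k\<in>S - {m}. tensor_moment S a (i \<circ> Transposition.transpose k m) j)"
  proof -
    have "(\<Sum>p<N. if (i(m := p)) k = p then tensor_moment S a (i(m := p, k := i m)) j else 0) = tensor_moment S a (i \<circ> Transposition.transpose k m) j"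
      if k: "k \<in> S - {m}" for k
    proof -
      have "(\<Sum>p<N. if (i(m := p)) k = p then tensor_moment S a (i(m := p, k := i m)) j else 0) =
         (\<Sum>p<N. if i k = p then tensor_moment S a (i(m := i k, k := i m)) j else 0)"
        using k by (intro sum.cong) auto
      also have "\<dots> = tensor_moment S a (i(m := i k, k := i m)) j" using il k by auto
      also have "i(m := i k, k := i m) = i \<circ> Transposition.transpose k m"
        using k by (auto simp: fun_eq_iff Transposition.transpose_def)
      finally show ?thesis .
    qed
    then show ?thesis by (subst sum.swap) (simp add: sum.remove[OF S(1) m])
  qed
  have right: "(\<Sum>p<N. \<Sum>l\<in>S. (if j l = i m then tensor_moment S a (i(m := p)) (j(l := p)) else 0)) =
    mat_trace (B ^\<^sub>m a m) * tensor_moment S (a(m := 0)) i j +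
    (\<Sum>k\<in>S - {m}. tensor_moment S (a(k := a k + a m, m := 0)) i (j \<circ> Transposition.transpose k m))"
    by (subst sum.swap) (simp only: sum.remove[OF S(1) m] c1 c2 cong: sum.cong)
  have "(\<Sum>p<N. \<Sum>l\<in>S. (if (i(m := p)) l = p then tensor_moment S a (i(m := p, l := i m)) j else 0)) =
      (\<Sum>p<N. \<Sum>l\<in>S. (if j l = i m then tensor_moment S a (i(m := p)) (j(l := p)) else 0))"
    by (rule sum.cong[OF refl]) (rule main, simp)
  then show ?thesis unfolding left right .
qed

text \<open>Slots outside \<open>T\<close> carry the identity matrix, and there the terms of the two sums cancel.\<close>

lemma loop_equation:
  assumes U: "finite S" "i \<in> S \<rightarrow> {..<N}" "j \<in> S \<rightarrow> {..<N}" and m: "m \<in> T" "T \<subseteq> S" and a: "\<forall>l. l \<notin> T \<longrightarrow> a l = 0"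
  shows "of_nat N * tensor_moment S a i j + (\<Sum>k\<in>T - {m}. tensor_moment S a (i \<circ> Transposition.transpose k m) j) =
    mat_trace (B ^\<^sub>m a m) * tensor_moment S (a(m := 0)) i j +
    (\<Sum>k\<in>T - {m}. tensor_moment S (a(k := a k + a m, m := 0)) i (j \<circ> Transposition.transpose k m))"
proof -
  have mS: "m \<in> S" using m by auto
  have cancel: "tensor_moment S (a(k := a k + a m, m := 0)) i (j \<circ> Transposition.transpose k m) = tensor_moment S a (i \<circ> Transposition.transpose k m) j"
    if k: "k \<in> S - T" for k
  proof -
    let ?t = "Transposition.transpose k m"
    have t: "?t permutes S" using k mS by (intro permutes_swap_id) auto
    \<comment> \<open>As \<open>a k = 0\<close>, moving the exponent of \<open>m\<close> to
      \<open>k\<close> amounts to exchanging the two slots.\<close>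
    have "a(k := a k + a m, m := 0) = a \<circ> ?t" using a k m(1) by (auto simp: fun_eq_iff Transposition.transpose_def)
    then have "tensor_moment S (a(k := a k + a m, m := 0)) i (j \<circ> ?t) = tensor_moment S (a \<circ> ?t) (i \<circ> ?t \<circ> ?t) (j \<circ> ?t)"
      by (simp add: comp_assoc)
    then show ?thesis using tensor_moment_permute[OF t, of a "i \<circ> ?t" j] by simp
  qed
  have split: "(\<Sum>k\<in>S - {m}. h k) = (\<Sum>k\<in>T - {m}. h k) + (\<Sum>k\<in>S - T. h k)" for h :: "nat \<Rightarrow> complex"
  proof -
    have "S - {m} = (T - {m}) \<union> (S - T)" using m by auto
    then show ?thesis using U(1) finite_subset[OF m(2)] by (simp only:) (subst sum.union_disjoint, auto)
  qed
  have "(\<Sum>k\<in>S - T. tensor_moment S (a(k := a k + a m, m := 0)) i (j \<circ> Transposition.transpose k m)) =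
     (\<Sum>k\<in>S - T. tensor_moment S a (i \<circ> Transposition.transpose k m) j)"
    using cancel by (intro sum.cong) auto
  with loop_equation_full[OF U mS, of a] show ?thesis unfolding split by simp
qed

end

section \<open>Moments as sums over monotone sequences\<close>

lemma sum_PiE_insert:
  fixes h :: "('a \<Rightarrow> 'b) \<Rightarrow> 'c :: comm_monoid_add"
  assumes "m \<notin> T"
  shows "(\<Sum>i\<in>PiE (insert m T) F. h i) = (\<Sum>i\<in>PiE T F. \<Sum>x\<in>F m. h (i(m := x)))"
proof -
  have "(\<Sum>i\<in>PiE (insert m T) F. h i) = (\<Sum>(x, i)\<in>F m \<times> PiE T F. h (i(m := x)))"
    unfolding PiE_insert_eq
    by (subst sum.reindex[OF inj_combinator[OF assms]]) (simp add: case_prod_unfold)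
  also have "\<dots> = (\<Sum>x\<in>F m. \<Sum>i\<in>PiE T F. h (i(m := x)))" by (simp add: sum.cartesian_product)
  finally show ?thesis by (simp add: sum.swap[of _ "F m"])
qed

lemma sum_PiE_comp_transpose:
  fixes h :: "(nat \<Rightarrow> 'b) \<Rightarrow> 'c :: comm_monoid_add"
  assumes "k \<in> S" "m \<in> S"
  shows "(\<Sum>i\<in>PiE S (\<lambda>_. F). h (i \<circ> Transposition.transpose k m)) = (\<Sum>i\<in>PiE S (\<lambda>_. F). h i)"
proof -
  have c: "i \<circ> Transposition.transpose k m \<in> PiE S (\<lambda>_. F)" if "i \<in> PiE S (\<lambda>_. F)" for i
    using that assms by (auto simp: PiE_iff extensional_def Transposition.transpose_def)
  show ?thesis
    by (rule sum.reindex_bij_witness[where i = "\<lambda>i. i \<circ> Transposition.transpose k m" and j = "\<lambda>i. i \<circ> Transposition.transpose k m"])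
      (use c in \<open>auto simp: comp_assoc\<close>)
qed

text \<open>A permutation and its inverse have the same cycles, and inversion turns the right factor
  into a left one.\<close>

lemma orbit_prod_insert_transpose_right:
  assumes "finite S" "p permutes S" "m \<notin> S" "k \<in> S"
  shows "orbit_prod w (insert m S) (p \<circ> Transposition.transpose k m) a = orbit_prod w S p (a(k := a k + a m))"
proof -
  let ?t = "Transposition.transpose k m"
  have p: "p permutes insert m S" using assms(2) by (rule permutes_subset) auto
  have t: "?t permutes insert m S" using assms by (intro permutes_swap_id) auto
  have pt: "p \<circ> ?t permutes insert m S" by (rule permutes_compose[OF t p])
  have "inv_into UNIV (p \<circ> ?t) = inv_into UNIV ?t \<circ> inv_into UNIV p"
    by (rule o_inv_distrib) (use p t permutes_bij in auto)
  then have e: "inv_into UNIV (p \<circ> ?t) = ?t \<circ> inv_into UNIV p" by (simp only: Transposition.inv_transpose_eq)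
  have fin: "finite (insert m S)" using assms(1) by simp
  have "orbit_prod w (insert m S) (p \<circ> ?t) a = orbit_prod w (insert m S) (inv_into UNIV (p \<circ> ?t)) a"
    by (rule orbit_prod_inv[OF fin pt, symmetric])
  also have "\<dots> = orbit_prod w S (inv_into UNIV p) (a(k := a k + a m))"
    unfolding e by (rule orbit_prod_insert_transpose[OF assms(1) permutes_inv[OF assms(2)] assms(3,4)])
  also have "\<dots> = orbit_prod w S p (a(k := a k + a m))" by (rule orbit_prod_inv[OF assms(1,2)])
  finally show ?thesis .
qed

text \<open>\<open>permutes_insert\<close> puts the transposition on the left; applied to the
  inverse of \<open>p\<close> it yields one on the right.\<close>

lemma permutes_insert_cases:
  assumes "p permutes insert m T"
  obtains q where "q permutes T" "p = q" | q k where "q permutes T" "k \<in> T" "p = q \<circ> Transposition.transpose k m"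
proof -
  have "inv_into UNIV p \<in> {q. q permutes insert m T}" using permutes_inv[OF assms] by simp
  then obtain b q where q: "b \<in> insert m T" "q permutes T" "inv_into UNIV p = Transposition.transpose m b \<circ> q"
    unfolding permutes_insert by auto
  let ?t = "Transposition.transpose m b"
  have t: "bij ?t" by simp
  have "p = inv_into UNIV (inv_into UNIV p)" using permutes_inv_inv[OF assms] by simp
  also have "\<dots> = inv_into UNIV q \<circ> inv_into UNIV ?t" unfolding q(3)
    by (rule o_inv_distrib[OF t]) (use q(2) permutes_bij in auto)
  finally have p: "p = inv_into UNIV q \<circ> ?t" by (simp only: Transposition.inv_transpose_eq)
  show ?thesis
  proof (cases "b = m")
    case True
    then show ?thesis using p that(1)[OF permutes_inv[OF q(2)]] by simp
  next
    case False
    then show ?thesis using q(1) p that(2)[OF permutes_inv[OF q(2)], of b] by (simp add: transpose_commute)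
  qed
qed

text \<open>The index of one slot \<open>m\<close> is summed out. At a fixed point this is a trace;
  otherwise the predecessor \<open>k\<close> of \<open>m\<close> absorbs the slot, since the sum
  multiplies A^(a k) by A^(a m).\<close>

lemma sum_tuples_eq_orbit_prod:
  assumes A: "A \<in> carrier_mat N N" and "finite S" "p permutes S"
  shows "(\<Sum>i\<in>PiE S (\<lambda>_. {..<N}). \<Prod>l\<in>S. (A ^\<^sub>m a l) $$ (i l, i (p l))) = orbit_prod (\<lambda>k. mat_trace (A ^\<^sub>m k)) S p a"
  using assms(2,3)
proof (induction S arbitrary: p a rule: finite_induct)
  case empty
  then show ?case by (simp add: orbit_prod_def)
next
  case (insert m T)
  have An: "A ^\<^sub>m n \<in> carrier_mat N N" for n using A by simp
  have tr: "mat_trace (A ^\<^sub>m n) = (\<Sum>x<N. (A ^\<^sub>m n) $$ (x, x))" for n using An[of n] by (auto simp: mat_trace_def)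
  from insert.prems show ?case
  proof (cases rule: permutes_insert_cases)
    case (1 q)
    have qm: "q m = m" using 1 insert.hyps by (simp add: permutes_def)
    have qT: "q l \<noteq> m" "l \<noteq> m" if "l \<in> T" for l using permutes_in_image[OF 1(1), of l] insert.hyps that by auto
    have "(\<Sum>i\<in>PiE (insert m T) (\<lambda>_. {..<N}). \<Prod>l\<in>insert m T. (A ^\<^sub>m a l) $$ (i l, i (q l))) =
      (\<Sum>i\<in>PiE T (\<lambda>_. {..<N}). \<Sum>x<N. (A ^\<^sub>m a m) $$ (x, x) * (\<Prod>l\<in>T. (A ^\<^sub>m a l) $$ (i l, i (q l))))"
      unfolding sum_PiE_insert[OF insert.hyps(2)] prod.insert[OF insert.hyps]
      by (intro sum.cong refl arg_cong2[of _ _ _ _ "(*)"] prod.cong) (auto simp: qm dest: qT)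
    also have "\<dots> = mat_trace (A ^\<^sub>m a m) * orbit_prod (\<lambda>k. mat_trace (A ^\<^sub>m k)) T q a"
      by (simp add: sum_distrib_right[symmetric] sum_distrib_left[symmetric] tr insert.IH[OF 1(1)])
    finally show ?thesis unfolding 1(2) orbit_prod_insert_fixed[OF insert.hyps(1) 1(1) insert.hyps(2)] .
  next
    case (2 q k)
    let ?p = "q \<circ> Transposition.transpose k m"
    have km: "k \<noteq> m" using 2 insert.hyps by auto
    have qT: "q l \<in> T" if "l \<in> T" for l using permutes_in_image[OF 2(1), of l] that by auto
    have qT': "q l \<noteq> m" if "l \<in> T" for l using qT[OF that] insert.hyps by auto
    have qm: "q m = m" using 2 insert.hyps by (simp add: permutes_def)
    have pl: "?p l = q l" if "l \<in> T - {k}" for l using that insert.hyps by (auto simp: Transposition.transpose_def)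
    have pk: "?p k = m" "?p m = q k" using qm by auto
    have kfin: "finite (T - {k})" using insert.hyps by simp
    have "(\<Sum>i\<in>PiE (insert m T) (\<lambda>_. {..<N}). \<Prod>l\<in>insert m T. (A ^\<^sub>m a l) $$ (i l, i (?p l))) =
      (\<Sum>i\<in>PiE T (\<lambda>_. {..<N}). \<Sum>x<N. \<Prod>l\<in>insert m T. (A ^\<^sub>m a l) $$ ((i(m := x)) l, (i(m := x)) (?p l)))"
      by (rule sum_PiE_insert[OF insert.hyps(2)])
    also have "\<dots> = (\<Sum>i\<in>PiE T (\<lambda>_. {..<N}). \<Prod>l\<in>T. (A ^\<^sub>m ((a(k := a k + a m)) l)) $$ (i l, i (q l)))"
    proof (rule sum.cong[OF refl])
      fix i assume i: "i \<in> PiE T (\<lambda>_. {..<N})"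
      let ?R = "\<Prod>l\<in>T - {k}. (A ^\<^sub>m a l) $$ (i l, i (q l))"
      have ik: "i k < N" "i (q k) < N" using i 2(2) qT by auto
      have R: "(\<Prod>l\<in>T - {k}. (A ^\<^sub>m a l) $$ ((i(m := x)) l, (i(m := x)) (?p l))) = ?R" for x
      proof (rule prod.cong[OF refl])
        fix l assume l: "l \<in> T - {k}"
        then have "l \<noteq> m" "q l \<noteq> m" using insert.hyps qT' by auto
        then show "(A ^\<^sub>m a l) $$ ((i(m := x)) l, (i(m := x)) (?p l)) = (A ^\<^sub>m a l) $$ (i l, i (q l))"
          unfolding pl[OF l] by simp
      qed
      have "(\<Prod>l\<in>insert m T. (A ^\<^sub>m a l) $$ ((i(m := x)) l, (i(m := x)) (?p l))) =
         ((A ^\<^sub>m a k) $$ (i k, x) * (A ^\<^sub>m a m) $$ (x, i (q k))) * ?R" for x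
        unfolding prod.insert[OF insert.hyps] prod.remove[OF insert.hyps(1) 2(2)] R pk
        using km qT'[OF 2(2)] by simp
      then have "(\<Sum>x<N. \<Prod>l\<in>insert m T. (A ^\<^sub>m a l) $$ ((i(m := x)) l, (i(m := x)) (?p l))) =
         (\<Sum>x<N. (A ^\<^sub>m a k) $$ (i k, x) * (A ^\<^sub>m a m) $$ (x, i (q k))) * ?R"
        by (simp add: sum_distrib_right)
      also have "(\<Sum>x<N. (A ^\<^sub>m a k) $$ (i k, x) * (A ^\<^sub>m a m) $$ (x, i (q k))) = (A ^\<^sub>m (a k + a m)) $$ (i k, i (q k))"
        using mat_mult_entry[OF An An ik, of "a k" "a m"] pow_mat_add[OF A, of "a k" "a m"] by simp
      also have "\<dots> * ?R = (\<Prod>l\<in>T. (A ^\<^sub>m ((a(k := a k + a m)) l)) $$ (i l, i (q l)))"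
        unfolding prod.remove[OF insert.hyps(1) 2(2)] by simp
      finally show "(\<Sum>x<N. \<Prod>l\<in>insert m T. (A ^\<^sub>m a l) $$ ((i(m := x)) l, (i(m := x)) (?p l))) =
        (\<Prod>l\<in>T. (A ^\<^sub>m ((a(k := a k + a m)) l)) $$ (i l, i (q l)))" .
    qed
    also have "\<dots> = orbit_prod (\<lambda>k. mat_trace (A ^\<^sub>m k)) T q (a(k := a k + a m))" by (rule insert.IH[OF 2(1)])
    finally show ?thesis unfolding 2(3) orbit_prod_insert_transpose_right[OF insert.hyps(1) 2(1) insert.hyps(2) 2(2)] .
  qed
qed

definition struct_sum where
  "struct_sum v w S r = (\<Sum>X\<in>mono_structs S r. struct_weight v w S X)"

context unitary_haar_conj
begin

context
  fixes A :: "complex mat"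
  assumes A: "A \<in> carrier_mat N N"
begin

text \<open>Copies of \<open>A\<close> are contracted with the tensor moment along \<open>p\<close>.
  Exponents 1 with p = id give E[Tr(AX)^d], exponents 0 the power sum of \<open>A\<close> over the
  cycles of \<open>p\<close>; the loop equations lead from the first to the second.\<close>

definition contracted :: "nat set \<Rightarrow> (nat \<Rightarrow> nat) \<Rightarrow> (nat \<Rightarrow> nat) \<Rightarrow> complex" where
  "contracted S a p = (\<Sum>i\<in>PiE S (\<lambda>_. {..<N}). \<Sum>j\<in>PiE S (\<lambda>_. {..<N}). (\<Prod>l\<in>S. A $$ (j l, i (p l))) * tensor_moment S a i j)"

text \<open>Loop equations permute indices of the tensor moment. Substituting \<open>i\<close>
  composed with the transposition moves the change to \<open>p\<close>, so that they become
  equations for functions on permutations.\<close>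

lemma contracted_left:
  assumes "k \<in> S" "m \<in> S"
  shows "contracted S a (Transposition.transpose k m \<circ> p) =
    (\<Sum>i\<in>PiE S (\<lambda>_. {..<N}). \<Sum>j\<in>PiE S (\<lambda>_. {..<N}). (\<Prod>l\<in>S. A $$ (j l, i (p l))) * tensor_moment S a (i \<circ> Transposition.transpose k m) j)"
proof -
  let ?t = "Transposition.transpose k m"
  let ?h = "\<lambda>i. \<Sum>j\<in>PiE S (\<lambda>_. {..<N}). (\<Prod>l\<in>S. A $$ (j l, i ((?t \<circ> p) l))) * tensor_moment S a i j"
  have "contracted S a (?t \<circ> p) = (\<Sum>i\<in>PiE S (\<lambda>_. {..<N}). ?h (i \<circ> ?t))"
    unfolding contracted_def by (rule sum_PiE_comp_transpose[OF assms, symmetric])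
  then show ?thesis by simp
qed

text \<open>Here the substitution is in \<open>j\<close>; reindexing the product over slots by the
  same transposition makes it a right factor of \<open>p\<close>.\<close>

lemma contracted_right:
  assumes "finite S" "k \<in> S" "m \<in> S"
  shows "contracted S a (p \<circ> Transposition.transpose k m) =
    (\<Sum>i\<in>PiE S (\<lambda>_. {..<N}). \<Sum>j\<in>PiE S (\<lambda>_. {..<N}). (\<Prod>l\<in>S. A $$ (j l, i (p l))) * tensor_moment S a i (j \<circ> Transposition.transpose k m))"
proof -
  let ?t = "Transposition.transpose k m"
  have t: "?t permutes S" using assms by (intro permutes_swap_id)
  have "(\<Sum>j\<in>PiE S (\<lambda>_. {..<N}). (\<Prod>l\<in>S. A $$ (j l, i ((p \<circ> ?t) l))) * tensor_moment S a i j) =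
    (\<Sum>j\<in>PiE S (\<lambda>_. {..<N}). (\<Prod>l\<in>S. A $$ (j l, i (p l))) * tensor_moment S a i (j \<circ> ?t))" for i
  proof -
    let ?h = "\<lambda>j. (\<Prod>l\<in>S. A $$ (j l, i ((p \<circ> ?t) l))) * tensor_moment S a i j"
    have "(\<Sum>j\<in>PiE S (\<lambda>_. {..<N}). ?h j) = (\<Sum>j\<in>PiE S (\<lambda>_. {..<N}). ?h (j \<circ> ?t))"
      by (rule sum_PiE_comp_transpose[OF assms(2,3), symmetric])
    also have "\<dots> = (\<Sum>j\<in>PiE S (\<lambda>_. {..<N}). (\<Prod>l\<in>S. A $$ (j l, i (p l))) * tensor_moment S a i (j \<circ> ?t))"
    proof (rule sum.cong[OF refl])
      fix j
      have "(\<Prod>l\<in>S. A $$ ((j \<circ> ?t) l, i ((p \<circ> ?t) l))) = (\<Prod>l\<in>S. A $$ (j l, i (p l)))"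
        using prod.permute[OF t, of "\<lambda>l. A $$ (j l, i (p l))"] by (simp add: o_def)
      then show "?h (j \<circ> ?t) = (\<Prod>l\<in>S. A $$ (j l, i (p l))) * tensor_moment S a i (j \<circ> ?t)" by simp
    qed
    finally show ?thesis .
  qed
  then show ?thesis by (simp only: contracted_def)
qed

lemma contracted_loop:
  assumes "finite S" "m \<in> T" "T \<subseteq> S" "\<forall>l. l \<notin> T \<longrightarrow> a l = 0"
  shows "of_nat N * contracted S a p + (\<Sum>k\<in>T - {m}. contracted S a (Transposition.transpose k m \<circ> p)) =
      mat_trace (B ^\<^sub>m a m) * contracted S (a(m := 0)) p +
      (\<Sum>k\<in>T - {m}. contracted S (a(k := a k + a m, m := 0)) (p \<circ> Transposition.transpose k m))"
proof -
  have mS: "m \<in> S" and kS: "k \<in> S" if "k \<in> T - {m}" for k using assms that by auto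
  let ?I = "PiE S (\<lambda>_. {..<N})"
  let ?P = "\<lambda>i j. \<Prod>l\<in>S. A $$ (j l, i (p l))"
  let ?t = "\<lambda>k. Transposition.transpose k m"
  have "(\<Sum>k\<in>T - {m}. contracted S a (?t k \<circ> p)) = (\<Sum>k\<in>T - {m}. \<Sum>i\<in>?I. \<Sum>j\<in>?I. ?P i j * tensor_moment S a (i \<circ> ?t k) j)"
    using assms by (intro sum.cong refl contracted_left) auto
  also have "\<dots> = (\<Sum>i\<in>?I. \<Sum>j\<in>?I. ?P i j * (\<Sum>k\<in>T - {m}. tensor_moment S a (i \<circ> ?t k) j))"
    by (subst sum.swap, rule sum.cong[OF refl], subst sum.swap) (simp add: sum_distrib_left)
  finally have 1: "of_nat N * contracted S a p + (\<Sum>k\<in>T - {m}. contracted S a (?t k \<circ> p)) =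
     (\<Sum>i\<in>?I. \<Sum>j\<in>?I. ?P i j * (of_nat N * tensor_moment S a i j + (\<Sum>k\<in>T - {m}. tensor_moment S a (i \<circ> ?t k) j)))"
    by (simp add: contracted_def sum_distrib_left distrib_left sum.distrib mult_ac)
  have "(\<Sum>k\<in>T - {m}. contracted S (a(k := a k + a m, m := 0)) (p \<circ> ?t k)) =
     (\<Sum>k\<in>T - {m}. \<Sum>i\<in>?I. \<Sum>j\<in>?I. ?P i j * tensor_moment S (a(k := a k + a m, m := 0)) i (j \<circ> ?t k))"
    using assms by (intro sum.cong refl contracted_right) auto
  also have "\<dots> = (\<Sum>i\<in>?I. \<Sum>j\<in>?I. ?P i j * (\<Sum>k\<in>T - {m}. tensor_moment S (a(k := a k + a m, m := 0)) i (j \<circ> ?t k)))"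
    by (subst sum.swap, rule sum.cong[OF refl], subst sum.swap) (simp add: sum_distrib_left)
  finally have 2: "mat_trace (B ^\<^sub>m a m) * contracted S (a(m := 0)) p +
      (\<Sum>k\<in>T - {m}. contracted S (a(k := a k + a m, m := 0)) (p \<circ> ?t k)) =
     (\<Sum>i\<in>?I. \<Sum>j\<in>?I. ?P i j * (mat_trace (B ^\<^sub>m a m) * tensor_moment S (a(m := 0)) i j +
        (\<Sum>k\<in>T - {m}. tensor_moment S (a(k := a k + a m, m := 0)) i (j \<circ> ?t k))))"
    by (simp add: contracted_def sum_distrib_left distrib_left sum.distrib mult_ac)
  show ?thesis unfolding 1 2
    by (intro sum.cong refl arg_cong2[of _ _ _ _ "(*)"] loop_equation) (use assms in auto)
qed

text \<open>The zeroth power is the identity, so \<open>j = i\<close> is forced and a cyclic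
  contraction of the entries of \<open>A\<close> remains.\<close>

lemma contracted_zero:
  assumes "finite S" "p permutes S"
  shows "contracted S (\<lambda>_. 0) p = orbit_prod (\<lambda>k. mat_trace (A ^\<^sub>m k)) S p (\<lambda>_. 1)"
proof -
  let ?I = "PiE S (\<lambda>_. {..<N})"
  have tensor_moment: "tensor_moment S (\<lambda>_. 0) i j = (if j = i then 1 else 0)" if "i \<in> ?I" "j \<in> ?I" for i j
  proof -
    have lt: "i l < N" "j l < N" if "l \<in> S" for l using that \<open>i \<in> ?I\<close> \<open>j \<in> ?I\<close> by auto
    have "tensor_moment S (\<lambda>_. 0) i j = (\<integral>U. (if j = i then 1 else 0) \<partial>\<kappa>)"
      unfolding tensor_moment_def
    proof (rule Bochner_Integration.integral_cong[OF refl])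
      fix U assume "U \<in> space \<kappa>"
      then have U: "U \<in> unitary_group N" by (simp add: space_eq)
      have "(\<Prod>l\<in>S. X 0 U $$ (i l, j l)) = (\<Prod>l\<in>S. if i l = j l then 1 else 0)"
        by (intro prod.cong refl X_0_entry[OF U] lt)
      also have "\<dots> = (if j = i then 1 else 0)"
      proof (cases "j = i")
        case False
        have "\<exists>l\<in>S. i l \<noteq> j l"
        proof (rule ccontr)
          assume "\<not> (\<exists>l\<in>S. i l \<noteq> j l)"
          then have "j = i" by (intro PiE_ext[OF that(2,1)]) auto
          then show False using False by contradiction
        qed
        then have "(\<Prod>l\<in>S. if i l = j l then 1 else 0) = (0 :: complex)" by (intro prod_zero[OF assms(1)]) auto
        then show ?thesis using False by simp
      qed simp
      finally show "(\<Prod>l\<in>S. X 0 U $$ (i l, j l)) = (if j = i then 1 else 0)" .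
    qed
    then show ?thesis by (simp add: prob_space)
  qed
  have fin: "finite ?I" using assms(1) by (intro finite_PiE) auto
  have "contracted S (\<lambda>_. 0) p = (\<Sum>i\<in>?I. \<Sum>j\<in>?I. if j = i then (\<Prod>l\<in>S. A $$ (i l, i (p l))) else 0)"
    unfolding contracted_def by (intro sum.cong refl) (simp add: tensor_moment)
  also have "\<dots> = (\<Sum>i\<in>?I. \<Prod>l\<in>S. (A ^\<^sub>m 1) $$ (i l, i (p l)))" using fin A by simp
  also have "\<dots> = orbit_prod (\<lambda>k. mat_trace (A ^\<^sub>m k)) S p (\<lambda>_. 1)"
    by (rule sum_tuples_eq_orbit_prod[OF A assms])
  finally show ?thesis .
qed

lemma trace_conj_eq:
  assumes "U \<in> unitary_group N"
  shows "mat_trace (A * U * B * mat_adjoint U) = (\<Sum>p<N. \<Sum>q<N. A $$ (q, p) * X 1 U $$ (p, q))"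
proof -
  note u = unitaryD[OF assms]
  have X1: "X 1 U = U * (B * mat_adjoint U)" using u B by (simp add: conj_pow_def assoc_N)
  have "A * U * B * mat_adjoint U = A * X 1 U" unfolding X1 using u A B by (simp add: assoc_N)
  then have "mat_trace (A * U * B * mat_adjoint U) = (\<Sum>q<N. \<Sum>p<N. A $$ (q, p) * X 1 U $$ (p, q))"
    using A X_carrier[OF assms, of 1]
    by (auto simp: mat_trace_def mat_mult_entry[OF A X_carrier[OF assms]] simp del: index_mult_mat(1) intro!: sum.cong)
  also have "\<dots> = (\<Sum>p<N. \<Sum>q<N. A $$ (q, p) * X 1 U $$ (p, q))" by (rule sum.swap)
  finally show ?thesis .
qed

lemma bdd_measurable_trace: "bdd_measurable (\<lambda>U. mat_trace (A * U * B * mat_adjoint U))"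
proof -
  have "bdd_measurable (\<lambda>U. \<Sum>p<N. \<Sum>q<N. A $$ (q, p) * X 1 U $$ (p, q))"
    by (intro bdd_measurable_sum bdd_measurable_mult bdd_measurable_const bdd_measurable_X) auto
  then show ?thesis by (rule bdd_measurable_cong) (simp only: trace_conj_eq)
qed

text \<open>With p = id every slot carries its own trace Tr(AX). The exponent is cut to 0 off
  \<open>S\<close> to meet the hypothesis of \<open>loop_solution\<close>.\<close>

lemma contracted_one:
  assumes "finite S"
  shows "contracted S (\<lambda>l. if l \<in> S then 1 else 0) id = (\<integral>U. mat_trace (A * U * B * mat_adjoint U) ^ card S \<partial>\<kappa>)"
proof -
  let ?I = "PiE S (\<lambda>_. {..<N})"
  have "mat_trace (A * U * B * mat_adjoint U) ^ card S =
     (\<Sum>i\<in>?I. \<Sum>j\<in>?I. (\<Prod>l\<in>S. A $$ (j l, i l)) * (\<Prod>l\<in>S. X 1 U $$ (i l, j l)))" if "U \<in> unitary_group N" for U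
  proof -
    have "mat_trace (A * U * B * mat_adjoint U) ^ card S = (\<Prod>l\<in>S. \<Sum>p<N. \<Sum>q<N. A $$ (q, p) * X 1 U $$ (p, q))"
      by (simp add: trace_conj_eq[OF that])
    also have "\<dots> = (\<Sum>i\<in>?I. \<Prod>l\<in>S. \<Sum>q<N. A $$ (q, i l) * X 1 U $$ (i l, q))"
      using assms by (subst prod_sum_PiE) auto
    also have "\<dots> = (\<Sum>i\<in>?I. \<Sum>j\<in>?I. \<Prod>l\<in>S. A $$ (j l, i l) * X 1 U $$ (i l, j l))"
      using assms by (subst prod_sum_PiE) auto
    finally show ?thesis by (simp add: prod.distrib)
  qed
  then have "(\<integral>U. mat_trace (A * U * B * mat_adjoint U) ^ card S \<partial>\<kappa>) =
     (\<integral>U. (\<Sum>i\<in>?I. \<Sum>j\<in>?I. (\<Prod>l\<in>S. A $$ (j l, i l)) * (\<Prod>l\<in>S. X 1 U $$ (i l, j l))) \<partial>\<kappa>)"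
    by (intro Bochner_Integration.integral_cong refl) (simp add: space_eq)
  also have "\<dots> = (\<Sum>i\<in>?I. \<integral>U. (\<Sum>j\<in>?I. (\<Prod>l\<in>S. A $$ (j l, i l)) * (\<Prod>l\<in>S. X 1 U $$ (i l, j l))) \<partial>\<kappa>)"
    by (rule Bochner_Integration.integral_sum)
       (intro bdd_measurable_integrable bdd_measurable_sum bdd_measurable_mult bdd_measurable_const bdd_measurable_prod_X[of _ _ _ "\<lambda>_. 1"], auto)
  also have "\<dots> = (\<Sum>i\<in>?I. \<Sum>j\<in>?I. \<integral>U. (\<Prod>l\<in>S. A $$ (j l, i l)) * (\<Prod>l\<in>S. X 1 U $$ (i l, j l)) \<partial>\<kappa>)"
    by (rule sum.cong[OF refl], rule Bochner_Integration.integral_sum)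
       (intro bdd_measurable_integrable bdd_measurable_sum bdd_measurable_mult bdd_measurable_const bdd_measurable_prod_X[of _ _ _ "\<lambda>_. 1"], auto)
  also have "\<dots> = (\<Sum>i\<in>?I. \<Sum>j\<in>?I. (\<Prod>l\<in>S. A $$ (j l, i l)) * tensor_moment S (\<lambda>_. 1) i j)"
    by (simp add: tensor_moment_def)
  also have "\<dots> = contracted S (\<lambda>l. if l \<in> S then 1 else 0) id"
    unfolding contracted_def id_def
    by (intro sum.cong refl arg_cong2[of _ _ _ _ "(*)"] tensor_moment_cong) auto
  finally show ?thesis ..
qed

theorem trace_moment:
  assumes S: "finite S" "(card S)\<^sup>2 < N"
  shows "(\<integral>U. mat_trace (A * U * B * mat_adjoint U) ^ card S \<partial>\<kappa>) =
    (1 / of_nat N) ^ card S *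
      (\<Sum>r. struct_sum (\<lambda>k. mat_trace (A ^\<^sub>m k)) (\<lambda>k. mat_trace (B ^\<^sub>m k)) S r * (- 1 / of_nat N) ^ r)"
proof -
  let ?v = "\<lambda>k. mat_trace (A ^\<^sub>m k)" and ?w = "\<lambda>k. mat_trace (B ^\<^sub>m k)"
  let ?a = "\<lambda>l. if l \<in> S then 1 else 0 :: nat"
  let ?x = "- 1 / of_nat N :: complex"
  have N: "N > 0" using S by auto
  define C where "C = (\<Sum>q | q permutes S. cmod (contracted S (\<lambda>_. 0) q))"
  have C: "cmod (contracted S (\<lambda>_. 0) q) \<le> C" if "q permutes S" for q
    unfolding C_def using that S(1) by (intro member_le_sum) (auto simp: finite_permutations)
  have x: "cmod ?x * (card S)\<^sup>2 < 1" using S N by (simp add: norm_divide field_simps flip: of_nat_power)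
  have series: "summable (\<lambda>r. (\<Sum>ts\<in>mono_lists S r. struct_weight ?v ?w S (\<sigma>, ts)) * ?x ^ r)"
    "orbit_prod ?w S \<sigma> ?a * mono_series (\<lambda>q. contracted S (\<lambda>_. 0) (q \<circ> \<sigma>)) S ?x id =
      (\<Sum>r. (\<Sum>ts\<in>mono_lists S r. struct_weight ?v ?w S (\<sigma>, ts)) * ?x ^ r)" if \<sigma>: "\<sigma> permutes S" for \<sigma>
  proof -
    let ?f = "\<lambda>q. contracted S (\<lambda>_. 0) (q \<circ> \<sigma>)"
    have e: "orbit_prod ?w S \<sigma> ?a * mono_sum ?f S r id = (\<Sum>ts\<in>mono_lists S r. struct_weight ?v ?w S (\<sigma>, ts))" for r
    proof -
      have "orbit_prod ?w S \<sigma> ?a = orbit_prod ?w S \<sigma> (\<lambda>_. 1)" by (rule orbit_prod_cong_exponent[OF \<sigma>]) simp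
      moreover have "contracted S (\<lambda>_. 0) (tprod ts \<circ> id \<circ> \<sigma>) = orbit_prod ?v S (\<sigma> \<circ> tprod ts) (\<lambda>_. 1)"
        if "ts \<in> mono_lists S r" for ts
      proof -
        have t: "tprod ts permutes S" by (rule mono_lists_permutes[OF that subset_refl])
        have "contracted S (\<lambda>_. 0) (tprod ts \<circ> id \<circ> \<sigma>) = orbit_prod ?v S (tprod ts \<circ> \<sigma>) (\<lambda>_. 1)"
          using contracted_zero[OF S(1) permutes_compose[OF \<sigma> t]] by simp
        \<comment> \<open>The loop solution yields the two factors in the opposite order; the
          products are conjugate by \<open>\<sigma>\<close>, hence have the same cycle
          lengths.\<close>
        also have "\<dots> = orbit_prod ?v S (\<sigma> \<circ> tprod ts) (\<lambda>_. 1)"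
          by (rule orbit_prod_conj[OF \<sigma>, symmetric]) (simp only: o_assoc)
        finally show ?thesis .
      qed
      ultimately show ?thesis
        unfolding mono_sum_def struct_weight_def split sum_distrib_left by (intro sum.cong refl) simp
    qed
    have "summable (\<lambda>r. cmod (mono_sum ?f S r id * ?x ^ r))"
      by (rule summable_norm_mono_series[OF S(1) subset_refl permutes_id _ x, where C = C])
         (use C permutes_compose[OF \<sigma>] in blast)
    then have sm: "summable (\<lambda>r. mono_sum ?f S r id * ?x ^ r)" by (rule summable_norm_cancel)
    show "summable (\<lambda>r. (\<Sum>ts\<in>mono_lists S r. struct_weight ?v ?w S (\<sigma>, ts)) * ?x ^ r)"
      unfolding e[symmetric] mult.assoc by (rule summable_mult[OF sm])
    show "orbit_prod ?w S \<sigma> ?a * mono_series ?f S ?x id = (\<Sum>r. (\<Sum>ts\<in>mono_lists S r. struct_weight ?v ?w S (\<sigma>, ts)) * ?x ^ r)"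
      unfolding mono_series_def e[symmetric] mult.assoc by (rule suminf_mult[OF sm, symmetric])
  qed
  have "contracted S ?a id = (1 / of_nat N) ^ card S * (\<Sum>\<sigma> | \<sigma> permutes S. orbit_prod ?w S \<sigma> ?a *
      mono_series (\<lambda>q. contracted S (\<lambda>_. 0) (q \<circ> \<sigma>)) S ?x id)"
  proof (rule loop_solution[OF S, where C = C])
    show "\<forall>l. l \<notin> S \<longrightarrow> ?a l = 0" by simp
  qed (rule contracted_loop[OF S(1)], assumption+, rule C, assumption, rule subset_refl, rule permutes_id)
  also have "(\<Sum>\<sigma> | \<sigma> permutes S. orbit_prod ?w S \<sigma> ?a * mono_series (\<lambda>q. contracted S (\<lambda>_. 0) (q \<circ> \<sigma>)) S ?x id) =
     (\<Sum>\<sigma> | \<sigma> permutes S. \<Sum>r. (\<Sum>ts\<in>mono_lists S r. struct_weight ?v ?w S (\<sigma>, ts)) * ?x ^ r)"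
    by (rule sum.cong[OF refl]) (simp only: series mem_Collect_eq)
  also have "\<dots> = (\<Sum>r. \<Sum>\<sigma> | \<sigma> permutes S. (\<Sum>ts\<in>mono_lists S r. struct_weight ?v ?w S (\<sigma>, ts)) * ?x ^ r)"
    by (rule suminf_sum[symmetric]) (simp only: series mem_Collect_eq)
  also have "\<dots> = (\<Sum>r. struct_sum ?v ?w S r * ?x ^ r)"
    unfolding struct_sum_def mono_structs_def by (simp only: sum.cartesian_product' sum_distrib_right)
  finally show ?thesis unfolding contracted_one[OF S(1)] .
qed

end
end

section \<open>Cumulants and their limit\<close>

definition conn_sum where
  "conn_sum v w S r = (\<Sum>X\<in>conn_structs S r. struct_weight v w S X)"

definition struct_series where
  "struct_series v w S x = (\<Sum>r. struct_sum v w S r * x ^ r)"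

definition conn_series where
  "conn_series v w S x = (\<Sum>r. conn_sum v w S r * x ^ r)"

lemma sum_mono_structs_le:
  fixes h :: "_ \<Rightarrow> real" and c :: real
  assumes "finite S" "\<And>X. X \<in> mono_structs S r \<Longrightarrow> h X \<le> c" "c \<ge> 0"
  shows "(\<Sum>X\<in>mono_structs S r. h X) \<le> fact (card S) * real ((card S)\<^sup>2) ^ r * c"
proof -
  have "(\<Sum>X\<in>mono_structs S r. h X) \<le> of_nat (card (mono_structs S r)) * c"
    by (rule sum_bounded_above) (rule assms(2))
  also have "card (mono_structs S r) \<le> fact (card S) * ((card S)\<^sup>2) ^ r"
    unfolding mono_structs_def card_cartesian_product
    using card_mono_lists[OF assms(1), of r] by (simp add: card_permutations[OF refl assms(1)])
  then have "of_nat (card (mono_structs S r)) * c \<le> of_nat (fact (card S) * ((card S)\<^sup>2) ^ r) * c"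
    using assms(3) by (intro mult_right_mono of_nat_mono)
  finally show ?thesis by simp
qed

lemma norm_sum_struct_weight_le:
  fixes K L :: real
  assumes "finite S" "Y \<subseteq> mono_structs S r"
    and "\<And>p. p permutes S \<Longrightarrow> cmod (orbit_prod v S p (\<lambda>_. 1)) \<le> K"
    and "\<And>p. p permutes S \<Longrightarrow> cmod (orbit_prod w S p (\<lambda>_. 1)) \<le> L"
  shows "cmod (\<Sum>X\<in>Y. struct_weight v w S X) \<le> fact (card S) * real ((card S)\<^sup>2) ^ r * (K * L)"
proof -
  have KL: "K \<ge> 0" "L \<ge> 0"
    by (auto intro: order_trans[OF norm_ge_zero assms(3)[OF permutes_id]] order_trans[OF norm_ge_zero assms(4)[OF permutes_id]])
  have "cmod (\<Sum>X\<in>Y. struct_weight v w S X) \<le> (\<Sum>X\<in>Y. cmod (struct_weight v w S X))" by (rule norm_sum)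
  also have "\<dots> \<le> (\<Sum>X\<in>mono_structs S r. cmod (struct_weight v w S X))"
    by (rule sum_mono2[OF finite_mono_structs[OF assms(1)] assms(2)]) simp
  also have "\<dots> \<le> fact (card S) * real ((card S)\<^sup>2) ^ r * (K * L)"
  proof (rule sum_mono_structs_le[OF assms(1)])
    fix X assume X: "X \<in> mono_structs S r"
    obtain \<sigma> ts where e: "X = (\<sigma>, ts)" by (cases X)
    have \<sigma>: "\<sigma> permutes S" and ts: "ts \<in> mono_lists S r" using X e by (auto simp: mono_structs_def)
    have "\<sigma> \<circ> tprod ts permutes S" by (rule permutes_compose[OF mono_lists_permutes[OF ts subset_refl] \<sigma>])
    then show "cmod (struct_weight v w S X) \<le> K * L"
      unfolding e struct_weight_def split norm_mult using assms(3,4) \<sigma> KL by (intro mult_mono) auto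
  qed (use KL in simp)
  finally show ?thesis .
qed

lemma summable_norm_struct_series:
  assumes "finite S" "\<And>r. Y r \<subseteq> mono_structs S r" "cmod x * (card S)\<^sup>2 < 1"
  shows "summable (\<lambda>r. cmod ((\<Sum>X\<in>Y r. struct_weight v w S X) * x ^ r))"
proof (rule summable_comparison_test'[where N = 0])
  define K where "K = (\<lambda>u :: nat \<Rightarrow> complex. \<Sum>p | p permutes S. cmod (orbit_prod u S p (\<lambda>_. 1)))"
  have K: "cmod (orbit_prod u S p (\<lambda>_. 1)) \<le> K u" if "p permutes S" for u p
    unfolding K_def using that assms(1) by (intro member_le_sum) (auto simp: finite_permutations)
  show "summable (\<lambda>r. (fact (card S) * (K v * K w)) * ((card S)\<^sup>2 * cmod x) ^ r)"
    using assms(3) by (intro summable_mult summable_geometric) (simp add: mult.commute)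
  fix r
  show "norm (cmod ((\<Sum>X\<in>Y r. struct_weight v w S X) * x ^ r)) \<le> (fact (card S) * (K v * K w)) * ((card S)\<^sup>2 * cmod x) ^ r"
    using mult_right_mono[OF norm_sum_struct_weight_le[OF assms(1,2) K K], where c = "cmod x ^ r"]
    by (simp add: norm_mult norm_power power_mult_distrib mult_ac)
qed

text \<open>Subsets inherit the condition on \<open>x\<close>, so all series converge absolutely and
  the convolution over lengths is a Cauchy product.\<close>

lemma struct_series_decompose:
  assumes "finite S" "s \<in> S" "cmod x * (card S)\<^sup>2 < 1"
  shows "struct_series v w S x = (\<Sum>T | T \<subseteq> S \<and> s \<in> T. conn_series v w T x * struct_series v w (S - T) x)"
proof -
  have sm: "cmod x * (card T)\<^sup>2 < 1" "finite T" if "T \<subseteq> S" for T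
  proof -
    have "cmod x * (card T)\<^sup>2 \<le> cmod x * (card S)\<^sup>2"
      using card_mono[OF assms(1) that] by (intro mult_left_mono) (auto intro!: power_mono)
    then show "cmod x * (card T)\<^sup>2 < 1" using assms(3) by linarith
    show "finite T" by (rule finite_subset[OF that assms(1)])
  qed
  have s1: "summable (\<lambda>r. cmod (conn_sum v w T r * x ^ r))" if "T \<subseteq> S" for T
    unfolding conn_sum_def by (rule summable_norm_struct_series) (use sm[OF that] conn_structs_subset in auto)
  have s2: "summable (\<lambda>r. cmod (struct_sum v w T r * x ^ r))" if "T \<subseteq> S" for T
    unfolding struct_sum_def by (rule summable_norm_struct_series) (use sm[OF that] in auto)
  have prod: "conn_series v w T x * struct_series v w (S - T) x =
      (\<Sum>r. \<Sum>q\<le>r. (conn_sum v w T q * x ^ q) * (struct_sum v w (S - T) (r - q) * x ^ (r - q)))"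
    and smp: "summable (\<lambda>r. \<Sum>q\<le>r. (conn_sum v w T q * x ^ q) * (struct_sum v w (S - T) (r - q) * x ^ (r - q)))"
    if "T \<subseteq> S" for T
    unfolding conn_series_def struct_series_def
    using s1[OF that] s2[of "S - T"] by (auto intro!: Cauchy_product summable_Cauchy_product)
  have "struct_series v w S x = (\<Sum>r. \<Sum>T | T \<subseteq> S \<and> s \<in> T. \<Sum>q\<le>r. (conn_sum v w T q * x ^ q) * (struct_sum v w (S - T) (r - q) * x ^ (r - q)))"
    unfolding struct_series_def
  proof (intro arg_cong[of _ _ suminf] ext)
    fix r
    have "struct_sum v w S r * x ^ r = (\<Sum>T | T \<subseteq> S \<and> s \<in> T. \<Sum>q\<le>r. conn_sum v w T q * struct_sum v w (S - T) (r - q)) * x ^ r"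
      unfolding struct_sum_def conn_sum_def sum_struct_weight_decompose[OF assms(1,2)] ..
    also have "\<dots> = (\<Sum>T | T \<subseteq> S \<and> s \<in> T. \<Sum>q\<le>r. (conn_sum v w T q * x ^ q) * (struct_sum v w (S - T) (r - q) * x ^ (r - q)))"
      unfolding sum_distrib_right
      by (intro sum.cong refl) (simp add: mult_ac flip: power_add)
    finally show "struct_sum v w S r * x ^ r = \<dots>" .
  qed
  also have "\<dots> = (\<Sum>T | T \<subseteq> S \<and> s \<in> T. \<Sum>r. \<Sum>q\<le>r. (conn_sum v w T q * x ^ q) * (struct_sum v w (S - T) (r - q) * x ^ (r - q)))"
    by (rule suminf_sum) (use smp in auto)
  also have "\<dots> = (\<Sum>T | T \<subseteq> S \<and> s \<in> T. conn_series v w T x * struct_series v w (S - T) x)"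
    by (rule sum.cong[OF refl]) (simp add: prod)
  finally show ?thesis .
qed

lemma sum_Pow_card:
  fixes h :: "nat \<Rightarrow> complex"
  assumes "finite S"
  shows "(\<Sum>T\<in>Pow S. h (card T)) = (\<Sum>k\<le>card S. of_nat (card S choose k) * h k)"
proof -
  have "(\<Sum>T\<in>Pow S. h (card T)) = (\<Sum>k\<le>card S. \<Sum>T | T \<in> Pow S \<and> card T = k. h (card T))"
    by (rule sum.group[symmetric]) (use assms card_mono in auto)
  also have "\<dots> = (\<Sum>k\<le>card S. of_nat (card S choose k) * h k)"
    by (intro sum.cong refl) (simp add: n_subsets[OF assms])
  finally show ?thesis .
qed

text \<open>The binomials count the choices of T - {s}. They match the Leibniz coefficients in
  \<open>higher_deriv_exp_rec\<close>, which lets set decompositions be compared with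
  derivatives.\<close>

lemma sum_pointed_subsets:
  fixes h :: "nat \<Rightarrow> complex"
  assumes "finite S" "s \<in> S" "card S = Suc d"
  shows "(\<Sum>T | T \<subseteq> S \<and> s \<in> T. h (card T)) = (\<Sum>k\<le>d. of_nat (d choose k) * h (Suc k))"
proof -
  have fin: "finite (S - {s})" "card (S - {s}) = d" using assms by auto
  have "(\<Sum>T | T \<subseteq> S \<and> s \<in> T. h (card T)) = (\<Sum>T\<in>Pow (S - {s}). h (Suc (card T)))"
  proof (rule sum.reindex_bij_witness[where i = "insert s" and j = "\<lambda>T. T - {s}"])
    fix T assume T: "T \<in> {T. T \<subseteq> S \<and> s \<in> T}"
    then show "insert s (T - {s}) = T" "T - {s} \<in> Pow (S - {s})" by auto
    have "finite T" using T assms(1) finite_subset by auto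
    then have "card T = Suc (card (T - {s}))" using T by (intro card.remove) auto
    then show "h (Suc (card (T - {s}))) = h (card T)" by simp
  qed (use assms in auto)
  then show ?thesis using sum_Pow_card[OF fin(1), of "\<lambda>k. h (Suc k)"] fin by simp
qed

text \<open>The component of a fixed point plays the role of the derivative in \<open>exp(f)' = f' exp(f)\<close>;
  the recursion determines \<open>f\<close>.\<close>

lemma conn_series_eq_cumulant:
  fixes m f :: "nat \<Rightarrow> complex"
  assumes "finite S" "S \<noteq> {}" "cmod x * (card S)\<^sup>2 < 1"
    and m: "\<And>T. T \<subseteq> S \<Longrightarrow> struct_series v w T x = m (card T)" and m0: "m 0 = 1"
    and rec: "\<And>d. m (Suc d) = (\<Sum>k\<le>d. of_nat (d choose k) * (f (Suc k) * m (d - k)))"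
  shows "conn_series v w S x = f (card S)"
  using assms(1-4)
proof (induction "card S" arbitrary: S rule: less_induct)
  case less
  obtain s where s: "s \<in> S" using less.prems by auto
  obtain d where d: "card S = Suc d" using less.prems by (metis card_0_eq not0_implies_Suc)
  have IH: "conn_series v w T x = f (card T)" if T: "T \<subseteq> S" "s \<in> T" "T \<noteq> S" for T
  proof (rule less.hyps)
    show lt: "card T < card S" using T less.prems(1) by (intro psubset_card_mono) auto
    show "finite T" by (rule finite_subset[OF T(1) less.prems(1)])
    show "T \<noteq> {}" using T by auto
    have "cmod x * (card T)\<^sup>2 \<le> cmod x * (card S)\<^sup>2"
      using lt by (intro mult_left_mono) (auto intro!: power_mono)
    then show "cmod x * (card T)\<^sup>2 < 1" using less.prems(3) by linarith
    show "struct_series v w T' x = m (card T')" if "T' \<subseteq> T" for T' by (rule less.prems(4)) (use that T in auto)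
  qed
  let ?P = "{T. T \<subseteq> S \<and> s \<in> T}"
  have fin: "finite ?P" using less.prems(1) by simp
  have SP: "S \<in> ?P" using s by simp
  have cd: "card (S - T) = card S - card T" if "T \<in> ?P" for T
    using that less.prems(1) finite_subset by (intro card_Diff_subset) auto
  \<comment> \<open>Two expansions of the same moment are compared. Terms with T different from S
    agree by induction, and T = S enters with the factor m 0 = 1.\<close>
  have "m (card S) = (\<Sum>T\<in>?P. conn_series v w T x * m (card (S - T)))"
    using struct_series_decompose[OF less.prems(1) s less.prems(3), of v w] less.prems(4)
    by (simp add: less.prems(4)[OF subset_refl])
  also have "\<dots> = conn_series v w S x + (\<Sum>T\<in>?P - {S}. conn_series v w T x * m (card (S - T)))"
    by (subst sum.remove[OF fin SP]) (simp add: m0)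
  also have "(\<Sum>T\<in>?P - {S}. conn_series v w T x * m (card (S - T))) = (\<Sum>T\<in>?P - {S}. f (card T) * m (card S - card T))"
    by (intro sum.cong refl) (simp add: IH cd)
  finally have 1: "m (card S) = conn_series v w S x + (\<Sum>T\<in>?P - {S}. f (card T) * m (card S - card T))" .
  have "m (card S) = (\<Sum>k\<le>d. of_nat (d choose k) * (f (Suc k) * m (card S - Suc k)))" using rec d by simp
  also have "\<dots> = (\<Sum>T\<in>?P. f (card T) * m (card S - card T))"
    by (rule sum_pointed_subsets[OF less.prems(1) s d, symmetric])
  also have "\<dots> = f (card S) + (\<Sum>T\<in>?P - {S}. f (card T) * m (card S - card T))"
    by (subst sum.remove[OF fin SP]) (simp add: m0)
  finally show ?case using 1 by simp
qed

lemma orbit_prod_scale: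
  fixes c :: complex
  assumes "finite S"
  shows "orbit_prod (\<lambda>k. c * v k) S p a = c ^ card (orbit p ` S) * orbit_prod v S p a"
  using assms by (simp add: orbit_prod_def prod.distrib)

lemma struct_weight_scale:
  fixes c :: complex
  assumes "finite S"
  shows "struct_weight (\<lambda>k. c * v k) (\<lambda>k. c * w k) S (\<sigma>, ts) =
    c ^ (card (orbit (\<sigma> \<circ> tprod ts) ` S) + card (orbit \<sigma> ` S)) * struct_weight v w S (\<sigma>, ts)"
  by (simp only: struct_weight_def split orbit_prod_scale[OF assms] power_add mult_ac)

text \<open>The level sets of the labelling are closed, so connectedness leaves a single label and
  the bound of \<open>genus_labelling\<close> becomes r + 2.\<close>

lemma connected_genus_bound:
  assumes "finite S" "S \<noteq> {}" "(\<sigma>, ts) \<in> conn_structs S r"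
  shows "card (orbit (\<sigma> \<circ> tprod ts) ` S) + card (orbit \<sigma> ` S) \<le> r + 2"
proof -
  have \<sigma>: "\<sigma> permutes S" and ts: "\<forall>(s, t)\<in>set ts. s \<in> S \<and> t \<in> S \<and> s < t" and len: "length ts = r"
    and con: "connected_on S \<sigma> ts"
    using assms(3) by (auto simp: conn_structs_def mono_structs_def mono_lists_def)
  obtain L :: "nat \<Rightarrow> nat set" where L: "\<forall>x. L (\<sigma> x) = L x" "\<forall>(s, t)\<in>set ts. L s = L t"
     "card (orbit (\<sigma> \<circ> tprod ts) ` S) + card (orbit \<sigma> ` S) \<le> length ts + 2 * card (L ` S)"
    by atomize_elim (rule genus_labelling[OF assms(1) \<sigma> ts])
  obtain s where s: "s \<in> S" using assms(2) by auto
  define T where "T = {y \<in> S. L y = L s}"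
  have "closed_under \<sigma> ts T"
    unfolding closed_under_def
  proof
    show "\<sigma> ` T \<subseteq> T" using L(1) permutes_in_image[OF \<sigma>] by (auto simp: T_def)
    show "\<forall>(u, t)\<in>set ts. (u \<in> T) = (t \<in> T)"
    proof (rule ballI, clarify)
      fix u t assume ut: "(u, t) \<in> set ts"
      then have "L u = L t" "u \<in> S" "t \<in> S" using L(2) ts by auto
      then show "(u \<in> T) = (t \<in> T)" by (simp add: T_def)
    qed
  qed
  moreover have "T \<subseteq> S" "T \<noteq> {}" using s by (auto simp: T_def)
  ultimately have TS: "T = S" using con unfolding connected_on_def by simp
  have Ls: "L y = L s" if "y \<in> S" for y using that unfolding TS[symmetric] by (simp add: T_def)
  have "L ` S = (\<lambda>_. L s) ` S" by (rule image_cong[OF refl Ls])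
  also have "\<dots> = {L s}" by (rule image_constant[OF s])
  finally have "L ` S = {L s}" .
  then show ?thesis using L(3) len by simp
qed

text \<open>Equality in \<open>connected_genus_bound\<close>, that is, genus zero.\<close>

definition planar_structs where
  "planar_structs S r = {(\<sigma>, ts) \<in> conn_structs S r. card (orbit (\<sigma> \<circ> tprod ts) ` S) + card (orbit \<sigma> ` S) = r + 2}"

lemma tendsto_orbit_prod:
  fixes v :: "'b \<Rightarrow> nat \<Rightarrow> complex"
  assumes "\<And>k. k \<ge> 1 \<Longrightarrow> ((\<lambda>n. v n k) \<longlongrightarrow> u k) F" "finite S" "p permutes S"
  shows "((\<lambda>n. orbit_prod (v n) S p (\<lambda>_. 1)) \<longlongrightarrow> orbit_prod u S p (\<lambda>_. 1)) F"
  unfolding orbit_prod_def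
proof (rule tendsto_prod)
  fix C assume "C \<in> orbit p ` S"
  then obtain x where x: "x \<in> S" "C = orbit p x" by auto
  have "finite C" using permutes_orbit_subset[OF assms(3) x(1)] assms(2) x(2) finite_subset by auto
  moreover have "x \<in> C" using permutes_self_in_orbit[OF assms(2,3)] x by simp
  \<comment> \<open>Cycles are nonempty; this matters because the limits are given only for k at
    least 1.\<close>
  ultimately have "card C \<ge> 1" using card_0_eq[of C] by (cases "card C") auto
  then show "((\<lambda>n. v n (\<Sum>l\<in>C. 1)) \<longlongrightarrow> u (\<Sum>l\<in>C. 1)) F" using assms(1) by simp
qed

lemma tendsto_struct_weight:
  fixes v w :: "'b \<Rightarrow> nat \<Rightarrow> complex"
  assumes "\<And>k. k \<ge> 1 \<Longrightarrow> ((\<lambda>n. v n k) \<longlongrightarrow> v' k) F" "\<And>k. k \<ge> 1 \<Longrightarrow> ((\<lambda>n. w n k) \<longlongrightarrow> w' k) F"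
    and "finite S" "(\<sigma>, ts) \<in> mono_structs S r"
  shows "((\<lambda>n. struct_weight (v n) (w n) S (\<sigma>, ts)) \<longlongrightarrow> struct_weight v' w' S (\<sigma>, ts)) F"
proof -
  have \<sigma>: "\<sigma> permutes S" and ts: "ts \<in> mono_lists S r" using assms(4) by (auto simp: mono_structs_def)
  have st: "\<sigma> \<circ> tprod ts permutes S" by (rule permutes_compose[OF mono_lists_permutes[OF ts subset_refl] \<sigma>])
  show ?thesis unfolding struct_weight_def split
    by (intro tendsto_mult tendsto_orbit_prod assms(1,2,3) \<sigma> st)
qed

lemma orbit_prod_bounded:
  fixes v :: "nat \<Rightarrow> nat \<Rightarrow> complex"
  assumes "\<And>k. k \<ge> 1 \<Longrightarrow> (\<lambda>n. v n k) \<longlonglongrightarrow> u k" "finite S"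
  obtains K where "\<And>n p. p permutes S \<Longrightarrow> cmod (orbit_prod (v n) S p (\<lambda>_. 1)) \<le> K"
proof -
  have "(\<lambda>n. \<Sum>p | p permutes S. cmod (orbit_prod (v n) S p (\<lambda>_. 1))) \<longlonglongrightarrow> (\<Sum>p | p permutes S. cmod (orbit_prod u S p (\<lambda>_. 1)))"
    by (intro tendsto_sum tendsto_norm tendsto_orbit_prod assms) simp_all
  then have "Bseq (\<lambda>n. \<Sum>p | p permutes S. cmod (orbit_prod (v n) S p (\<lambda>_. 1)))"
    using convergent_imp_Bseq convergentI by blast
  then obtain K where K: "\<And>n. norm (\<Sum>p | p permutes S. cmod (orbit_prod (v n) S p (\<lambda>_. 1))) \<le> K"
    unfolding Bseq_def by blast
  have "cmod (orbit_prod (v n) S p (\<lambda>_. 1)) \<le> K" if "p permutes S" for n p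
  proof -
    have "cmod (orbit_prod (v n) S p (\<lambda>_. 1)) \<le> (\<Sum>p | p permutes S. cmod (orbit_prod (v n) S p (\<lambda>_. 1)))"
      using that assms(2) by (intro member_le_sum) (auto simp: finite_permutations)
    also have "\<dots> \<le> K" using K[of n] by simp
    finally show ?thesis .
  qed
  then show ?thesis by (rule that)
qed

text \<open>By the genus bound every power of \<open>n\<close> that occurs is nonpositive; the limit is taken termwise by
  Tannery's theorem.\<close>

lemma conn_series_genus_limit:
  fixes v w :: "nat \<Rightarrow> nat \<Rightarrow> complex"
  assumes v: "\<And>k. k \<ge> 1 \<Longrightarrow> (\<lambda>n. v n k) \<longlonglongrightarrow> v' k" and w: "\<And>k. k \<ge> 1 \<Longrightarrow> (\<lambda>n. w n k) \<longlonglongrightarrow> w' k"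
    and S: "finite S" "S \<noteq> {}"
  shows "(\<lambda>n. conn_series (\<lambda>k. of_nat n * v n k) (\<lambda>k. of_nat n * w n k) S (- 1 / of_nat n) / (of_nat n)\<^sup>2)
    \<longlonglongrightarrow> (\<Sum>r. \<Sum>X\<in>planar_structs S r. (-1) ^ r * struct_weight v' w' S X)"
proof -
  define c where "c = (\<lambda>(\<sigma>, ts). card (orbit (\<sigma> \<circ> tprod ts) ` S) + card (orbit \<sigma> ` S))"
  \<comment> \<open>Scaling gives n^(c X), the series n^(-r), and the division n^(-2); the total
    exponent r + 2 - c X of 1/n is a natural number by the genus bound.\<close>
  define a where "a = (\<lambda>r n. \<Sum>X\<in>conn_structs S r. (-1) ^ r * struct_weight (v n) (w n) S X * (1 / of_nat n) ^ (r + 2 - c X))"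
  let ?d = "card S"
  have finc: "finite (conn_structs S r)" for r
    by (rule finite_subset[OF conn_structs_subset finite_mono_structs[OF S(1)]])
  have cle: "c X \<le> r + 2" if "X \<in> conn_structs S r" for X r
    using connected_genus_bound[OF S, of "fst X" "snd X" r] that by (simp add: c_def case_prod_unfold)
  have cd: "c X \<le> 2 * ?d" for X
    using card_image_le[OF S(1), of "orbit (fst X \<circ> tprod (snd X))"] card_image_le[OF S(1), of "orbit (fst X)"]
    by (simp add: c_def case_prod_unfold)
  have eq: "conn_series (\<lambda>k. of_nat n * v n k) (\<lambda>k. of_nat n * w n k) S (- 1 / of_nat n) / (of_nat n)\<^sup>2 = (\<Sum>r. a r n)"
    if n: "n \<ge> 1" and n2: "2 * ?d\<^sup>2 \<le> n" for n
  proof -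
    have n0: "of_nat n \<noteq> (0 :: complex)" using n by simp
    have lt: "cmod (- 1 / of_nat n) * (card S)\<^sup>2 < 1"
    proof -
      have "?d \<ge> 1" using S by (simp add: Suc_le_eq card_gt_0_iff)
      then have "?d\<^sup>2 \<ge> 1" by simp
      then have "?d\<^sup>2 < n" using n2 by linarith
      then show ?thesis using n by (simp add: norm_divide field_simps flip: of_nat_power)
    qed
    have coeff: "conn_sum (\<lambda>k. of_nat n * v n k) (\<lambda>k. of_nat n * w n k) S r * (- 1 / of_nat n) ^ r / (of_nat n)\<^sup>2 = a r n" for r
    proof -
      have "struct_weight (\<lambda>k. of_nat n * v n k) (\<lambda>k. of_nat n * w n k) S X * (- 1 / of_nat n) ^ r / (of_nat n)\<^sup>2 =
          (-1) ^ r * struct_weight (v n) (w n) S X * (1 / of_nat n) ^ (r + 2 - c X)" if X: "X \<in> conn_structs S r" for X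
      proof -
        obtain \<sigma> ts where e: "X = (\<sigma>, ts)" by (cases X)
        have "struct_weight (\<lambda>k. of_nat n * v n k) (\<lambda>k. of_nat n * w n k) S X = of_nat n ^ c X * struct_weight (v n) (w n) S X"
          unfolding e c_def split by (rule struct_weight_scale[OF S(1)])
        moreover have "of_nat n ^ (r + 2) = of_nat n ^ c X * (of_nat n :: complex) ^ (r + 2 - c X)"
          using cle[OF X] by (simp flip: power_add)
        moreover have "(- 1 / of_nat n) ^ r / (of_nat n :: complex)\<^sup>2 = (-1) ^ r / of_nat n ^ (r + 2)"
          by (simp only: power_divide divide_divide_eq_left power_add)
        ultimately show ?thesis using n0 by (simp add: power_divide field_simps)
      qed
      then show ?thesis unfolding conn_sum_def a_def sum_distrib_right sum_divide_distrib by (intro sum.cong refl) auto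
    qed
    have "summable (\<lambda>r. cmod (conn_sum (\<lambda>k. of_nat n * v n k) (\<lambda>k. of_nat n * w n k) S r * (- 1 / of_nat n) ^ r))"
      unfolding conn_sum_def by (rule summable_norm_struct_series[OF S(1) conn_structs_subset lt])
    then have "summable (\<lambda>r. conn_sum (\<lambda>k. of_nat n * v n k) (\<lambda>k. of_nat n * w n k) S r * (- 1 / of_nat n) ^ r)"
      by (rule summable_norm_cancel)
    from suminf_divide[OF this, of "(of_nat n)\<^sup>2"] show ?thesis unfolding conn_series_def coeff by simp
  qed
  obtain K where K: "\<And>n p. p permutes S \<Longrightarrow> cmod (orbit_prod (v n) S p (\<lambda>_. 1)) \<le> K"
    using orbit_prod_bounded[of v v' S, OF v S(1)] by metis
  obtain L where L: "\<And>n p. p permutes S \<Longrightarrow> cmod (orbit_prod (w n) S p (\<lambda>_. 1)) \<le> L"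
    using orbit_prod_bounded[of w w' S, OF w S(1)] by metis
  have KL: "K \<ge> 0" "L \<ge> 0"
    by (auto intro: order_trans[OF norm_ge_zero K[OF permutes_id]] order_trans[OF norm_ge_zero L[OF permutes_id]])
  \<comment> \<open>As c X is at most 2d, at least r - 2d factors 1/n are available, and for n at
    least 2 d^2 each turns a factor d^2 into at most 1/2. The constants pay for the first 2d factors
    d^2 and for the shift of the geometric series.\<close>
  define M where "M = (\<lambda>r. fact ?d * (K * L) * real (?d\<^sup>2) ^ (2 * ?d) * 2 ^ (2 * ?d) * (1 / 2) ^ r)"
  have bound: "cmod (a r n) \<le> M r" if n: "n \<ge> 1" "2 * ?d\<^sup>2 \<le> n" for r n
  proof -
    have d1: "real (?d\<^sup>2) \<ge> 1"
    proof -
      have "?d \<ge> 1" using S by (simp add: Suc_le_eq card_gt_0_iff)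
      then show ?thesis by simp
    qed
    let ?q = "(1 / real n) ^ (r - 2 * ?d)"
    have "cmod (a r n) \<le> (\<Sum>X\<in>conn_structs S r. cmod ((-1) ^ r * struct_weight (v n) (w n) S X * (1 / of_nat n) ^ (r + 2 - c X)))"
      unfolding a_def by (rule norm_sum)
    \<comment> \<open>Off the connected structures the subtraction in the exponent may be truncated
      at 0, where the bound by \<open>?q\<close> still holds.\<close>
    also have "\<dots> \<le> (\<Sum>X\<in>mono_structs S r. cmod ((-1) ^ r * struct_weight (v n) (w n) S X * (1 / of_nat n) ^ (r + 2 - c X)))"
      by (rule sum_mono2[OF finite_mono_structs[OF S(1)] conn_structs_subset]) simp
    also have "\<dots> \<le> fact ?d * real (?d\<^sup>2) ^ r * ((K * L) * ?q)"
    proof (rule sum_mono_structs_le[OF S(1)])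
      fix X assume X: "X \<in> mono_structs S r"
      obtain \<sigma> ts where e: "X = (\<sigma>, ts)" by (cases X)
      have \<sigma>: "\<sigma> permutes S" and ts: "ts \<in> mono_lists S r" using X e by (auto simp: mono_structs_def)
      have st: "\<sigma> \<circ> tprod ts permutes S" by (rule permutes_compose[OF mono_lists_permutes[OF ts subset_refl] \<sigma>])
      have 1: "cmod (struct_weight (v n) (w n) S X) \<le> K * L"
        unfolding e struct_weight_def split norm_mult using K[OF st] L[OF \<sigma>] KL by (intro mult_mono) auto
      have 2: "(1 / real n) ^ (r + 2 - c X) \<le> ?q"
        using cd[of X] n by (intro power_decreasing) (auto simp: c_def)
      have "cmod ((-1) ^ r * struct_weight (v n) (w n) S X * (1 / of_nat n) ^ (r + 2 - c X)) =
          cmod (struct_weight (v n) (w n) S X) * (1 / real n) ^ (r + 2 - c X)"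
        by (simp add: norm_mult norm_power norm_divide)
      also have "\<dots> \<le> (K * L) * ?q" using 1 2 KL by (intro mult_mono) auto
      finally show "cmod ((-1) ^ r * struct_weight (v n) (w n) S X * (1 / of_nat n) ^ (r + 2 - c X)) \<le> (K * L) * ?q" .
    qed (use KL in simp)
    also have "\<dots> = fact ?d * (K * L) * (real (?d\<^sup>2) ^ r * ?q)" by (simp add: mult_ac)
    also have "real (?d\<^sup>2) ^ r * ?q \<le> real (?d\<^sup>2) ^ (2 * ?d) * 2 ^ (2 * ?d) * (1 / 2) ^ r"
    proof (cases "r \<ge> 2 * ?d")
      case True
      then obtain e where e: "r = 2 * ?d + e" by (auto simp: le_iff_add)
      have "real (?d\<^sup>2) * (1 / real n) \<le> 1 / 2"
      proof -
        have "2 * real (?d\<^sup>2) \<le> real n" using n(2) by (metis of_nat_mono of_nat_mult of_nat_numeral)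
        then show ?thesis using n by (simp add: field_simps)
      qed
      then have "(real (?d\<^sup>2) * (1 / real n)) ^ e \<le> (1 / 2) ^ e" by (intro power_mono) auto
      then have "real (?d\<^sup>2) ^ (2 * ?d) * (real (?d\<^sup>2) * (1 / real n)) ^ e \<le> real (?d\<^sup>2) ^ (2 * ?d) * (1 / 2) ^ e"
        by (intro mult_left_mono) auto
      then show ?thesis by (simp add: e power_add power_mult_distrib mult_ac power_one_over power_divide)
    next
      case False
      then have "real (?d\<^sup>2) ^ r \<le> real (?d\<^sup>2) ^ (2 * ?d)" using d1 by (intro power_increasing) auto
      moreover have "(1::real) \<le> 2 ^ (2 * ?d) * (1 / 2) ^ r"
      proof -
        have "(2::real) ^ r \<le> 2 ^ (2 * ?d)" using False by (intro power_increasing) auto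
        then show ?thesis by (simp add: power_divide field_simps)
      qed
      ultimately have "real (?d\<^sup>2) ^ r * 1 \<le> real (?d\<^sup>2) ^ (2 * ?d) * (2 ^ (2 * ?d) * (1 / 2) ^ r)"
        by (intro mult_mono) auto
      then show ?thesis using False by (simp add: mult_ac)
    qed
    then have "fact ?d * (K * L) * (real (?d\<^sup>2) ^ r * ?q) \<le> M r"
      unfolding M_def using mult_left_mono[of "real (?d\<^sup>2) ^ r * ?q" _ "fact ?d * (K * L)"] KL by (simp add: mult.assoc)
    finally show ?thesis by simp
  qed
  have smM: "summable M" unfolding M_def by (intro summable_mult summable_geometric) simp
  have lim: "(\<lambda>n. a r n) \<longlonglongrightarrow> (\<Sum>X\<in>planar_structs S r. (-1) ^ r * struct_weight v' w' S X)" for r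
  proof -
    have pl: "planar_structs S r = {X \<in> conn_structs S r. c X = r + 2}"
      by (auto simp: planar_structs_def c_def)
    have "(\<lambda>n. a r n) \<longlonglongrightarrow> (\<Sum>X\<in>conn_structs S r. (-1) ^ r * struct_weight v' w' S X * (if c X = r + 2 then 1 else 0))"
      unfolding a_def
    proof (intro tendsto_sum tendsto_mult tendsto_const)
      fix X assume X: "X \<in> conn_structs S r"
      obtain \<sigma> ts where e: "X = (\<sigma>, ts)" by (cases X)
      have Xm: "(\<sigma>, ts) \<in> mono_structs S r" using X e conn_structs_subset by blast
      show "(\<lambda>n. struct_weight (v n) (w n) S X) \<longlonglongrightarrow> struct_weight v' w' S X"
        unfolding e by (rule tendsto_struct_weight[OF v w S(1) Xm])
      show "(\<lambda>n. (1 / of_nat n) ^ (r + 2 - c X)) \<longlonglongrightarrow> (if c X = r + 2 then 1 else 0 :: complex)"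
      proof (cases "c X = r + 2")
        case False
        then have "r + 2 - c X \<noteq> 0" using cle[OF X] by simp
        then show ?thesis using False tendsto_power[OF lim_1_over_n, of "r + 2 - c X"] by (simp add: zero_power)
      qed simp
    qed
    also have "(\<Sum>X\<in>conn_structs S r. (-1) ^ r * struct_weight v' w' S X * (if c X = r + 2 then 1 else 0)) =
       (\<Sum>X\<in>planar_structs S r. (-1) ^ r * struct_weight v' w' S X)"
      unfolding pl by (subst sum.inter_filter[OF finc]) (intro sum.cong, auto)
    finally show ?thesis .
  qed
  have ev: "\<forall>\<^sub>F n in sequentially. n \<ge> 1 \<and> 2 * ?d\<^sup>2 \<le> n"
    by (intro eventually_conj eventually_ge_at_top)
  have "\<forall>\<^sub>F (r, n) in at_top \<times>\<^sub>F sequentially. norm (a r n) \<le> M r"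
    unfolding eventually_prod_filter
    by (intro exI[of _ "\<lambda>_. True"] exI[of _ "\<lambda>n. n \<ge> 1 \<and> 2 * ?d\<^sup>2 \<le> n"]) (use ev bound in auto)
  from tannerys_theorem[OF lim this smM]
  have "(\<lambda>n. \<Sum>r. a r n) \<longlonglongrightarrow> (\<Sum>r. \<Sum>X\<in>planar_structs S r. (-1) ^ r * struct_weight v' w' S X)" by simp
  then show ?thesis
    by (rule Lim_transform_eventually) (rule eventually_mono[OF ev], rule eq[symmetric], auto)
qed

section \<open>Genus zero monotone Hurwitz numbers\<close>

lemma finite_int_partitions: "finite (int_partitions d)"
proof (rule finite_subset)
  show "finite (mset ` {xs. set xs \<subseteq> {..d} \<and> length xs \<le> d})"
    by (intro finite_imageI finite_lists_length_le) simp
  show "int_partitions d \<subseteq> mset ` {xs. set xs \<subseteq> {..d} \<and> length xs \<le> d}"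
  proof
    fix \<alpha> assume a: "\<alpha> \<in> int_partitions d"
    obtain xs where xs: "\<alpha> = mset xs" by (metis ex_mset)
    have sum: "sum_list xs = d" and nz: "0 \<notin> set xs" using a xs by (auto simp: int_partitions_def sum_mset_sum_list)
    have "set xs \<subseteq> {..d}" using sum member_le_sum_list by fastforce
    moreover have "length xs \<le> d"
    proof -
      have "length xs \<le> sum_list xs" using nz by (induction xs) (auto simp: Suc_le_eq)
      then show ?thesis using sum by simp
    qed
    ultimately show "\<alpha> \<in> mset ` {xs. set xs \<subseteq> {..d} \<and> length xs \<le> d}" using xs by auto
  qed
qed

lemma perm_cycle_type_partition:
  assumes "p permutes {1..d}"
  shows "perm_cycle_type d p \<in> int_partitions d"
proof -
  let ?S = "{1..d}"
  have self: "x \<in> orbit p x" for x by (rule permutes_self_in_orbit[OF _ assms]) simp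
  have sub: "C \<subseteq> ?S" if "C \<in> orbit p ` ?S" for C
    using that by (elim imageE) (simp only: permutes_orbit_subset[OF assms])
  have fin: "finite C" if "C \<in> orbit p ` ?S" for C using sub[OF that] finite_subset by blast
  have "pairwise disjnt (orbit p ` ?S)"
  proof (rule pairwiseI)
    fix C D assume "C \<in> orbit p ` ?S" "D \<in> orbit p ` ?S" "C \<noteq> D"
    then obtain x y where xy: "C = orbit p x" "D = orbit p y" by auto
    have eq: "orbit p z = orbit p x" if "z \<in> orbit p x" for x z by (rule permutes_orbit_eq[OF _ assms that]) simp
    have "z \<notin> D" if "z \<in> C" for z using eq[of z x] eq[of z y] that xy \<open>C \<noteq> D\<close> by metis
    then show "disjnt C D" by (auto simp: disjnt_def)
  qed
  then have "(\<Sum>C\<in>orbit p ` ?S. card C) = card (\<Union> (orbit p ` ?S))"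
    using fin by (intro card_Union_disjoint[symmetric])
  also have "\<Union> (orbit p ` ?S) = ?S"
  proof
    show "\<Union> (orbit p ` ?S) \<subseteq> ?S" using sub by (intro Union_least)
    show "?S \<subseteq> \<Union> (orbit p ` ?S)" using self by (intro subsetI) (rule UnionI[OF imageI], assumption, rule self)
  qed
  finally have "(\<Sum>C\<in>orbit p ` ?S. card C) = d" by simp
  then have "sum_mset (perm_cycle_type d p) = d" by (simp add: perm_cycle_type_def sum_unfold_sum_mset)
  moreover have "card C \<noteq> 0" if C: "C \<in> orbit p ` ?S" for C
  proof -
    obtain x where "C = orbit p x" using C by auto
    then have "x \<in> C" using self by simp
    then show ?thesis using fin[OF C] by auto
  qed
  then have "0 \<notin> card ` (orbit p ` ?S)" by (metis (no_types, lifting) imageE)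
  then have "0 \<notin># perm_cycle_type d p" unfolding perm_cycle_type_def by simp
  ultimately show ?thesis by (simp add: int_partitions_def)
qed

lemma size_perm_cycle_type: "size (perm_cycle_type d p) = card (orbit p ` {1..d})"
  by (simp add: perm_cycle_type_def)

lemma moment_prod_cycle_type: "moment_prod \<phi> (perm_cycle_type d p) = orbit_prod \<phi> {1..d} p (\<lambda>_. 1)"
  by (simp add: moment_prod_def perm_cycle_type_def orbit_prod_def prod_unfold_prod_mset image_mset.compositionality o_def)

text \<open>A set invariant under \<open>\<sigma>\<close> and the transpositions is invariant under
  \<open>\<rho>\<close>, the inverse of their product, hence under the whole group. Conversely the
  orbit of a point is closed, so connectedness makes it everything.\<close>

lemma transitive_iff_connected_on:
  assumes \<sigma>: "\<sigma> permutes {1..d}" and ts: "\<forall>(s, t)\<in>set ts. s \<in> {1..d} \<and> t \<in> {1..d} \<and> s < t"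
    and \<rho>: "\<rho> permutes {1..d}" "\<rho> \<circ> (\<sigma> \<circ> tprod ts) = id" and d: "d \<ge> 1"
  shows "(\<forall>x\<in>{1..d}. \<forall>y\<in>{1..d}. \<exists>g\<in>generate (sym_group d) ({\<rho>, \<sigma>} \<union> set (transps ts)). g x = y) \<longleftrightarrow>
    connected_on {1..d} \<sigma> ts"
proof -
  let ?S = "{1..d}" and ?G = "sym_group d"
  let ?H = "{\<rho>, \<sigma>} \<union> set (transps ts)"
  have tr: "set (transps ts) = (\<lambda>(s, t). Transposition.transpose s t) ` set ts" by (simp add: transps_def)
  have tp: "h permutes ?S" if "h \<in> set (transps ts)" for h
    using that ts unfolding tr by (auto intro!: permutes_swap_id)
  have HG: "?H \<subseteq> carrier ?G" using \<sigma> \<rho>(1) tp by (auto simp: sym_group_carrier)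
  have gp: "g permutes ?S" if "g \<in> generate ?G ?H" for g
    using group.generate_in_carrier[OF sym_group_is_group HG that] by (simp add: sym_group_carrier)
  show ?thesis
  proof
    assume trans: "\<forall>x\<in>?S. \<forall>y\<in>?S. \<exists>g\<in>generate ?G ?H. g x = y"
    show "connected_on ?S \<sigma> ts"
      unfolding connected_on_def
    proof (intro allI impI)
      fix T assume T: "T \<subseteq> ?S" "T \<noteq> {}" and cl: "closed_under \<sigma> ts T"
      have "finite T" using T(1) finite_subset by blast
      then have img: "\<sigma> ` T = T"
        using cl permutes_inj_on[OF \<sigma>, of T] by (simp add: closed_under_def endo_inj_surj)
      have i\<sigma>: "\<sigma> x \<in> T \<longleftrightarrow> x \<in> T" for x
        using inj_image_mem_iff[OF permutes_inj[OF \<sigma>], of x T] img by simp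
      have it: "(Transposition.transpose s t x \<in> T) = (x \<in> T)" if "(s, t) \<in> set ts" for s t x
        using cl that by (auto simp: closed_under_def Transposition.transpose_def)
      have itp: "(tprod ts x \<in> T) = (x \<in> T)" for x
        using tprod_invariant[of ts "\<lambda>x. x \<in> T" x] cl by (simp add: closed_under_def)
      have \<rho>2: "(\<sigma> \<circ> tprod ts) (\<rho> x) = x" for x
      proof -
        have "tprod ts permutes ?S" by (rule tprod_permutes) (use ts in auto)
        then have "bij (\<sigma> \<circ> tprod ts)" using permutes_compose[OF _ \<sigma>] permutes_bij by blast
        then obtain y where "x = (\<sigma> \<circ> tprod ts) y" by (metis bij_pointE)
        moreover have "\<rho> ((\<sigma> \<circ> tprod ts) y) = y" using \<rho>(2) by (metis comp_apply id_apply)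
        ultimately show ?thesis by simp
      qed
      have i\<rho>: "\<rho> x \<in> T \<longleftrightarrow> x \<in> T" for x
        using \<rho>2[of x] i\<sigma>[of "tprod ts (\<rho> x)"] itp[of "\<rho> x"] by simp
      have iH: "(h x \<in> T) = (x \<in> T)" if "h \<in> ?H" for h x
        using that i\<rho> i\<sigma> it unfolding tr by auto
      have inv: "\<forall>x. (g x \<in> T) = (x \<in> T)" if "g \<in> generate ?G ?H" for g
        using that
      proof (induction rule: generate.induct)
        case one
        then show ?case by (simp add: sym_group_one)
      next
        case (incl h)
        then show ?case using iH by blast
      next
        case (inv h)
        have hc: "h \<in> carrier ?G" using inv HG by blast
        then have hp: "h permutes ?S" by (simp add: sym_group_carrier)
        have "h (inv_into UNIV h x) = x" for x using permutes_inverses(1)[OF hp] .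
        then show ?case unfolding sym_group_inv_equality[OF hc] using iH[OF inv] by metis
      next
        case (eng h1 h2)
        then show ?case by (simp add: sym_group_mult)
      qed
      obtain x where x: "x \<in> T" using T by auto
      show "T = ?S"
      proof
        show "?S \<subseteq> T"
        proof
          fix y assume "y \<in> ?S"
          then obtain g where "g \<in> generate ?G ?H" "g x = y" using trans x T(1) by blast
          then show "y \<in> T" using inv x by blast
        qed
      qed (rule T)
    qed
  next
    assume con: "connected_on ?S \<sigma> ts"
    show "\<forall>x\<in>?S. \<forall>y\<in>?S. \<exists>g\<in>generate ?G ?H. g x = y"
    proof (intro ballI)
      fix x y assume xy: "x \<in> ?S" "y \<in> ?S"
      define T where "T = (\<lambda>g. g x) ` generate ?G ?H"
      have step: "h z \<in> T" if h: "h \<in> ?H" and z: "z \<in> T" for h z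
      proof -
        obtain g where g: "g \<in> generate ?G ?H" "z = g x" using z unfolding T_def by auto
        have "h \<otimes>\<^bsub>?G\<^esub> g \<in> generate ?G ?H" by (rule generate.eng[OF generate.incl[OF h] g(1)])
        then have "h \<circ> g \<in> generate ?G ?H" by (simp add: sym_group_mult)
        then show ?thesis unfolding T_def g(2) by (rule rev_image_eqI) simp
      qed
      have "closed_under \<sigma> ts T"
        unfolding closed_under_def
      proof
        show "\<sigma> ` T \<subseteq> T" using step[of \<sigma>] by auto
        show "\<forall>(s, t)\<in>set ts. (s \<in> T) = (t \<in> T)"
        proof (rule ballI, clarify)
          fix s t assume st: "(s, t) \<in> set ts"
          then have "Transposition.transpose s t \<in> ?H" unfolding tr by force
          from step[OF this, of s] step[OF this, of t] show "(s \<in> T) = (t \<in> T)" by auto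
        qed
      qed
      moreover have "T \<subseteq> ?S"
        unfolding T_def by (rule image_subsetI) (simp only: permutes_in_image[OF gp] xy(1))
      moreover have "T \<noteq> {}" unfolding T_def using generate.one by auto
      ultimately have "T = ?S" using con unfolding connected_on_def by blast
      then have "y \<in> T" using xy(2) by simp
      then show "\<exists>g\<in>generate ?G ?H. g x = y" unfolding T_def by auto
    qed
  qed
qed

text \<open>As \<open>\<rho>\<close> is determined by \<open>\<sigma>\<close> and \<open>ts\<close>,
  forgetting it is a bijection from the counted tuples to the planar structures, and the double sum
  over partitions merely groups them by cycle type. The signs agree because r + 2 is the total
  number of cycles.\<close>

theorem hciz_coeff_0_eq_planar:
  assumes d: "d \<ge> 1"
  shows "hciz_coeff_0 d \<phi> \<psi> =
    (-1) ^ d * (\<Sum>r. \<Sum>X\<in>planar_structs {1..d} r. (-1) ^ r * struct_weight \<phi> \<psi> {1..d} X)"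
proof -
  let ?S = "{1..d}"
  let ?c = "\<lambda>p. card (orbit p ` ?S)"
  have fS: "finite ?S" by simp
  have c1: "?c p \<ge> 1" for p using d by (simp add: Suc_le_eq card_gt_0_iff)
  have cd: "?c p \<le> d" for p using card_image_le[of ?S "orbit p"] by simp
  define P where "P = (\<Union>r\<le>2 * d. planar_structs ?S r)"
  \<comment> \<open>The counted tuples for all pairs of cycle types at once. The length is stated
    additively, so that no truncated subtraction appears.\<close>
  define H where "H = {(\<rho>, \<sigma>, ts). \<rho> permutes ?S \<and> \<sigma> permutes ?S \<and> length ts + 2 = ?c \<rho> + ?c \<sigma> \<and>
     (\<forall>(s, t)\<in>set ts. 1 \<le> s \<and> s < t \<and> t \<le> d) \<and>
     \<rho> \<circ> \<sigma> \<circ> foldr (\<circ>) (transps ts) id = id \<and>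
     (\<forall>x\<in>?S. \<forall>y\<in>?S. \<exists>g\<in>generate (sym_group d) ({\<rho>, \<sigma>} \<union> set (transps ts)). g x = y) \<and>
     sorted (map snd ts)}"
  define f where "f = (\<lambda>(\<rho> :: nat \<Rightarrow> nat, \<sigma> :: nat \<Rightarrow> nat, ts :: (nat \<times> nat) list). perm_cycle_type d \<rho>)"
  define g where "g = (\<lambda>(\<rho> :: nat \<Rightarrow> nat, \<sigma> :: nat \<Rightarrow> nat, ts :: (nat \<times> nat) list). perm_cycle_type d \<sigma>)"
  define tm where "tm = (\<lambda>\<alpha> \<beta>. (-1) ^ (d + size \<alpha> + size \<beta>) * moment_prod \<phi> \<alpha> * moment_prod \<psi> \<beta>)"
  define i where "i = (\<lambda>(\<sigma> :: nat \<Rightarrow> nat, ts :: (nat \<times> nat) list). (inv_into UNIV (\<sigma> \<circ> tprod ts), \<sigma>, ts))"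
  have planar_len: "length ts = r" if "(\<sigma>, ts) \<in> planar_structs ?S r" for \<sigma> ts r
    using that by (auto simp: planar_structs_def conn_structs_def mono_structs_def mono_lists_def)
  have planar_le: "r \<le> 2 * d" if "X \<in> planar_structs ?S r" for X r
    \<comment> \<open>Two permutations have at most 2d cycles together; hence the series over r is a
      finite sum.\<close>
    using that cd[of "fst X \<circ> tprod (snd X)"] cd[of "fst X"] by (auto simp: planar_structs_def)
  have finpl: "finite (planar_structs ?S r)" for r
    by (rule finite_subset[OF _ finite_mono_structs[OF fS, of r]]) (auto simp: planar_structs_def conn_structs_def)
  have finP: "finite P" unfolding P_def using finpl by auto
  have ts_iff: "(\<forall>(s, t)\<in>set ts. 1 \<le> s \<and> s < t \<and> t \<le> d) \<longleftrightarrow> (\<forall>(s, t)\<in>set ts. s \<in> ?S \<and> t \<in> ?S \<and> s < t)" for ts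
    by (auto simp: split_beta)
  have PI: "i X \<in> H" if X: "X \<in> P" for X
  proof -
    obtain \<sigma> ts where e: "X = (\<sigma>, ts)" by (cases X)
    obtain r where r: "(\<sigma>, ts) \<in> planar_structs ?S r" using X e by (auto simp: P_def)
    then have \<sigma>: "\<sigma> permutes ?S" and ts: "\<forall>(s, t)\<in>set ts. s \<in> ?S \<and> t \<in> ?S \<and> s < t" and len: "length ts = r"
      and srt: "sorted (map snd ts)" and con: "connected_on ?S \<sigma> ts" and pl: "?c (\<sigma> \<circ> tprod ts) + ?c \<sigma> = r + 2"
      by (auto simp: planar_structs_def conn_structs_def mono_structs_def mono_lists_def)
    have "tprod ts permutes ?S" by (rule tprod_permutes) (use ts in auto)
    then have st: "\<sigma> \<circ> tprod ts permutes ?S" by (rule permutes_compose[OF _ \<sigma>])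
    let ?\<rho> = "inv_into UNIV (\<sigma> \<circ> tprod ts)"
    have \<rho>: "?\<rho> permutes ?S" by (rule permutes_inv[OF st])
    have id: "?\<rho> \<circ> (\<sigma> \<circ> tprod ts) = id" by (rule permutes_inv_o(2)[OF st])
    have orb: "orbit ?\<rho> = orbit (\<sigma> \<circ> tprod ts)"
      by (rule ext, rule orbit_inv_eq) (use st permutation_permutes fS in metis)
    have "?c ?\<rho> = ?c (\<sigma> \<circ> tprod ts)" by (simp only: orb)
    then have "length ts + 2 = ?c ?\<rho> + ?c \<sigma>" using pl len by simp
    moreover have "?\<rho> \<circ> \<sigma> \<circ> foldr (\<circ>) (transps ts) id = id" using id by (simp only: tprod_def o_assoc)
    ultimately show ?thesis
      unfolding e i_def split H_def mem_Collect_eq ts_iff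
      using \<rho> \<sigma> ts srt transitive_iff_connected_on[OF \<sigma> ts \<rho> id d] con by (intro conjI) simp_all
  qed
  have HP: "(\<sigma>, ts) \<in> P \<and> i (\<sigma>, ts) = (\<rho>, \<sigma>, ts)" if X: "(\<rho>, \<sigma>, ts) \<in> H" for \<rho> \<sigma> ts
  proof -
    have \<rho>: "\<rho> permutes ?S" and \<sigma>: "\<sigma> permutes ?S" and len: "length ts + 2 = ?c \<rho> + ?c \<sigma>"
      and ts: "\<forall>(s, t)\<in>set ts. s \<in> ?S \<and> t \<in> ?S \<and> s < t" and id0: "\<rho> \<circ> \<sigma> \<circ> foldr (\<circ>) (transps ts) id = id"
      and tra: "\<forall>x\<in>?S. \<forall>y\<in>?S. \<exists>g\<in>generate (sym_group d) ({\<rho>, \<sigma>} \<union> set (transps ts)). g x = y"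
      and srt: "sorted (map snd ts)"
      using X unfolding H_def ts_iff by simp_all
    have id: "\<rho> \<circ> (\<sigma> \<circ> tprod ts) = id" using id0 by (simp only: tprod_def o_assoc)
    have "tprod ts permutes ?S" by (rule tprod_permutes) (use ts in auto)
    then have st: "\<sigma> \<circ> tprod ts permutes ?S" by (rule permutes_compose[OF _ \<sigma>])
    have "\<rho> = \<rho> \<circ> ((\<sigma> \<circ> tprod ts) \<circ> inv_into UNIV (\<sigma> \<circ> tprod ts))" using permutes_inv_o(1)[OF st] by simp
    also have "\<dots> = (\<rho> \<circ> (\<sigma> \<circ> tprod ts)) \<circ> inv_into UNIV (\<sigma> \<circ> tprod ts)" by (rule o_assoc)
    also have "\<dots> = inv_into UNIV (\<sigma> \<circ> tprod ts)" unfolding id by simp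
    finally have \<rho>e: "\<rho> = inv_into UNIV (\<sigma> \<circ> tprod ts)" .
    have orb: "orbit \<rho> = orbit (\<sigma> \<circ> tprod ts)"
      unfolding \<rho>e by (rule ext, rule orbit_inv_eq) (use st permutation_permutes fS in metis)
    have "?c \<rho> = ?c (\<sigma> \<circ> tprod ts)" by (simp only: orb)
    then have pl: "?c (\<sigma> \<circ> tprod ts) + ?c \<sigma> = length ts + 2" using len by simp
    have "connected_on ?S \<sigma> ts" using transitive_iff_connected_on[OF \<sigma> ts \<rho> id d] tra by simp
    then have "(\<sigma>, ts) \<in> planar_structs ?S (length ts)"
      unfolding planar_structs_def conn_structs_def mono_structs_def mono_lists_def using \<sigma> ts srt pl by simp
    then have "(\<sigma>, ts) \<in> P" unfolding P_def using planar_le by blast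
    then show ?thesis using \<rho>e by (simp add: i_def)
  qed
  have injP: "inj_on i P" by (auto simp: inj_on_def i_def)
  have imP: "i ` P = H"
  proof
    show "i ` P \<subseteq> H" using PI by auto
    show "H \<subseteq> i ` P"
    proof
      fix X assume "X \<in> H"
      then show "X \<in> i ` P" using HP[of "fst X" "fst (snd X)" "snd (snd X)"] by (metis image_eqI prod.collapse)
    qed
  qed
  have finH: "finite H" using imP finP by auto
  have count: "monotone_hurwitz_0 d \<alpha> \<beta> = card {X \<in> H. f X = \<alpha> \<and> g X = \<beta>}" for \<alpha> \<beta>
  proof -
    have "{(\<rho>, \<sigma>, ts). \<rho> permutes {1..d} \<and> perm_cycle_type d \<rho> = \<alpha> \<and>
     \<sigma> permutes {1..d} \<and> perm_cycle_type d \<sigma> = \<beta> \<and>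
     length ts = size \<alpha> + size \<beta> - 2 \<and>
     (\<forall>(s, t)\<in>set ts. 1 \<le> s \<and> s < t \<and> t \<le> d) \<and>
     \<rho> \<circ> \<sigma> \<circ> foldr (\<circ>) (transps ts) id = id \<and>
     (\<forall>x\<in>{1..d}. \<forall>y\<in>{1..d}.
        \<exists>g\<in>generate (sym_group d) ({\<rho>, \<sigma>} \<union> set (transps ts)). g x = y) \<and>
     sorted (map snd ts)} = {X \<in> H. f X = \<alpha> \<and> g X = \<beta>}"
    proof -
      have aux: "(a \<Longrightarrow> b \<Longrightarrow> L = L') \<Longrightarrow>
          (A' \<and> a \<and> B' \<and> b \<and> L \<and> C \<and> D \<and> E \<and> F) = ((A' \<and> B' \<and> L' \<and> C \<and> D \<and> E \<and> F) \<and> a \<and> b)"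
        for a b L L' A' B' C D E F :: bool by blast
      show ?thesis
      proof (rule Set.set_eqI)
        fix X :: "(nat \<Rightarrow> nat) \<times> (nat \<Rightarrow> nat) \<times> (nat \<times> nat) list"
        obtain \<rho> \<sigma> ts where X: "X = (\<rho>, \<sigma>, ts)" by (cases X)
        show "X \<in> {(\<rho>, \<sigma>, ts). \<rho> permutes {1..d} \<and> perm_cycle_type d \<rho> = \<alpha> \<and>
           \<sigma> permutes {1..d} \<and> perm_cycle_type d \<sigma> = \<beta> \<and>
           length ts = size \<alpha> + size \<beta> - 2 \<and>
           (\<forall>(s, t)\<in>set ts. 1 \<le> s \<and> s < t \<and> t \<le> d) \<and>
           \<rho> \<circ> \<sigma> \<circ> foldr (\<circ>) (transps ts) id = id \<and>
           (\<forall>x\<in>{1..d}. \<forall>y\<in>{1..d}.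
              \<exists>g\<in>generate (sym_group d) ({\<rho>, \<sigma>} \<union> set (transps ts)). g x = y) \<and>
           sorted (map snd ts)} \<longleftrightarrow> X \<in> {X \<in> H. f X = \<alpha> \<and> g X = \<beta>}"
          unfolding X H_def f_def g_def mem_Collect_eq split
        proof (rule aux)
          \<comment> \<open>Each permutation has at least one cycle because d is at least 1, so the
            subtraction of 2 is not truncated.\<close>
          assume "perm_cycle_type d \<rho> = \<alpha>" "perm_cycle_type d \<sigma> = \<beta>"
          then have "size \<alpha> = ?c \<rho>" "size \<beta> = ?c \<sigma>" using size_perm_cycle_type by auto
          then show "(length ts = size \<alpha> + size \<beta> - 2) = (length ts + 2 = ?c \<rho> + ?c \<sigma>)"
            using c1[of \<rho>] c1[of \<sigma>] by linarith
        qed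
      qed
    qed
    then show ?thesis unfolding monotone_hurwitz_0_def by simp
  qed
  have fg: "(f X, g X) \<in> int_partitions d \<times> int_partitions d" if "X \<in> H" for X
    using that perm_cycle_type_partition unfolding H_def f_def g_def by auto
  have "hciz_coeff_0 d \<phi> \<psi> = (\<Sum>(\<alpha>, \<beta>)\<in>int_partitions d \<times> int_partitions d. of_nat (card {X \<in> H. f X = \<alpha> \<and> g X = \<beta>}) * tm \<alpha> \<beta>)"
    unfolding hciz_coeff_0_def count tm_def sum.cartesian_product by (intro sum.cong refl) (auto simp: mult_ac)
  also have "\<dots> = (\<Sum>y\<in>int_partitions d \<times> int_partitions d. \<Sum>X | X \<in> H \<and> (f X, g X) = y. tm (f X) (g X))"
  proof (rule sum.cong[OF refl])
    fix y :: "nat multiset \<times> nat multiset"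
    obtain \<alpha> \<beta> where y: "y = (\<alpha>, \<beta>)" by (cases y)
    have "(\<Sum>X | X \<in> H \<and> (f X, g X) = y. tm (f X) (g X)) = (\<Sum>X | X \<in> H \<and> f X = \<alpha> \<and> g X = \<beta>. tm \<alpha> \<beta>)"
      unfolding y by (intro sum.cong) auto
    then show "(case y of (\<alpha>, \<beta>) \<Rightarrow> of_nat (card {X \<in> H. f X = \<alpha> \<and> g X = \<beta>}) * tm \<alpha> \<beta>) = (\<Sum>X | X \<in> H \<and> (f X, g X) = y. tm (f X) (g X))"
      unfolding y by simp
  qed
  also have "\<dots> = (\<Sum>X\<in>H. tm (f X) (g X))"
    by (rule sum.group[OF finH]) (use fg finite_int_partitions in auto)
  also have "\<dots> = (\<Sum>X\<in>P. tm (f (i X)) (g (i X)))"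
    unfolding imP[symmetric] by (rule sum.reindex[OF injP, unfolded o_def])
  also have "\<dots> = (\<Sum>r\<le>2 * d. \<Sum>X\<in>planar_structs ?S r. tm (f (i X)) (g (i X)))"
    unfolding P_def
  proof (rule sum.UNION_disjoint)
    show "\<forall>r\<in>{..2 * d}. \<forall>r'\<in>{..2 * d}. r \<noteq> r' \<longrightarrow> planar_structs ?S r \<inter> planar_structs ?S r' = {}"
    proof (intro ballI impI equals0I)
      fix r r' X assume "r \<noteq> r'" and X: "X \<in> planar_structs ?S r \<inter> planar_structs ?S r'"
      then show False using planar_len[of "fst X" "snd X" r] planar_len[of "fst X" "snd X" r'] by simp
    qed
  qed (use finpl in auto)
  also have "\<dots> = (\<Sum>r\<le>2 * d. \<Sum>X\<in>planar_structs ?S r. (-1) ^ d * ((-1) ^ r * struct_weight \<phi> \<psi> ?S X))"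
  proof (intro sum.cong refl)
    fix r X assume X: "X \<in> planar_structs ?S r"
    obtain \<sigma> ts where e: "X = (\<sigma>, ts)" by (cases X)
    have \<sigma>: "\<sigma> permutes ?S" and ts: "ts \<in> mono_lists ?S r" and pl: "?c (\<sigma> \<circ> tprod ts) + ?c \<sigma> = r + 2"
      using X e by (auto simp: planar_structs_def conn_structs_def mono_structs_def)
    have st: "\<sigma> \<circ> tprod ts permutes ?S" by (rule permutes_compose[OF mono_lists_permutes[OF ts subset_refl] \<sigma>])
    let ?\<rho> = "inv_into UNIV (\<sigma> \<circ> tprod ts)"
    have orb: "orbit ?\<rho> = orbit (\<sigma> \<circ> tprod ts)"
      by (rule ext, rule orbit_inv_eq) (use st permutation_permutes fS in metis)
    have fi: "f (i X) = perm_cycle_type d ?\<rho>" and gi: "g (i X) = perm_cycle_type d \<sigma>" by (simp_all add: e f_def g_def i_def)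
    have "size (f (i X)) + size (g (i X)) = r + 2" using pl unfolding fi gi size_perm_cycle_type orb .
    then have "(-1::complex) ^ (d + size (f (i X)) + size (g (i X))) = (-1) ^ (d + r + 2)" by (simp add: add.assoc)
    also have "\<dots> = (-1) ^ d * (-1) ^ r" by (simp add: power_add)
    finally have sg: "(-1::complex) ^ (d + size (f (i X)) + size (g (i X))) = (-1) ^ d * (-1) ^ r" .
    have "moment_prod \<phi> (f (i X)) = orbit_prod \<phi> ?S (\<sigma> \<circ> tprod ts) (\<lambda>_. 1)"
      unfolding fi moment_prod_cycle_type by (rule orbit_prod_inv[OF fS st])
    moreover have "moment_prod \<psi> (g (i X)) = orbit_prod \<psi> ?S \<sigma> (\<lambda>_. 1)"
      unfolding gi by (rule moment_prod_cycle_type)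
    moreover have "struct_weight \<phi> \<psi> ?S X = orbit_prod \<phi> ?S (\<sigma> \<circ> tprod ts) (\<lambda>_. 1) * orbit_prod \<psi> ?S \<sigma> (\<lambda>_. 1)"
      unfolding e struct_weight_def split ..
    ultimately show "tm (f (i X)) (g (i X)) = (-1) ^ d * ((-1) ^ r * struct_weight \<phi> \<psi> ?S X)"
      unfolding tm_def sg by (simp only: mult.assoc)
  qed
  also have "\<dots> = (-1) ^ d * (\<Sum>r\<le>2 * d. \<Sum>X\<in>planar_structs ?S r. (-1) ^ r * struct_weight \<phi> \<psi> ?S X)"
    by (simp only: sum_distrib_left)
  also have "(\<Sum>r\<le>2 * d. \<Sum>X\<in>planar_structs ?S r. (-1) ^ r * struct_weight \<phi> \<psi> ?S X) =
     (\<Sum>r. \<Sum>X\<in>planar_structs ?S r. (-1) ^ r * struct_weight \<phi> \<psi> ?S X)"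
    by (rule suminf_finite[symmetric]) (use planar_le in \<open>auto intro!: sum.neutral\<close>)
  finally show ?thesis .
qed

section \<open>Analytic properties of the integral\<close>

lemma vec_l2_norm_eq_L2_set: "vec_l2_norm v = L2_set (\<lambda>i. cmod (vec_index v i)) {..<dim_vec v}"
  by (simp add: vec_l2_norm_def L2_set_def)

lemma vec_l2_norm_nonneg: "0 \<le> vec_l2_norm v"
  by (simp add: vec_l2_norm_def sum_nonneg)

lemma mat_vec_entry:
  assumes "A \<in> carrier_mat n m" "v \<in> carrier_vec m" "i < n"
  shows "vec_index (A *\<^sub>v v) i = (\<Sum>j<m. A $$ (i, j) * vec_index v j)"
  using assms by (auto simp: scalar_prod_def atLeast0LessThan intro!: sum.cong)

lemma cmod_entry_le_vec_l2_norm: "i < dim_vec v \<Longrightarrow> cmod (vec_index v i) \<le> vec_l2_norm v"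
  unfolding vec_l2_norm_eq_L2_set by (rule member_le_L2_set) auto

lemma vec_l2_norm_smult: "vec_l2_norm (c \<cdot>\<^sub>v v) = cmod c * vec_l2_norm v"
  by (simp add: vec_l2_norm_def norm_mult power_mult_distrib real_sqrt_mult flip: sum_distrib_left)

text \<open>A real supremum dominates its members only if the set is bounded above, so a crude bound
  by the sum of all entries comes first. Vectors of positive norm are then rescaled.\<close>

lemma vec_l2_norm_mult_le_op_norm:
  assumes A: "A \<in> carrier_mat N N" and v: "v \<in> carrier_vec N"
  shows "vec_l2_norm (A *\<^sub>v v) \<le> mat_op_norm A * vec_l2_norm v"
proof -
  let ?V = "{v \<in> carrier_vec N. vec_l2_norm v \<le> 1}"
  have "vec_l2_norm (A *\<^sub>v w) \<le> (\<Sum>i<N. \<Sum>j<N. cmod (A $$ (i, j)))" if w: "w \<in> ?V" for w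
  proof -
    have wc: "w \<in> carrier_vec N" "vec_l2_norm w \<le> 1" using w by auto
    have "vec_l2_norm (A *\<^sub>v w) \<le> (\<Sum>i<N. cmod (vec_index (A *\<^sub>v w) i))"
      unfolding vec_l2_norm_eq_L2_set using A wc L2_set_le_sum_abs[of "\<lambda>i. cmod (vec_index (A *\<^sub>v w) i)" "{..<N}"] by simp
    also have "\<dots> \<le> (\<Sum>i<N. \<Sum>j<N. cmod (A $$ (i, j)))"
    proof (rule sum_mono)
      fix i assume "i \<in> {..<N}"
      then have i: "i < N" by simp
      have "cmod (vec_index (A *\<^sub>v w) i) \<le> (\<Sum>j<N. cmod (A $$ (i, j) * vec_index w j))"
        unfolding mat_vec_entry[OF A wc(1) i] by (rule norm_sum)
      also have "\<dots> \<le> (\<Sum>j<N. cmod (A $$ (i, j)))"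
      proof (rule sum_mono)
        fix j assume "j \<in> {..<N}"
        then have "cmod (vec_index w j) \<le> 1" using cmod_entry_le_vec_l2_norm[of j w] wc by simp
        then show "cmod (A $$ (i, j) * vec_index w j) \<le> cmod (A $$ (i, j))"
          unfolding norm_mult by (simp add: mult_left_le)
      qed
      finally show "cmod (vec_index (A *\<^sub>v w) i) \<le> (\<Sum>j<N. cmod (A $$ (i, j)))" .
    qed
    finally show ?thesis .
  qed
  then have "bdd_above ((\<lambda>v. vec_l2_norm (A *\<^sub>v v)) ` ?V)" by (intro bdd_aboveI2)
  then have op: "vec_l2_norm (A *\<^sub>v w) \<le> mat_op_norm A" if "w \<in> ?V" for w
    unfolding mat_op_norm_def carrier_matD(2)[OF A] by (rule cSUP_upper[OF that])
  show ?thesis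
  proof (cases "vec_l2_norm v = 0")
    case True
    have "vec_index v j = 0" if "j < N" for j
      using cmod_entry_le_vec_l2_norm[of j v] that v True by simp
    then have "vec_index (A *\<^sub>v v) i = 0" if "i < N" for i using mat_vec_entry[OF A v that] by simp
    then have "vec_l2_norm (A *\<^sub>v v) = 0" using A by (simp add: vec_l2_norm_def)
    then show ?thesis using True by simp
  next
    case False
    then have pos: "vec_l2_norm v > 0" using vec_l2_norm_nonneg[of v] by linarith
    let ?w = "complex_of_real (1 / vec_l2_norm v) \<cdot>\<^sub>v v"
    have "vec_l2_norm ?w = 1" using pos by (simp add: vec_l2_norm_smult norm_divide)
    then have "vec_l2_norm (A *\<^sub>v ?w) \<le> mat_op_norm A" using v by (intro op) simp
    also have "A *\<^sub>v ?w = complex_of_real (1 / vec_l2_norm v) \<cdot>\<^sub>v (A *\<^sub>v v)" by (rule mult_mat_vec[OF A v])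
    finally have "1 / vec_l2_norm v * vec_l2_norm (A *\<^sub>v v) \<le> mat_op_norm A"
      using pos by (simp add: vec_l2_norm_smult norm_divide)
    then show ?thesis using pos by (simp add: field_simps)
  qed
qed

context unitary_haar
begin

lemma vec_l2_norm_unitary:
  assumes U: "U \<in> carrier_mat N N" "mat_adjoint U * U = 1\<^sub>m N" and v: "v \<in> carrier_vec N"
  shows "vec_l2_norm (U *\<^sub>v v) = vec_l2_norm v"
proof -
  have U': "mat_adjoint U \<in> carrier_mat N N" by (rule mat_adjoint_carrier[OF U(1)])
  let ?v = "vec_index v"
  have orth: "(\<Sum>i<N. cnj (U $$ (i, k)) * U $$ (i, j)) = (if k = j then 1 else 0)" if "k < N" "j < N" for k j
  proof -
    have "(\<Sum>i<N. cnj (U $$ (i, k)) * U $$ (i, j)) = (mat_adjoint U * U) $$ (k, j)"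
      using that by (simp add: mat_mult_entry[OF U' U(1)] mat_adjoint_entry[OF U(1)] del: index_mult_mat(1))
    then show ?thesis using that U(2) by simp
  qed
  have "complex_of_real (\<Sum>i<N. (cmod (vec_index (U *\<^sub>v v) i))\<^sup>2) =
      (\<Sum>i<N. (\<Sum>j<N. U $$ (i, j) * ?v j) * cnj (\<Sum>k<N. U $$ (i, k) * ?v k))"
    by (simp add: complex_norm_square mat_vec_entry[OF U(1) v] del: of_real_power cnj_sum index_mult_mat_vec)
  also have "\<dots> = (\<Sum>i<N. \<Sum>j<N. \<Sum>k<N. ?v j * cnj (?v k) * (cnj (U $$ (i, k)) * U $$ (i, j)))"
    by (simp add: sum_product mult_ac)
  also have "\<dots> = (\<Sum>j<N. \<Sum>k<N. \<Sum>i<N. ?v j * cnj (?v k) * (cnj (U $$ (i, k)) * U $$ (i, j)))"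
    by (subst sum.swap, rule sum.cong[OF refl], rule sum.swap)
  also have "\<dots> = (\<Sum>j<N. \<Sum>k<N. ?v j * cnj (?v k) * (if k = j then 1 else 0))"
    by (intro sum.cong refl) (simp add: orth sum_distrib_left[symmetric])
  also have "\<dots> = (\<Sum>j<N. ?v j * cnj (?v j))"
    by (intro sum.cong refl) (simp add: if_distrib[of "\<lambda>y. _ * y"] cong: if_cong)
  also have "\<dots> = complex_of_real (\<Sum>j<N. (cmod (?v j))\<^sup>2)" by (simp add: complex_norm_square del: of_real_power)
  finally have "(\<Sum>i<N. (cmod (vec_index (U *\<^sub>v v) i))\<^sup>2) = (\<Sum>j<N. (cmod (?v j))\<^sup>2)" by (simp only: of_real_eq_iff)
  then show ?thesis using U(1) v by (simp add: vec_l2_norm_def del: index_mult_mat_vec)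
qed

lemma mat_adjoint_adjoint: "(U :: complex mat) \<in> carrier_mat N N \<Longrightarrow> mat_adjoint (mat_adjoint U) = U"
  using mat_adjoint_carrier[of U N N] mat_adjoint_carrier[of "mat_adjoint U" N N]
  by (intro eq_matI) (auto simp: mat_adjoint_entry[of _ N N])

text \<open>Each diagonal entry is at most the norm of the image of a unit vector, and
  \<open>U\<close> and its adjoint preserve norms. With the factor N in the exponent of the
  integrand, the N entries give the N^2 of the free energy.\<close>

lemma norm_trace_conj_le:
  assumes A: "A \<in> carrier_mat N N" "mat_op_norm A \<le> M" and B: "B \<in> carrier_mat N N" "mat_op_norm B \<le> M"
    and M: "M \<ge> 0" and U: "U \<in> unitary_group N"
  shows "cmod (mat_trace (A * U * B * mat_adjoint U)) \<le> of_nat N * M\<^sup>2"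
proof -
  note u = unitaryD[OF U]
  let ?C = "A * U * B * mat_adjoint U"
  have C: "?C \<in> carrier_mat N N" using A B u by simp
  have "cmod (?C $$ (i, i)) \<le> M\<^sup>2" if i: "i < N" for i
  proof -
    let ?e = "unit_vec N i :: complex vec"
    have e: "?e \<in> carrier_vec N" by simp
    have ne: "vec_l2_norm ?e = 1"
    proof -
      have "(\<Sum>j<N. (cmod (vec_index ?e j))\<^sup>2) = (\<Sum>j<N. if j = i then 1 else 0)"
        using i by (intro sum.cong) auto
      then show ?thesis using i by (simp add: vec_l2_norm_def)
    qed
    have "vec_index (?C *\<^sub>v ?e) i = (\<Sum>j<N. if j = i then ?C $$ (i, i) else 0)"
      unfolding mat_vec_entry[OF C e i] using i by (intro sum.cong) auto
    then have "cmod (?C $$ (i, i)) = cmod (vec_index (?C *\<^sub>v ?e) i)" using i by simp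
    also have "\<dots> \<le> vec_l2_norm (?C *\<^sub>v ?e)" using A i by (intro cmod_entry_le_vec_l2_norm) simp
    also have "?C *\<^sub>v ?e = A *\<^sub>v (U *\<^sub>v (B *\<^sub>v (mat_adjoint U *\<^sub>v ?e)))"
      using A B u by (simp add: assoc_mult_mat_vec[of _ N N _ N])
    also have "vec_l2_norm \<dots> \<le> mat_op_norm A * vec_l2_norm (U *\<^sub>v (B *\<^sub>v (mat_adjoint U *\<^sub>v ?e)))"
      using A B u e by (intro vec_l2_norm_mult_le_op_norm) auto
    also have "vec_l2_norm (U *\<^sub>v (B *\<^sub>v (mat_adjoint U *\<^sub>v ?e))) = vec_l2_norm (B *\<^sub>v (mat_adjoint U *\<^sub>v ?e))"
      using A B u e by (intro vec_l2_norm_unitary) auto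
    also have "mat_op_norm A * \<dots> \<le> M * (M * vec_l2_norm (mat_adjoint U *\<^sub>v ?e))"
    proof (rule mult_mono[OF A(2) _ M vec_l2_norm_nonneg])
      have "vec_l2_norm (B *\<^sub>v (mat_adjoint U *\<^sub>v ?e)) \<le> mat_op_norm B * vec_l2_norm (mat_adjoint U *\<^sub>v ?e)"
        using B u e by (intro vec_l2_norm_mult_le_op_norm) auto
      also have "\<dots> \<le> M * vec_l2_norm (mat_adjoint U *\<^sub>v ?e)" by (rule mult_right_mono[OF B(2) vec_l2_norm_nonneg])
      finally show "vec_l2_norm (B *\<^sub>v (mat_adjoint U *\<^sub>v ?e)) \<le> M * vec_l2_norm (mat_adjoint U *\<^sub>v ?e)" .
    qed
    also have "vec_l2_norm (mat_adjoint U *\<^sub>v ?e) = 1"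
      unfolding ne[symmetric] using u e by (intro vec_l2_norm_unitary) (auto simp: mat_adjoint_adjoint)
    finally show ?thesis by (simp add: power2_eq_square)
  qed
  then have "cmod (\<Sum>i<N. ?C $$ (i, i)) \<le> of_nat (card {..<N}) * M\<^sup>2"
    by (intro sum_norm_bound) auto
  then show ?thesis using A by (simp add: mat_trace_def del: index_mult_mat(1))
qed

end

section \<open>Power series expansion of the integral\<close>

context unitary_haar_conj
begin

lemma bdd_measurable_power: "bdd_measurable f \<Longrightarrow> bdd_measurable (\<lambda>U. f U ^ n)"
  by (induction n) auto

text \<open>The exponential is integrated termwise; the bound \<open>C\<close> on the trace gives
  the exponential series of |z| N C as a majorant.\<close>

lemma hciz_sums:
  assumes A: "A \<in> carrier_mat N N" and C: "\<And>U. U \<in> unitary_group N \<Longrightarrow> cmod (mat_trace (A * U * B * mat_adjoint U)) \<le> C"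
  shows "(\<lambda>n. (- of_nat N) ^ n * (\<integral>U. mat_trace (A * U * B * mat_adjoint U) ^ n \<partial>\<kappa>) / fact n * z ^ n)
    sums hciz \<kappa> N A B z"
proof -
  let ?T = "\<lambda>U. mat_trace (A * U * B * mat_adjoint U)"
  define c where "c = - z * of_nat N"
  define f where "f = (\<lambda>n U. (c * ?T U) ^ n /\<^sub>R fact n)"
  have fe: "f n U = (c ^ n / fact n) * ?T U ^ n" for n U
    by (simp add: f_def power_mult_distrib scaleR_conv_of_real divide_inverse mult_ac)
  have bf: "bdd_measurable (f n)" for n unfolding fe[abs_def] by (intro bdd_measurable_mult bdd_measurable_const bdd_measurable_power bdd_measurable_trace[OF A])
  have nf: "norm (f n U) \<le> (cmod c * C) ^ n /\<^sub>R fact n" if "U \<in> unitary_group N" for n U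
  proof -
    have "(cmod c * cmod (?T U)) ^ n \<le> (cmod c * C) ^ n"
      using C[OF that] by (intro power_mono mult_left_mono) auto
    then show ?thesis by (simp add: f_def norm_power norm_mult divide_right_mono field_simps)
  qed
  have "(\<lambda>n. integral\<^sup>L \<kappa> (f n)) sums (\<integral>U. (\<Sum>n. f n U) \<partial>\<kappa>)"
  proof (rule sums_integral)
    show "integrable \<kappa> (f n)" for n by (rule bdd_measurable_integrable[OF bf])
    show "AE U in \<kappa>. summable (\<lambda>n. norm (f n U))"
    proof (rule AE_I2)
      fix U show "summable (\<lambda>n. norm (f n U))"
        using summable_exp_generic[of "cmod (c * ?T U)"] by (simp add: f_def norm_power)
    qed
    show "summable (\<lambda>n. \<integral>U. norm (f n U) \<partial>\<kappa>)"
    proof (rule summable_comparison_test'[where N = 0])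
      show "summable (\<lambda>n. (cmod c * C) ^ n /\<^sub>R fact n)" by (rule summable_exp_generic)
      fix n
      have "(\<integral>U. norm (f n U) \<partial>\<kappa>) \<le> (\<integral>U. (cmod c * C) ^ n /\<^sub>R fact n \<partial>\<kappa>)"
        by (rule integral_mono) (use nf bdd_measurable_integrable[OF bf] in \<open>auto simp: space_eq\<close>)
      then show "norm (\<integral>U. norm (f n U) \<partial>\<kappa>) \<le> (cmod c * C) ^ n /\<^sub>R fact n"
        by (simp add: prob_space)
    qed
  qed
  moreover have "(\<Sum>n. f n U) = exp (- z * of_nat N * ?T U)" for U
    unfolding f_def c_def using exp_converges[of "- z * of_nat N * ?T U"] by (simp add: sums_iff)
  moreover have "integral\<^sup>L \<kappa> (f n) = (- of_nat N) ^ n * (\<integral>U. ?T U ^ n \<partial>\<kappa>) / fact n * z ^ n" for n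
  proof -
    have "c ^ n = (- of_nat N) ^ n * z ^ n" by (simp add: c_def mult.commute flip: power_mult_distrib)
    then show ?thesis unfolding fe by simp
  qed
  ultimately show ?thesis by (simp add: hciz_def)
qed

lemma norm_hciz_le:
  assumes A: "A \<in> carrier_mat N N" and C: "\<And>U. U \<in> unitary_group N \<Longrightarrow> cmod (mat_trace (A * U * B * mat_adjoint U)) \<le> C"
  shows "cmod (hciz \<kappa> N A B z) \<le> exp (cmod z * of_nat N * C)"
  unfolding hciz_def
proof (rule order_trans[OF integral_norm_bound])
  let ?g = "\<lambda>U. exp (- z * of_nat N * mat_trace (A * U * B * mat_adjoint U))"
  have le: "norm (?g U) \<le> exp (cmod z * of_nat N * C)" if "U \<in> unitary_group N" for U
  proof -
    have "norm (?g U) \<le> exp (norm (- z * of_nat N * mat_trace (A * U * B * mat_adjoint U)))" by (rule norm_exp)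
    also have "\<dots> \<le> exp (cmod z * of_nat N * C)"
      using C[OF that] by (simp add: norm_mult mult_left_mono)
    finally show ?thesis .
  qed
  have meas: "?g \<in> borel_measurable \<kappa>"
    using bdd_measurable_trace[OF A] unfolding bdd_measurable_def
    by (auto intro!: measurable_compose[OF _ borel_measurable_continuous_onI[of exp]] continuous_intros borel_measurable_times)
  have int: "integrable \<kappa> ?g"
    by (rule integrable_const_bound[OF _ meas, of "exp (cmod z * of_nat N * C)"]) (rule AE_I2, rule le, simp add: space_eq)
  have "(\<integral>U. norm (?g U) \<partial>\<kappa>) \<le> (\<integral>U. exp (cmod z * of_nat N * C) \<partial>\<kappa>)"
    by (rule integral_mono[OF integrable_norm[OF int] integrable_const]) (rule le, simp only: space_eq)
  then show "(\<integral>U. norm (?g U) \<partial>\<kappa>) \<le> exp (cmod z * of_nat N * C)" by (simp add: prob_space)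
qed

lemma hciz_derivatives:
  assumes "A \<in> carrier_mat N N" "\<And>U. U \<in> unitary_group N \<Longrightarrow> cmod (mat_trace (A * U * B * mat_adjoint U)) \<le> C"
  shows "(deriv ^^ n) (hciz \<kappa> N A B) 0 = (- of_nat N) ^ n * (\<integral>U. mat_trace (A * U * B * mat_adjoint U) ^ n \<partial>\<kappa>)"
    and "hciz \<kappa> N A B holomorphic_on ball 0 r" and "hciz \<kappa> N A B 0 = 1"
proof -
  let ?a = "\<lambda>n. (- of_nat N) ^ n * (\<integral>U. mat_trace (A * U * B * mat_adjoint U) ^ n \<partial>\<kappa>) / fact n"
  have "hciz \<kappa> N A B has_fps_expansion Abs_fps ?a"
    by (rule has_fps_expansionI) (use hciz_sums[OF assms] in simp)
  from fps_nth_fps_expansion[OF this, of n]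
  show "(deriv ^^ n) (hciz \<kappa> N A B) 0 = (- of_nat N) ^ n * (\<integral>U. mat_trace (A * U * B * mat_adjoint U) ^ n \<partial>\<kappa>)"
    by (simp add: field_simps)
  show "hciz \<kappa> N A B holomorphic_on ball 0 r"
    by (rule power_series_holomorphic[where a = ?a]) (use hciz_sums[OF assms] in simp)
  show "hciz \<kappa> N A B 0 = 1" by (simp add: hciz_def prob_space)
qed

end

text \<open>Borel-Caratheodory: apply the Schwarz lemma to \<open>F / (2 C - F)\<close>.\<close>

lemma norm_le_of_Re_less:
  assumes F: "F holomorphic_on ball 0 \<epsilon>" "F 0 = 0" and Re: "\<And>z. z \<in> ball 0 \<epsilon> \<Longrightarrow> Re (F z) < C"
    and pos: "\<epsilon> > 0" "C > 0" and z: "cmod z \<le> \<epsilon> / 2"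
  shows "cmod (F z) \<le> 2 * C"
proof -
  define g where "g = (\<lambda>w. F (of_real \<epsilon> * w) / (2 * of_real C - F (of_real \<epsilon> * w)))"
  have in_ball: "of_real \<epsilon> * w \<in> ball 0 \<epsilon>" if "cmod w < 1" for w :: complex
    using that pos by (simp add: norm_mult)
  have nz: "2 * of_real C - F w \<noteq> 0" if "w \<in> ball 0 \<epsilon>" for w
  proof
    assume "2 * of_real C - F w = 0"
    then have "Re (F w) = 2 * C" by (simp add: complex_eq_iff)
    then show False using Re[OF that] pos by simp
  qed
  have lt: "cmod (F w) < cmod (2 * of_real C - F w)" if "w \<in> ball 0 \<epsilon>" for w
  proof -
    have "0 < 4 * C * (C - Re (F w))" using Re[OF that] pos by simp
    moreover have "(2 * C - Re (F w))\<^sup>2 = (Re (F w))\<^sup>2 + 4 * C * (C - Re (F w))"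
      by (simp add: power2_eq_square algebra_simps)
    moreover have "(cmod (2 * of_real C - F w))\<^sup>2 = (2 * C - Re (F w))\<^sup>2 + (Im (F w))\<^sup>2"
      by (simp add: cmod_power2)
    ultimately have "(cmod (F w))\<^sup>2 < (cmod (2 * of_real C - F w))\<^sup>2"
      using cmod_power2[of "F w"] by linarith
    then show ?thesis by (rule power2_less_imp_less) simp
  qed
  have hol: "g holomorphic_on ball 0 1"
    unfolding g_def
  proof (intro holomorphic_intros)
    have "(F \<circ> (\<lambda>w. of_real \<epsilon> * w)) holomorphic_on ball 0 1"
      by (rule holomorphic_on_compose_gen[OF _ F(1)]) (use in_ball in \<open>auto intro!: holomorphic_intros\<close>)
    then show "(\<lambda>w. F (of_real \<epsilon> * w)) holomorphic_on ball 0 1" "(\<lambda>w. F (of_real \<epsilon> * w)) holomorphic_on ball 0 1"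
      by (simp_all add: o_def)
    show "\<And>w. w \<in> ball 0 1 \<Longrightarrow> 2 * of_real C - F (of_real \<epsilon> * w) \<noteq> 0" using nz in_ball by simp
  qed
  have "cmod (g w) < 1" if "cmod w < 1" for w
    using lt[OF in_ball[OF that]] nz[OF in_ball[OF that]] by (simp add: g_def norm_divide)
  moreover have "g 0 = 0" by (simp add: g_def F(2))
  moreover have z1: "cmod (z / of_real \<epsilon>) \<le> 1 / 2" using z pos by (simp add: norm_divide field_simps)
  ultimately have "cmod (g (z / of_real \<epsilon>)) \<le> cmod (z / of_real \<epsilon>)"
    by (intro Schwarz_Lemma(1)[OF hol]) auto
  then have "cmod (g (z / of_real \<epsilon>)) \<le> 1 / 2" using z1 by linarith
  moreover have "of_real \<epsilon> * (z / of_real \<epsilon>) = z" using pos by simp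
  moreover have zb: "z \<in> ball 0 \<epsilon>" using z pos by simp
  \<comment> \<open>|g| is at most 1/2 here, so |F| is at most C + |F|/2, which is solved for
    |F|.\<close>
  ultimately have "cmod (F z) \<le> cmod (2 * of_real C - F z) / 2"
    using nz[OF zb] by (simp add: g_def norm_divide field_simps)
  also have "\<dots> \<le> (2 * C + cmod (F z)) / 2"
    using norm_triangle_ineq4[of "2 * of_real C" "F z"] pos by (simp add: norm_mult)
  finally show ?thesis by simp
qed

text \<open>A Vitali type argument. Cauchy estimates on the circle of radius R bound the Taylor
  coefficients uniformly in \<open>n\<close>, the limit coefficients inherit the bound, and for |z|
  at most rho < R Tannery's theorem sums the coefficient differences. The larger disc keeps that
  circle inside the domain.\<close>

lemma holomorphic_sequence_limit:
  fixes f :: "nat \<Rightarrow> complex \<Rightarrow> complex"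
  assumes R: "R > 0" and hol: "\<And>n. n \<ge> 1 \<Longrightarrow> f n holomorphic_on ball 0 (2 * R)"
    and bd: "\<And>n z. n \<ge> 1 \<Longrightarrow> z \<in> ball 0 (2 * R) \<Longrightarrow> cmod (f n z) \<le> K"
    and lim: "\<And>d. (\<lambda>n. (deriv ^^ d) (f n) 0) \<longlonglongrightarrow> c d"
  shows "z \<in> ball 0 R \<Longrightarrow> summable (\<lambda>d. c d / fact d * z ^ d)"
    and "compact T \<Longrightarrow> T \<subseteq> ball 0 R \<Longrightarrow> uniform_limit T f (\<lambda>z. \<Sum>d. c d / fact d * z ^ d) sequentially"
proof -
  define a where "a = (\<lambda>n d. (deriv ^^ d) (f n) 0 / fact d)"
  define b where "b = (\<lambda>d. c d / fact d)"
  have K: "K \<ge> 0" using order_trans[OF norm_ge_zero bd[of 1 0]] R by simp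
  have an: "cmod (a n d) \<le> K / R ^ d" if n: "n \<ge> 1" for n d
  proof -
    have "norm ((deriv ^^ d) (f n) 0) \<le> fact d * K / R ^ d"
    proof (rule Cauchy_inequality[OF _ _ R])
      show "f n holomorphic_on ball 0 R" by (rule holomorphic_on_subset[OF hol[OF n]]) (use R in auto)
      show "continuous_on (cball 0 R) (f n)"
        by (rule holomorphic_on_imp_continuous_on, rule holomorphic_on_subset[OF hol[OF n]]) (use R in auto)
      show "\<And>x. norm (0 - x) = R \<Longrightarrow> norm (f n x) \<le> K" using bd[OF n] R by simp
    qed
    then show ?thesis by (simp add: a_def norm_divide field_simps)
  qed
  have alim: "(\<lambda>n. a n d) \<longlonglongrightarrow> b d" for d
    unfolding a_def b_def by (intro tendsto_divide lim tendsto_const) simp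
  have bn: "cmod (b d) \<le> K / R ^ d" for d
    by (rule tendsto_upperbound[OF tendsto_norm[OF alim[of d]]])
       (auto intro!: eventually_mono[OF eventually_ge_at_top[of 1]] an)
  have geo: "summable (\<lambda>d. L / R ^ d * \<rho> ^ d)" if "0 \<le> \<rho>" "\<rho> < R" for \<rho> L :: real
  proof -
    have "summable (\<lambda>d. L * (\<rho> / R) ^ d)" using that R by (intro summable_mult summable_geometric) simp
    then show ?thesis by (simp add: power_divide)
  qed
  have sb: "summable (\<lambda>d. b d * z ^ d)" if "cmod z < R" for z
  proof (rule summable_comparison_test'[OF geo[OF norm_ge_zero that, of K], where N = 0])
    fix d show "norm (b d * z ^ d) \<le> K / R ^ d * cmod z ^ d"
      unfolding norm_mult norm_power by (rule mult_right_mono[OF bn]) simp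
  qed
  then show "z \<in> ball 0 R \<Longrightarrow> summable (\<lambda>d. c d / fact d * z ^ d)" by (simp add: b_def)
  show "uniform_limit T f (\<lambda>z. \<Sum>d. c d / fact d * z ^ d) sequentially" if T: "compact T" "T \<subseteq> ball 0 R"
  proof -
    obtain \<rho> where \<rho>: "0 \<le> \<rho>" "\<rho> < R" "\<And>z. z \<in> T \<Longrightarrow> cmod z \<le> \<rho>"
    proof (cases "T = {}")
      case True
      then show ?thesis using that[of 0] R by simp
    next
      case False
      obtain x where "x \<in> T" "\<And>y. y \<in> T \<Longrightarrow> cmod y \<le> cmod x"
        using continuous_attains_sup[OF T(1) False continuous_on_norm_id] by blast
      then show ?thesis using that[of "cmod x"] T(2) by auto
    qed
    have "(\<lambda>n. \<Sum>d. cmod (a n d - b d) * \<rho> ^ d) \<longlonglongrightarrow> (\<Sum>d. 0)"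
    proof -
      have l0: "(\<lambda>n. cmod (a n d - b d) * \<rho> ^ d) \<longlonglongrightarrow> 0" for d
        using tendsto_mult_left_zero[OF tendsto_norm_zero[OF LIM_zero[OF alim[of d]]]] by simp
      have "\<forall>\<^sub>F (d, n) in at_top \<times>\<^sub>F sequentially. norm (cmod (a n d - b d) * \<rho> ^ d) \<le> 2 * K / R ^ d * \<rho> ^ d"
        unfolding eventually_prod_filter
      proof (intro exI conjI allI impI)
        show "\<forall>\<^sub>F d :: nat in at_top. True" by simp
        show "\<forall>\<^sub>F n :: nat in sequentially. n \<ge> 1" by (rule eventually_ge_at_top)
        fix d n :: nat assume "n \<ge> 1"
        then have "cmod (a n d - b d) \<le> K / R ^ d + K / R ^ d"
          using norm_triangle_ineq4[of "a n d" "b d"] an[of n d] bn[of d] by linarith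
        then have "cmod (a n d - b d) * \<rho> ^ d \<le> (K / R ^ d + K / R ^ d) * \<rho> ^ d"
          using \<rho>(1) by (intro mult_right_mono) auto
        then show "case (d, n) of (d, n) \<Rightarrow> norm (cmod (a n d - b d) * \<rho> ^ d) \<le> 2 * K / R ^ d * \<rho> ^ d"
          using \<rho>(1) by (simp add: abs_mult)
      qed
      from tannerys_theorem[OF l0 this geo[OF \<rho>(1,2)]] show ?thesis by simp
    qed
    then have small: "(\<lambda>n. \<Sum>d. cmod (a n d - b d) * \<rho> ^ d) \<longlonglongrightarrow> 0" by simp
    have le: "dist (f n z) (\<Sum>d. b d * z ^ d) \<le> (\<Sum>d. cmod (a n d - b d) * \<rho> ^ d)" if n: "n \<ge> 1" and z: "z \<in> T" for n z
    proof -
      have zR: "cmod z < R" using \<rho>(2,3) z by (meson le_less_trans)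
      have "(\<lambda>d. a n d * (z - 0) ^ d) sums f n z"
        unfolding a_def by (rule holomorphic_power_series[OF hol[OF n]]) (use zR R in simp)
      then have s: "(\<lambda>d. a n d * z ^ d - b d * z ^ d) sums (f n z - (\<Sum>d. b d * z ^ d))"
        using sb[OF zR] by (intro sums_diff summable_sums) simp_all
      have dom: "summable (\<lambda>d. cmod (a n d - b d) * \<rho> ^ d)"
      proof (rule summable_comparison_test'[OF geo[OF \<rho>(1,2), of "2 * K"], where N = 0])
        fix d
        have le2: "cmod (a n d - b d) \<le> 2 * K / R ^ d"
          using norm_triangle_ineq4[of "a n d" "b d"] an[OF n, of d] bn[of d] by simp
        show "norm (cmod (a n d - b d) * \<rho> ^ d) \<le> 2 * K / R ^ d * \<rho> ^ d"
          using mult_right_mono[OF le2, of "\<rho> ^ d"] \<rho>(1) by (simp add: abs_mult)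
      qed
      have tm: "norm (a n d * z ^ d - b d * z ^ d) \<le> cmod (a n d - b d) * \<rho> ^ d" for d
        using \<rho>(3)[OF z] by (simp add: left_diff_distrib[symmetric] norm_mult norm_power mult_left_mono power_mono)
      have "norm (\<Sum>d. a n d * z ^ d - b d * z ^ d) \<le> (\<Sum>d. cmod (a n d - b d) * \<rho> ^ d)"
        by (rule norm_suminf_le[OF tm dom])
      then show ?thesis using s by (simp add: sums_iff dist_norm)
    qed
    have "uniform_limit T f (\<lambda>z. \<Sum>d. b d * z ^ d) sequentially"
    proof (rule uniform_limitI)
      fix e :: real assume "e > 0"
      then have "\<forall>\<^sub>F n in sequentially. (\<Sum>d. cmod (a n d - b d) * \<rho> ^ d) < e"
        by (rule order_tendstoD(2)[OF small])
      then show "\<forall>\<^sub>F n in sequentially. \<forall>z\<in>T. dist (f n z) (\<Sum>d. b d * z ^ d) < e"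
        using eventually_ge_at_top[of 1]
        by eventually_elim (use le le_less_trans in blast)
    qed
    then show ?thesis by (simp add: b_def)
  qed
qed

text \<open>Leibniz' rule for f' = g' f. Up to signs it is the recursion that
  \<open>conn_series_eq_cumulant\<close> asks of moments and cumulants.\<close>

lemma higher_deriv_exp_rec:
  assumes hol: "g holomorphic_on ball 0 \<epsilon>" and pos: "\<epsilon> > 0" and f: "\<And>z. z \<in> ball 0 \<epsilon> \<Longrightarrow> f z = exp (g z)"
  shows "(deriv ^^ Suc d) f 0 = (\<Sum>k\<le>d. of_nat (d choose k) * ((deriv ^^ Suc k) g 0 * (deriv ^^ (d - k)) f 0))"
proof -
  have z0: "(0 :: complex) \<in> ball 0 \<epsilon>" using pos by simp
  have holf: "f holomorphic_on ball 0 \<epsilon>"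
    by (rule holomorphic_transform[of "\<lambda>z. exp (g z)"]) (use hol f in \<open>auto intro!: holomorphic_intros\<close>)
  have df: "deriv f z = deriv g z * f z" if z: "z \<in> ball 0 \<epsilon>" for z
  proof -
    have "(g has_field_derivative deriv g z) (at z)" by (rule holomorphic_derivI[OF hol open_ball z])
    then have "((\<lambda>z. exp (g z)) has_field_derivative exp (g z) * deriv g z) (at z)"
      by (rule DERIV_fun_exp)
    then have "(f has_field_derivative exp (g z) * deriv g z) (at z)"
      by (rule DERIV_cong_ev[OF refl _ refl, THEN iffD1, rotated])
         (use f eventually_nhds_in_open[OF open_ball z] in \<open>auto elim!: eventually_mono\<close>)
    then show ?thesis using f[OF z] by (simp add: DERIV_imp_deriv)
  qed
  have "(deriv ^^ Suc d) f 0 = (deriv ^^ d) (deriv f) 0" by (simp add: funpow_swap1)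
  also have "\<dots> = (deriv ^^ d) (\<lambda>z. deriv g z * f z) 0"
    by (rule higher_deriv_cong_ev[OF _ refl])
       (use df eventually_nhds_in_open[OF open_ball z0] in \<open>auto elim!: eventually_mono\<close>)
  also have "\<dots> = (\<Sum>k = 0..d. of_nat (d choose k) * (deriv ^^ k) (deriv g) 0 * (deriv ^^ (d - k)) f 0)"
    by (rule higher_deriv_mult[OF holomorphic_deriv[OF hol open_ball] holf open_ball z0])
  also have "\<dots> = (\<Sum>k\<le>d. of_nat (d choose k) * ((deriv ^^ Suc k) g 0 * (deriv ^^ (d - k)) f 0))"
    by (simp add: atLeast0AtMost funpow_swap1 mult.assoc)
  finally show ?thesis .
qed

section \<open>Convergence of the free energy\<close>

lemma norm_conj_trace_regular:
  assumes "regular_sequence M \<phi> A" "regular_sequence M \<psi> B" "M \<ge> 0" "N \<ge> 1" "is_unitary_haar N \<kappa>" "U \<in> unitary_group N"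
  shows "cmod (mat_trace (A N * U * B N * mat_adjoint U)) \<le> of_nat N * M\<^sup>2"
proof -
  interpret unitary_haar N \<kappa> by unfold_locales (rule assms(5))
  show ?thesis by (rule norm_trace_conj_le) (use assms in \<open>auto simp: regular_sequence_def\<close>)
qed

lemma free_energy_coeff_limit:
  assumes regA: "regular_sequence M \<phi> A" and regB: "regular_sequence M \<psi> B" and M: "M \<ge> 0"
    and \<kappa>: "\<And>N. N \<ge> 1 \<Longrightarrow> is_unitary_haar N (\<kappa> N)" and \<epsilon>: "\<epsilon> > 0"
    and F: "\<And>N. N \<ge> 1 \<Longrightarrow> is_hciz_free_energy (\<kappa> N) N (A N) (B N) (ball 0 \<epsilon>) (F N)" and d: "d \<ge> 1"
  shows "(\<lambda>N. (deriv ^^ d) (F N) 0) \<longlonglongrightarrow> hciz_coeff_0 d \<phi> \<psi>"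
proof -
  let ?S = "{1..d}"
  define v where "v = (\<lambda>N k. mat_trace (A N ^\<^sub>m k) / of_nat N)"
  define w where "w = (\<lambda>N k. mat_trace (B N ^\<^sub>m k) / of_nat N)"
  have vlim: "(\<lambda>N. v N k) \<longlonglongrightarrow> \<phi> k" and wlim: "(\<lambda>N. w N k) \<longlonglongrightarrow> \<psi> k" if "k \<ge> 1" for k
    using regA regB that by (auto simp: regular_sequence_def v_def w_def)
  let ?c = "\<lambda>N. conn_series (\<lambda>k. of_nat N * v N k) (\<lambda>k. of_nat N * w N k) ?S (- 1 / of_nat N) / (of_nat N)\<^sup>2"
  have "?c \<longlonglongrightarrow> (\<Sum>r. \<Sum>X\<in>planar_structs ?S r. (-1) ^ r * struct_weight \<phi> \<psi> ?S X)"
    by (rule conn_series_genus_limit[OF vlim wlim]) (use d in auto)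
  then have lim: "(\<lambda>N. (-1) ^ d * ?c N) \<longlonglongrightarrow> hciz_coeff_0 d \<phi> \<psi>"
    unfolding hciz_coeff_0_eq_planar[OF d] by (rule tendsto_mult_left)
  \<comment> \<open>For fixed d this is an exact identity, valid in the range where
    \<open>trace_moment\<close> applies to all subsets of \<open>{1..d}\<close>.\<close>
  have "(-1) ^ d * ?c N = (deriv ^^ d) (F N) 0" if N: "N > d\<^sup>2" for N
  proof -
    have N1: "N \<ge> 1" using N by simp
    have carrier: "A N \<in> carrier_mat N N" "B N \<in> carrier_mat N N"
      using regA regB N1 by (auto simp: regular_sequence_def)
    interpret unitary_haar_conj N "\<kappa> N" "B N"
      by unfold_locales (rule \<kappa>[OF N1], rule carrier)
    let ?T = "\<lambda>U. mat_trace (A N * U * B N * mat_adjoint U)"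
    let ?I = "hciz (\<kappa> N) N (A N) (B N)"
    let ?g = "\<lambda>z. (of_nat N)\<^sup>2 * F N z"
    have bd: "cmod (?T U) \<le> of_nat N * M\<^sup>2" if "U \<in> unitary_group N" for U
      by (rule norm_conj_trace_regular[OF regA regB M N1 \<kappa>[OF N1] that])
    have holF: "F N holomorphic_on ball 0 \<epsilon>" and eq: "\<And>z. z \<in> ball 0 \<epsilon> \<Longrightarrow> ?I z = exp (?g z)"
      using F[OF N1] by (auto simp: is_hciz_free_energy_def)
    have holg: "?g holomorphic_on ball 0 \<epsilon>" by (intro holomorphic_intros holF)
    \<comment> \<open>The signs come from exp(-z N ...). With (-1)^k removed, \<open>m\<close> holds
      the moments, whose factor N^k cancels the N^(-k) in \<open>trace_moment\<close>, and
      \<open>f\<close> holds the derivatives of N^2 F_N.\<close>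
    define m where "m = (\<lambda>k. of_nat N ^ k * (\<integral>U. ?T U ^ k \<partial>\<kappa> N))"
    define f where "f = (\<lambda>k. (-1) ^ k * (deriv ^^ k) ?g 0)"
    have dI: "(deriv ^^ k) ?I 0 = (-1) ^ k * m k" for k
      using hciz_derivatives(1)[OF carrier(1) bd, of k] by (simp add: m_def power_minus[of "of_nat N"])
    have vw: "(\<lambda>k. of_nat N * v N k) = (\<lambda>k. mat_trace (A N ^\<^sub>m k))" "(\<lambda>k. of_nat N * w N k) = (\<lambda>k. mat_trace (B N ^\<^sub>m k))"
      using N1 by (auto simp: v_def w_def)
    have "conn_series (\<lambda>k. of_nat N * v N k) (\<lambda>k. of_nat N * w N k) ?S (- 1 / of_nat N) = f (card ?S)"
    proof (rule conn_series_eq_cumulant[where m = m])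
      show "cmod (- 1 / of_nat N) * (card ?S)\<^sup>2 < 1"
        using N by (simp add: norm_divide field_simps flip: of_nat_power)
      fix T assume T: "T \<subseteq> ?S"
      have fT: "finite T" by (rule finite_subset[OF T]) simp
      have "(card T)\<^sup>2 \<le> d\<^sup>2" using card_mono[OF _ T] by (intro power_mono) auto
      then have "(card T)\<^sup>2 < N" by (rule le_less_trans[OF _ N])
      from trace_moment[OF carrier(1) fT this]
      show "struct_series (\<lambda>k. of_nat N * v N k) (\<lambda>k. of_nat N * w N k) T (- 1 / of_nat N) = m (card T)"
        using N1 unfolding vw struct_series_def m_def by (simp add: power_one_over)
    next
      show "m 0 = 1" by (simp add: m_def prob_space)
    next
      fix e
      have "(-1) ^ Suc e * m (Suc e) = (\<Sum>k\<le>e. of_nat (e choose k) * ((deriv ^^ Suc k) ?g 0 * ((-1) ^ (e - k) * m (e - k))))"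
        using higher_deriv_exp_rec[OF holg \<epsilon> eq, of e] unfolding dI .
      then have "(-1) ^ Suc e * ((-1) ^ Suc e * m (Suc e)) =
        (-1) ^ Suc e * (\<Sum>k\<le>e. of_nat (e choose k) * ((deriv ^^ Suc k) ?g 0 * ((-1) ^ (e - k) * m (e - k))))" by (rule arg_cong)
      also have "(-1) ^ Suc e * ((-1) ^ Suc e * m (Suc e)) = m (Suc e)"
        by (simp only: mult.assoc[symmetric] power_add[symmetric] mult_2[symmetric] power_mult) simp
      also have "(-1) ^ Suc e * (\<Sum>k\<le>e. of_nat (e choose k) * ((deriv ^^ Suc k) ?g 0 * ((-1) ^ (e - k) * m (e - k)))) =
         (\<Sum>k\<le>e. of_nat (e choose k) * (f (Suc k) * m (e - k)))"
        unfolding sum_distrib_left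
      proof (rule sum.cong[OF refl])
        fix k assume "k \<in> {..e}"
        then have "Suc e + (e - k) = Suc k + 2 * (e - k)" by simp
        then have "(-1 :: complex) ^ (Suc e + (e - k)) = (-1) ^ Suc k" by (simp only: power_add power_mult) simp
        then have sg: "(-1 :: complex) ^ Suc e * (-1) ^ (e - k) = (-1) ^ Suc k" by (simp only: power_add)
        have "(-1) ^ Suc e * (of_nat (e choose k) * ((deriv ^^ Suc k) ?g 0 * ((-1) ^ (e - k) * m (e - k)))) =
          of_nat (e choose k) * (((-1) ^ Suc e * (-1) ^ (e - k)) * (deriv ^^ Suc k) ?g 0 * m (e - k))" by (simp only: mult_ac)
        then show "(-1) ^ Suc e * (of_nat (e choose k) * ((deriv ^^ Suc k) ?g 0 * ((-1) ^ (e - k) * m (e - k)))) =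
          of_nat (e choose k) * (f (Suc k) * m (e - k))" unfolding sg f_def .
      qed
      finally show "m (Suc e) = (\<Sum>k\<le>e. of_nat (e choose k) * (f (Suc k) * m (e - k)))" .
    qed (use d in auto)
    also have "f (card ?S) = (-1) ^ d * ((of_nat N)\<^sup>2 * (deriv ^^ d) (F N) 0)"
      using higher_deriv_cmult[OF holF _ open_ball, of 0 d "(of_nat N)\<^sup>2"] \<epsilon> by (simp add: f_def)
    finally have c: "conn_series (\<lambda>k. of_nat N * v N k) (\<lambda>k. of_nat N * w N k) ?S (- 1 / of_nat N) =
      (-1) ^ d * ((of_nat N)\<^sup>2 * (deriv ^^ d) (F N) 0)" .
    show ?thesis unfolding c using N1 by (simp flip: mult.assoc power_add power_mult_distrib)
  qed
  then show ?thesis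
    by (intro Lim_transform_eventually[OF lim] eventually_mono[OF eventually_gt_at_top[of "d\<^sup>2"]])
qed

text \<open>A disc is contractible, so a holomorphic logarithm exists. The real part of N^2 F_N is
  log |I_N|, at most |z| N^2 M^2, whence a bound free of N; the added 1 makes it strict and the
  constant positive even for M = 0.\<close>

lemma free_energy_exists:
  assumes regA: "regular_sequence M \<phi> A" and regB: "regular_sequence M \<psi> B" and M: "M \<ge> 0"
    and N: "N \<ge> 1" and \<kappa>: "is_unitary_haar N \<kappa>" and \<epsilon>: "\<epsilon> > 0"
    and nz: "\<And>z. z \<in> ball 0 \<epsilon> \<Longrightarrow> hciz \<kappa> N (A N) (B N) z \<noteq> 0"
  shows "\<exists>F. is_hciz_free_energy \<kappa> N (A N) (B N) (ball 0 \<epsilon>) F"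
    and "\<And>F z. is_hciz_free_energy \<kappa> N (A N) (B N) (ball 0 \<epsilon>) F \<Longrightarrow> z \<in> ball 0 \<epsilon> \<Longrightarrow> Re (F z) < \<epsilon> * M\<^sup>2 + 1"
proof -
  have carrier: "A N \<in> carrier_mat N N" "B N \<in> carrier_mat N N"
    using regA regB N by (auto simp: regular_sequence_def)
  interpret unitary_haar_conj N \<kappa> "B N" by unfold_locales (rule \<kappa>, rule carrier)
  note bd = norm_conj_trace_regular[OF regA regB M N \<kappa>]
  let ?I = "hciz \<kappa> N (A N) (B N)"
  have N0: "(of_nat N :: complex) \<noteq> 0" using N by simp
  have hol: "?I holomorphic_on ball 0 \<epsilon>" by (rule hciz_derivatives(2)[OF carrier(1) bd])
  obtain g where g: "g holomorphic_on ball 0 \<epsilon>" "\<And>z. z \<in> ball 0 \<epsilon> \<Longrightarrow> ?I z = exp (g z)"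
    using contractible_imp_holomorphic_log[OF hol convex_imp_contractible[OF convex_ball] nz] by metis
  have "exp (g 0) = 1" using g(2)[of 0] hciz_derivatives(3)[OF carrier(1) bd] \<epsilon> by simp
  \<comment> \<open>Subtracting \<open>g 0\<close> normalises the value at 0 and, as exp (g 0) = 1,
    leaves the exponential unchanged.\<close>
  then have "is_hciz_free_energy \<kappa> N (A N) (B N) (ball 0 \<epsilon>) (\<lambda>z. (g z - g 0) / (of_nat N)\<^sup>2)"
    unfolding is_hciz_free_energy_def using g N0 by (auto intro!: holomorphic_intros simp: exp_diff)
  then show "\<exists>F. is_hciz_free_energy \<kappa> N (A N) (B N) (ball 0 \<epsilon>) F" by blast
  fix F :: "complex \<Rightarrow> complex" and z :: complex assume F: "is_hciz_free_energy \<kappa> N (A N) (B N) (ball 0 \<epsilon>) F" and z: "z \<in> ball 0 \<epsilon>"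
  have "exp (Re ((of_nat N)\<^sup>2 * F z)) = cmod (?I z)" using F z by (simp add: is_hciz_free_energy_def)
  also have "\<dots> \<le> exp (cmod z * of_nat N * (of_nat N * M\<^sup>2))" by (rule norm_hciz_le[OF carrier(1) bd])
  finally have "Re ((of_nat N)\<^sup>2 * F z) \<le> cmod z * of_nat N * (of_nat N * M\<^sup>2)" by simp
  moreover have "Re ((of_nat N)\<^sup>2 * F z) = (of_nat N)\<^sup>2 * Re (F z)"
  proof -
    have "(of_nat N)\<^sup>2 * F z = complex_of_real ((real N)\<^sup>2) * F z" by simp
    then show ?thesis by (simp del: of_real_power)
  qed
  ultimately have "(of_nat N)\<^sup>2 * Re (F z) \<le> (of_nat N)\<^sup>2 * (cmod z * M\<^sup>2)"
    by (simp add: power2_eq_square mult_ac)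
  then have "Re (F z) \<le> cmod z * M\<^sup>2" using N by simp
  also have "\<dots> \<le> \<epsilon> * M\<^sup>2" using z by (intro mult_right_mono) auto
  finally show "Re (F z) < \<epsilon> * M\<^sup>2 + 1" by simp
qed

theorem theorem0p4:
  fixes M :: real
    and \<phi> \<psi> :: "nat \<Rightarrow> complex"
    and A B :: "nat \<Rightarrow> complex mat"
    and \<kappa> :: "nat \<Rightarrow> complex mat measure"
  assumes "M \<ge> 0"
    and "regular_sequence M \<phi> A"
    and "regular_sequence M \<psi> B"
    and "\<And>N. N \<ge> 1 \<Longrightarrow> is_unitary_haar N (\<kappa> N)"
    and "0 \<notin> closure (\<Union>N\<in>{1..}. {z. hciz (\<kappa> N) N (A N) (B N) z = 0})"
  shows "\<exists>D F. open D \<and> connected D \<and> simply_connected D \<and> 0 \<in> D \<and> D \<subseteq> hciz_disc M \<and>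
    (\<forall>N\<ge>1. is_hciz_free_energy (\<kappa> N) N (A N) (B N) D (F N)) \<and>
    (\<forall>z\<in>D. summable (hciz_limit_term \<phi> \<psi> z)) \<and>
    (\<forall>K. compact K \<and> K \<subseteq> D \<longrightarrow> uniform_limit K F (hciz_limit \<phi> \<psi>) sequentially)"
proof -
  let ?Z = "\<Union>N\<in>{1..}. {z. hciz (\<kappa> N) N (A N) (B N) z = 0}"
  have "0 \<in> - closure ?Z" using assms(5) by simp
  then obtain \<epsilon> where \<epsilon>: "\<epsilon> > 0" and sub: "ball 0 \<epsilon> \<subseteq> - closure ?Z"
    by (rule openE[OF open_Compl[OF closed_closure]])
  have nz: "hciz (\<kappa> N) N (A N) (B N) z \<noteq> 0" if "N \<ge> 1" "z \<in> ball 0 \<epsilon>" for N z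
  proof -
    have "z \<notin> ?Z" using subsetD[OF sub that(2)] subsetD[OF closure_subset, of z ?Z] by (simp only: Compl_iff) metis
    then show ?thesis using that(1) by simp
  qed
  have "\<exists>F. N \<ge> 1 \<longrightarrow> is_hciz_free_energy (\<kappa> N) N (A N) (B N) (ball 0 \<epsilon>) F" for N
  proof (cases "N \<ge> 1")
    case True
    show ?thesis using free_energy_exists(1)[OF assms(2,3,1) True assms(4)[OF True] \<epsilon> nz[OF True]] by simp
  qed simp
  then obtain F where F: "\<And>N. N \<ge> 1 \<Longrightarrow> is_hciz_free_energy (\<kappa> N) N (A N) (B N) (ball 0 \<epsilon>) (F N)" by metis
  define C where "C = \<epsilon> * M\<^sup>2 + 1"
  have C: "C > 0" using \<epsilon> by (simp add: C_def add_nonneg_pos)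
  have holF: "F N holomorphic_on ball 0 \<epsilon>" and F0: "F N 0 = 0" if "N \<ge> 1" for N
    using F[OF that] by (auto simp: is_hciz_free_energy_def)
  have bound: "cmod (F N z) \<le> 2 * C" if N: "N \<ge> 1" and z: "cmod z \<le> \<epsilon> / 2" for N z
  proof (rule norm_le_of_Re_less[OF holF[OF N] F0[OF N] _ \<epsilon> C z])
    fix z :: complex assume z: "z \<in> ball 0 \<epsilon>"
    show "Re (F N z) < C"
      unfolding C_def by (rule free_energy_exists(2)[OF assms(2,3,1) N assms(4)[OF N] \<epsilon> nz[OF N] F[OF N] z])
  qed
  \<comment> \<open>The bound on \<open>F\<close> holds up to radius \<open>\<epsilon> / 2\<close>,
    and \<open>holomorphic_sequence_limit\<close> wants it on twice the final radius. The second
    term keeps R M^2 at most 1/27 and is meaningful for M = 0 as well.\<close>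
  define R where "R = min (\<epsilon> / 4) (1 / (27 * (M\<^sup>2 + 1)))"
  have M1: "M\<^sup>2 + 1 > 0" by (simp add: add_nonneg_pos)
  have R: "R > 0" "2 * R \<le> \<epsilon> / 2" "R \<le> 1 / (27 * (M\<^sup>2 + 1))"
    using \<epsilon> M1 by (auto simp: R_def)
  have RM: "R * M\<^sup>2 < 2 / 27"
  proof -
    have "R * M\<^sup>2 \<le> 1 / (27 * (M\<^sup>2 + 1)) * (M\<^sup>2 + 1)" using R by (intro mult_mono) auto
    also have "\<dots> = 1 / 27" using M1 by (simp add: field_simps)
    finally show ?thesis by simp
  qed
  \<comment> \<open>The constant term is set to 0 to match F 0 = 0; the formula for
    \<open>hciz_coeff_0\<close> would give 1 at degree 0, from the empty partitions.\<close>
  define c where "c = (\<lambda>d. if d = 0 then 0 else hciz_coeff_0 d \<phi> \<psi>)"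
  have lim: "(\<lambda>N. (deriv ^^ d) (F N) 0) \<longlonglongrightarrow> c d" for d
  proof (cases "d = 0")
    case True
    have "\<forall>\<^sub>F N in sequentially. (deriv ^^ d) (F N) 0 = c d"
      using eventually_ge_at_top[of 1] by eventually_elim (simp add: True F0 c_def)
    then show ?thesis by (rule tendsto_eventually)
  next
    case False
    then show ?thesis using free_energy_coeff_limit[OF assms(2,3,1,4) \<epsilon> F, of d] by (simp add: c_def)
  qed
  have hol2: "F N holomorphic_on ball 0 (2 * R)" if "N \<ge> 1" for N
    by (rule holomorphic_on_subset[OF holF[OF that]]) (use R \<epsilon> in auto)
  have bd2: "cmod (F N z) \<le> 2 * C" if "N \<ge> 1" "z \<in> ball 0 (2 * R)" for N z
    by (rule bound[OF that(1)]) (use that(2) R in simp)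
  note seq = holomorphic_sequence_limit[OF R(1) hol2 bd2 lim]
  have sm: "summable (hciz_limit_term \<phi> \<psi> z)" and eq: "hciz_limit \<phi> \<psi> z = (\<Sum>d. c d / fact d * z ^ d)"
    if z: "z \<in> ball 0 R" for z
  proof -
    have s: "summable (\<lambda>d. c d / fact d * z ^ d)" by (rule seq(1)) (use z in auto)
    have t: "hciz_limit_term \<phi> \<psi> z = (\<lambda>n. c (Suc n) / fact (Suc n) * z ^ Suc n)"
      unfolding hciz_limit_term_def c_def by (simp only: if_False nat.simps times_divide_eq_left)
    show "summable (hciz_limit_term \<phi> \<psi> z)"
      unfolding t by (rule summable_Suc_iff[THEN iffD2, OF s])
    show "hciz_limit \<phi> \<psi> z = (\<Sum>d. c d / fact d * z ^ d)"
      unfolding hciz_limit_def t using suminf_split_head[OF s] by (simp add: c_def)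
  qed
  show ?thesis
  proof (intro exI[of _ "ball 0 R"] exI[of _ F] conjI allI impI ballI)
    show "simply_connected (ball (0 :: complex) R)" by (rule convex_imp_simply_connected[OF convex_ball])
    show "ball 0 R \<subseteq> hciz_disc M"
    proof
      fix z :: complex assume "z \<in> ball 0 R"
      then have "cmod z * M\<^sup>2 \<le> R * M\<^sup>2" by (intro mult_right_mono) auto
      then show "z \<in> hciz_disc M" using RM by (simp add: hciz_disc_def)
    qed
    fix N :: nat assume "N \<ge> 1"
    then show "is_hciz_free_energy (\<kappa> N) N (A N) (B N) (ball 0 R) (F N)"
      using F[of N] R \<epsilon> unfolding is_hciz_free_energy_def by (auto intro: holomorphic_on_subset)
  next
    fix K :: "complex set" assume K: "compact K \<and> K \<subseteq> ball 0 R"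
    then have "uniform_limit K F (\<lambda>z. \<Sum>d. c d / fact d * z ^ d) sequentially"
      by (intro seq(2)) auto
    then show "uniform_limit K F (hciz_limit \<phi> \<psi>) sequentially"
      by (rule uniform_limit_cong'[THEN iffD1, rotated 2]) (use eq K in auto)
  qed (use R sm in auto)
qed

end
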